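(* Let $u$ be a physically realizable weak solution of the 2D Euler equations on $\mathbb{T}^2$ with initial velocity $u_0$, having a physical realization $\{u^\varepsilon\}_{\varepsilon>0}$ that satisfies admissible sparse stability. Then $u$ is conservative, i.e. $\|u(t)\|_{L^2(\mathbb{T}^2)}=\|u_0\|_{L^2(\mathbb{T}^2)}$ for $t\in[0,T]$.
   Context: $\mathbb{T}^2\equiv[0,2\pi]^2$ (periodic). $u\in C(0,T;L^2(\mathbb{T}^2))$, $u_0\in L^2(\mathbb{T}^2)$; $u$ is physically realizable with initial velocity $u_0$ if there is a family $\{u^\varepsilon\}_{\varepsilon>0}$ of solutions of the Navier–Stokes equations on $\mathbb{T}^2$ with viscosity $\varepsilon$ ($u^\varepsilon_t+u^\varepsilon\cdot\nabla u^\varepsilon+\nabla p^\varepsilon=\varepsilon\Delta u^\varepsilon$, $\operatorname{div}u^\varepsilon=0$) with $u^\varepsilon\rightharpoonup u$ weakly-* in $L^\infty(0,T;L^2(\mathbb{T}^2))$ and $u^\varepsilon_0\to u_0$ strongly in $L^2(\mathbb{T}^2)$; such a family is a physical realization. Vorticity: $\omega^\varepsilon=\partial_1u^\varepsilon_2-\partial_2u^\varepsilon_1$. Sparse notions on $Q_0=\mathbb{T}^2$: $\mathcal{D}(Q_0)$ are the dyadic subsquares of $Q_0$; a countable $\mathcal{Q}=(Q_i)\subset\mathcal{D}(Q_0)$ is sparse if there are pairwise disjoint measurable $E_{Q_i}\subseteq Q_i$ with $|E_{Q_i}|\ge\frac12|Q_i|$; $S(Q_0)$ is the set of these families. For $f\in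 L^1(\mathbb{T}^2)$ and $N\in\mathbb{N}$, $s_N(f)=\sup_{\mathcal{Q}\in S(Q_0)}\big[\sum_{Q\in\mathcal{Q},\,\ell(Q)\le 2^{-(N-1)}\ell(Q_0)}\big(\int_Q|f|\big)^2\big]^{1/2}$. A decay is a positive decreasing $\Psi$ on $[0,\infty)$ with $\Psi(t)\to0$; it is admissible if $\sum_{r=0}^N(2^r\Psi(r))^2\le C(2^N\Psi(N))^2$ for all $N\in\mathbb{N}_0$. $S_\Psi(\mathbb{T}^2)$ is normed by $\sup_{N\in\mathbb{N}}s_N(f)/\Psi(N)$. The realization satisfies admissible sparse stability if there is an admissible decay $\Psi$ with $\sup_{\varepsilon>0}\|\omega^\varepsilon\|_{C(0,T;S_\Psi(\mathbb{T}^2))}<\infty$. *)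

theory Defs
  imports "HOL-Analysis.Analysis"
begin

section \<open>Setting: the torus T^2 = [0,2pi]^2 with periodic functions\<close>

type_synonym pt = "real \<times> real"

definition Q0 :: "pt set" where
  "Q0 = cbox (0, 0) (2 * pi, 2 * pi)"

definition periodic2 :: "(pt \<Rightarrow> 'b) \<Rightarrow> bool" where
  "periodic2 f \<longleftrightarrow> (\<forall>x. f (x + (2 * pi, 0)) = f x \<and> f (x + (0, 2 * pi)) = f x)"

definition dt :: "(real \<Rightarrow> pt \<Rightarrow> real) \<Rightarrow> real \<Rightarrow> pt \<Rightarrow> real" where
  "dt f t x = deriv (\<lambda>s. f s x) t"

definition d1 :: "(real \<Rightarrow> pt \<Rightarrow> real) \<Rightarrow> real \<Rightarrow> pt \<Rightarrow> real" where
  "d1 f t x = deriv (\<lambda>s. f t (s, snd x)) (fst x)"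

definition d2 :: "(real \<Rightarrow> pt \<Rightarrow> real) \<Rightarrow> real \<Rightarrow> pt \<Rightarrow> real" where
  "d2 f t x = deriv (\<lambda>s. f t (fst x, s)) (snd x)"

definition spatialC1 :: "(real \<times> pt) set \<Rightarrow> (real \<Rightarrow> pt \<Rightarrow> real) \<Rightarrow> bool" where
  "spatialC1 S f \<longleftrightarrow>
     continuous_on S (\<lambda>(t, x). f t x) \<and>
     (\<forall>(t, x)\<in>S. (\<lambda>s. f t (s, snd x)) differentiable (at (fst x)) \<and>
                  (\<lambda>s. f t (fst x, s)) differentiable (at (snd x))) \<and>
     continuous_on S (\<lambda>(t, x). d1 f t x) \<and> continuous_on S (\<lambda>(t, x). d2 f t x)"

definition timeC1 :: "(real \<times> pt) set \<Rightarrow> (real \<Rightarrow> pt \<Rightarrow> real) \<Rightarrow> bool" where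
  "timeC1 S f \<longleftrightarrow>
     (\<forall>(t, x)\<in>S. (\<lambda>s. f s x) differentiable (at t)) \<and>
     continuous_on S (\<lambda>(t, x). dt f t x)"

definition C12 :: "(real \<times> pt) set \<Rightarrow> (real \<Rightarrow> pt \<Rightarrow> real) \<Rightarrow> bool" where
  "C12 S f \<longleftrightarrow> timeC1 S f \<and> spatialC1 S f \<and> spatialC1 S (d1 f) \<and> spatialC1 S (d2 f)"

definition L2_field :: "(pt \<Rightarrow> real \<times> real) \<Rightarrow> bool" where
  "L2_field v \<longleftrightarrow> periodic2 v \<and> v \<in> borel_measurable lborel \<and>
     set_integrable lborel Q0 (\<lambda>x. (norm (v x))\<^sup>2)"

definition L2norm :: "(pt \<Rightarrow> real \<times> real) \<Rightarrow> real" where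
  "L2norm v = sqrt (LINT x:Q0|lborel. (norm (v x))\<^sup>2)"

definition CL2 :: "real \<Rightarrow> (real \<Rightarrow> pt \<Rightarrow> real \<times> real) \<Rightarrow> bool" where
  "CL2 T u \<longleftrightarrow> (\<forall>t\<in>{0..T}. L2_field (u t)) \<and>
     (\<forall>t\<in>{0..T}. ((\<lambda>s. L2norm (\<lambda>x. u s x - u t x)) \<longlongrightarrow> 0) (at t within {0..T}))"

definition NS_solution ::
  "real \<Rightarrow> real \<Rightarrow> (real \<Rightarrow> pt \<Rightarrow> real \<times> real) \<Rightarrow> (real \<Rightarrow> pt \<Rightarrow> real) \<Rightarrow> bool" where
  "NS_solution eps T v p \<longleftrightarrow>
     (let v1 = (\<lambda>t x. fst (v t x)); v2 = (\<lambda>t x. snd (v t x)); S = {0<..<T} \<times> UNIV in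
       CL2 T v \<and> (\<forall>t\<in>{0<..<T}. periodic2 (p t)) \<and>
       C12 S v1 \<and> C12 S v2 \<and> spatialC1 S p \<and>
       (\<forall>(t, x)\<in>S.
          dt v1 t x + v1 t x * d1 v1 t x + v2 t x * d2 v1 t x + d1 p t x
            = eps * (d1 (d1 v1) t x + d2 (d2 v1) t x) \<and>
          dt v2 t x + v1 t x * d1 v2 t x + v2 t x * d2 v2 t x + d2 p t x
            = eps * (d1 (d1 v2) t x + d2 (d2 v2) t x) \<and>
          d1 v1 t x + d2 v2 t x = 0))"

definition vorticity :: "(real \<Rightarrow> pt \<Rightarrow> real \<times> real) \<Rightarrow> real \<Rightarrow> pt \<Rightarrow> real" where
  "vorticity v t x = d1 (\<lambda>t x. snd (v t x)) t x - d2 (\<lambda>t x. fst (v t x)) t x"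

definition euler_test :: "real \<Rightarrow> (real \<Rightarrow> pt \<Rightarrow> real \<times> real) \<Rightarrow> bool" where
  "euler_test T \<phi> \<longleftrightarrow>
     (let \<phi>1 = (\<lambda>t x. fst (\<phi> t x)); \<phi>2 = (\<lambda>t x. snd (\<phi> t x)) in
       timeC1 UNIV \<phi>1 \<and> spatialC1 UNIV \<phi>1 \<and> timeC1 UNIV \<phi>2 \<and> spatialC1 UNIV \<phi>2 \<and>
       (\<forall>t. periodic2 (\<phi> t)) \<and>
       (\<exists>\<delta>>0. \<forall>t\<ge>T - \<delta>. \<forall>x. \<phi> t x = 0) \<and>
       (\<forall>t x. d1 \<phi>1 t x + d2 \<phi>2 t x = 0))"

definition euler_weak ::
  "real \<Rightarrow> (real \<Rightarrow> pt \<Rightarrow> real \<times> real) \<Rightarrow> (pt \<Rightarrow> real \<times> real) \<Rightarrow> bool" where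
  "euler_weak T u u0 \<longleftrightarrow>
     CL2 T u \<and> L2_field u0 \<and>
     (\<forall>t\<in>{0..T}. \<forall>\<psi>::pt \<Rightarrow> real. spatialC1 UNIV (\<lambda>_. \<psi>) \<and> periodic2 \<psi> \<longrightarrow>
        (LINT x:Q0|lborel. inner (u t x) (d1 (\<lambda>_. \<psi>) t x, d2 (\<lambda>_. \<psi>) t x)) = 0) \<and>
     (\<forall>\<phi>. euler_test T \<phi> \<longrightarrow>
        (let \<phi>1 = (\<lambda>t x. fst (\<phi> t x)); \<phi>2 = (\<lambda>t x. snd (\<phi> t x)) in
          (LINT t:{0..T}|lborel. LINT x:Q0|lborel.
              inner (u t x) (dt \<phi>1 t x, dt \<phi>2 t x)
            + fst (u t x) * fst (u t x) * d1 \<phi>1 t x + fst (u t x) * snd (u t x) * d2 \<phi>1 t x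
            + snd (u t x) * fst (u t x) * d1 \<phi>2 t x + snd (u t x) * snd (u t x) * d2 \<phi>2 t x)
          + (LINT x:Q0|lborel. inner (u0 x) (\<phi> 0 x)) = 0))"

definition L1L2 :: "real \<Rightarrow> (real \<Rightarrow> pt \<Rightarrow> real \<times> real) \<Rightarrow> bool" where
  "L1L2 T g \<longleftrightarrow> (\<lambda>(t, x). g t x) \<in> borel_measurable lborel \<and>
     (AE t in lborel. t \<in> {0..T} \<longrightarrow> set_integrable lborel Q0 (\<lambda>x. (norm (g t x))\<^sup>2)) \<and>
     set_integrable lborel {0..T} (\<lambda>t. L2norm (g t))"

definition pairing :: "real \<Rightarrow> (real \<Rightarrow> pt \<Rightarrow> real \<times> real) \<Rightarrow> (real \<Rightarrow> pt \<Rightarrow> real \<times> real) \<Rightarrow> real" where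
  "pairing T u g = (LINT t:{0..T}|lborel. LINT x:Q0|lborel. inner (u t x) (g t x))"

text \<open>Weak-* convergence in L^infty(0,T;L^2(T^2)) = (L^1(0,T;L^2(T^2)))^*, as eps -> 0+.\<close>
definition weak_star_conv ::
  "real \<Rightarrow> (real \<Rightarrow> real \<Rightarrow> pt \<Rightarrow> real \<times> real) \<Rightarrow> (real \<Rightarrow> pt \<Rightarrow> real \<times> real) \<Rightarrow> bool" where
  "weak_star_conv T ue u \<longleftrightarrow>
     (\<forall>g. L1L2 T g \<longrightarrow> ((\<lambda>eps. pairing T (ue eps) g) \<longlongrightarrow> pairing T u g) (at_right 0))"

definition physical_realization ::
  "real \<Rightarrow> (real \<Rightarrow> pt \<Rightarrow> real \<times> real) \<Rightarrow> (pt \<Rightarrow> real \<times> real) \<Rightarrow>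
   (real \<Rightarrow> real \<Rightarrow> pt \<Rightarrow> real \<times> real) \<Rightarrow> (real \<Rightarrow> real \<Rightarrow> pt \<Rightarrow> real) \<Rightarrow> bool" where
  "physical_realization T u u0 ue pe \<longleftrightarrow>
     (\<forall>eps>0. NS_solution eps T (ue eps) (pe eps)) \<and>
     weak_star_conv T ue u \<and>
     ((\<lambda>eps. L2norm (\<lambda>x. ue eps 0 x - u0 x)) \<longlongrightarrow> 0) (at_right 0)"

definition dyadic_square :: "nat \<Rightarrow> nat \<Rightarrow> nat \<Rightarrow> pt set" where
  "dyadic_square j k1 k2 =
     cbox (2 * pi * real k1 / 2 ^ j, 2 * pi * real k2 / 2 ^ j)
          (2 * pi * (real k1 + 1) / 2 ^ j, 2 * pi * (real k2 + 1) / 2 ^ j)"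

definition dyadic_squares :: "pt set set" where
  "dyadic_squares = {dyadic_square j k1 k2 | j k1 k2. k1 < 2 ^ j \<and> k2 < 2 ^ j}"

definition sidelen :: "pt set \<Rightarrow> real" where
  "sidelen Q = sqrt (measure lborel Q)"

definition sparse_family :: "pt set set \<Rightarrow> bool" where
  "sparse_family \<Q> \<longleftrightarrow> \<Q> \<subseteq> dyadic_squares \<and> countable \<Q> \<and>
     (\<exists>E. (\<forall>Q\<in>\<Q>. E Q \<in> sets lborel \<and> E Q \<subseteq> Q \<and> measure lborel (E Q) \<ge> measure lborel Q / 2)
          \<and> disjoint_family_on E \<Q>)"

definition ennsqrt :: "ennreal \<Rightarrow> ennreal" where
  "ennsqrt a = (if a = \<infinity> then \<infinity> else ennreal (sqrt (enn2real a)))"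

definition sN :: "(pt \<Rightarrow> real) \<Rightarrow> nat \<Rightarrow> ennreal" where
  "sN f N = (SUP \<Q>\<in>{\<Q>. sparse_family \<Q>}.
      ennsqrt (infsum (\<lambda>Q. (\<integral>\<^sup>+ x\<in>Q. ennreal \<bar>f x\<bar> \<partial>lborel)\<^sup>2)
               {Q\<in>\<Q>. sidelen Q \<le> 2 powr (- (real N - 1)) * sidelen Q0}))"

definition decay :: "(real \<Rightarrow> real) \<Rightarrow> bool" where
  "decay \<Psi> \<longleftrightarrow> (\<forall>t\<ge>0. \<Psi> t > 0) \<and> (\<forall>s t. 0 \<le> s \<longrightarrow> s \<le> t \<longrightarrow> \<Psi> t \<le> \<Psi> s) \<and>
     (\<Psi> \<longlongrightarrow> 0) at_top"

definition admissible_decay :: "(real \<Rightarrow> real) \<Rightarrow> bool" where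
  "admissible_decay \<Psi> \<longleftrightarrow> decay \<Psi> \<and>
     (\<exists>C. \<forall>N::nat. (\<Sum>r\<le>N. (2 ^ r * \<Psi> (real r))\<^sup>2) \<le> C * (2 ^ N * \<Psi> (real N))\<^sup>2)"

definition SPsi_norm :: "(real \<Rightarrow> real) \<Rightarrow> (pt \<Rightarrow> real) \<Rightarrow> ennreal" where
  "SPsi_norm \<Psi> f = (SUP N\<in>{1::nat..}. sN f N / ennreal (\<Psi> (real N)))"

definition in_SPsi :: "(real \<Rightarrow> real) \<Rightarrow> (pt \<Rightarrow> real) \<Rightarrow> bool" where
  "in_SPsi \<Psi> f \<longleftrightarrow> periodic2 f \<and> set_integrable lborel Q0 f \<and> SPsi_norm \<Psi> f < \<infinity>"

text \<open>Admissible sparse stability of a realization (vorticity taken for 0 < t < T,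
  where the Navier--Stokes solutions are classical).\<close>
definition admissible_sparse_stability ::
  "real \<Rightarrow> (real \<Rightarrow> real \<Rightarrow> pt \<Rightarrow> real \<times> real) \<Rightarrow> bool" where
  "admissible_sparse_stability T ue \<longleftrightarrow>
     (\<exists>\<Psi>. admissible_decay \<Psi> \<and>
        (\<exists>M::real. \<forall>eps>0.
           (\<forall>t\<in>{0<..<T}. in_SPsi \<Psi> (vorticity (ue eps) t)) \<and>
           (\<forall>t\<in>{0<..<T}. ((\<lambda>s. SPsi_norm \<Psi> (\<lambda>x. vorticity (ue eps) s x - vorticity (ue eps) t x))
                              \<longlongrightarrow> 0) (at t within {0<..<T})) \<and>
           (\<forall>t\<in>{0<..<T}. SPsi_norm \<Psi> (vorticity (ue eps) t) \<le> ennreal M)))"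

end

theory Submission
  imports Defs
begin

text \<open>
  For a divergence-free \<open>v\<close> on the torus with vorticity \<open>w\<close>, the autocorrelation of \<open>v\<close> has
  the autocorrelation of \<open>w\<close> as its negative Laplacian. Averaging against a rescaled radial bump and
  differentiating in the scale bounds the translation modulus \<open>\<parallel>v(\<cdot> + h) - v\<parallel>\<^sub>2\<close>, \<open>|h| \<sim> 2\<^sup>-\<^sup>N\<close>, by the sum
  of \<open>(\<integral>\<^sub>Q |w|)\<^sup>2\<close> over the dyadic squares \<open>Q\<close> of side at most \<open>2\<^sup>-\<^sup>N\<close>. Passing to principal squares
  dominates this sum by sparse sums, so sparse stability yields a modulus that is uniform in time and
  viscosity. The same autocorrelation gives \<open>\<parallel>w\<parallel>\<^sup>2 \<le> C r\<^sup>2 \<parallel>\<nabla>w\<parallel>\<^sup>2 + o(1) / r\<^sup>2\<close>; inserted in the enstrophy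
  balance with \<open>r\<^sup>2 \<sim> \<epsilon>\<close> it shows that \<open>\<epsilon> \<parallel>w\<^sup>\<epsilon>(t)\<parallel>\<^sup>2 \<rightarrow> 0\<close> for every \<open>t > 0\<close>. Testing the equation with the
  (divergence-free) mollification of \<open>u\<^sup>\<epsilon>(t) - u\<^sup>\<epsilon>(s)\<close> gives equicontinuity in time up to \<open>t = 0\<close>, hence no
  energy is lost near the initial time, weak convergence holds at each time, and by the uniform
  spatial modulus it preserves the \<open>L\<^sup>2\<close> norm.
\<close>

section \<open>Calculus on the torus\<close>

text \<open>The available regularity shapes the argument. Solutions are C^1 in time and C^2 in space
  with C^1 pressure, and only for 0 < t < T. The vorticity is then merely C^1 in space, so its
  evolution equation has no classical meaning: the enstrophy balance comes from difference quotients
  of the velocity, and curl grad = 0 is used for the pressure in integrated form only. Correlations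
  serve the same purpose, since the correlation of two C^1 functions is C^2: each derivative may
  fall on either factor. The kernel is chosen so that y times \<open>kern\<close> is minus the
  gradient of \<open>bump ^ 3\<close>; this turns the scale derivative of an average into the
  integral of a Laplacian. In the plane, squares of integrals of |w| scale like kinetic energy,
  hence sums over dyadic levels carry no weight in the side length. The obstacle at t = 0 is that
  the enstrophy bound degenerates like 1 / (e t). It still gives e times the L^1 norm of w of order
  t^(-1/2), which is integrable and controls the initial layer.\<close>

definition has_partials :: "(pt \<Rightarrow> real) \<Rightarrow> (pt \<Rightarrow> real) \<Rightarrow> (pt \<Rightarrow> real) \<Rightarrow> bool" where
  "has_partials f f1 f2 \<longleftrightarrow>
     (\<forall>a b. ((\<lambda>s. f (s, b)) has_real_derivative f1 (a, b)) (at a)) \<and>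
     (\<forall>a b. ((\<lambda>s. f (a, s)) has_real_derivative f2 (a, b)) (at b)) \<and>
     continuous_on UNIV f \<and> continuous_on UNIV f1 \<and> continuous_on UNIV f2"

lemma has_partialsD:
  assumes "has_partials f f1 f2"
  shows "((\<lambda>s. f (s, b)) has_real_derivative f1 (a, b)) (at a)"
    and "((\<lambda>s. f (a, s)) has_real_derivative f2 (a, b)) (at b)"
    and "continuous_on UNIV f" "continuous_on UNIV f1" "continuous_on UNIV f2"
  using assms by (auto simp: has_partials_def)

lemma cont_int:
  fixes f :: "'a::euclidean_space \<Rightarrow> real"
  assumes "continuous_on UNIV f" shows "f integrable_on cbox a b"
  using assms continuous_on_subset integrable_continuous by blast

lemma cont_compose:
  assumes "continuous_on UNIV f" "continuous_on S g"
  shows "continuous_on S (\<lambda>x. f (g x))"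
  using assms continuous_on_compose2 by blast

lemma has_partials_add:
  assumes "has_partials f f1 f2" "has_partials g g1 g2"
  shows "has_partials (\<lambda>x. f x + g x) (\<lambda>x. f1 x + g1 x) (\<lambda>x. f2 x + g2 x)"
  using assms unfolding has_partials_def by (auto intro!: derivative_eq_intros continuous_intros)

lemma has_partials_diff:
  assumes "has_partials f f1 f2" "has_partials g g1 g2"
  shows "has_partials (\<lambda>x. f x - g x) (\<lambda>x. f1 x - g1 x) (\<lambda>x. f2 x - g2 x)"
  using assms unfolding has_partials_def by (auto intro!: derivative_eq_intros continuous_intros)

lemma has_partials_mult:
  assumes "has_partials f f1 f2" "has_partials g g1 g2"
  shows "has_partials (\<lambda>x. f x * g x) (\<lambda>x. f1 x * g x + f x * g1 x) (\<lambda>x. f2 x * g x + f x * g2 x)"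
  using assms unfolding has_partials_def by (auto intro!: derivative_eq_intros continuous_intros)

lemma has_partials_cmult:
  assumes "has_partials f f1 f2"
  shows "has_partials (\<lambda>x. c * f x) (\<lambda>x. c * f1 x) (\<lambda>x. c * f2 x)"
  using assms unfolding has_partials_def by (auto intro!: derivative_eq_intros continuous_intros)

lemma has_partials_affine:
  assumes "has_partials f f1 f2"
  shows "has_partials (\<lambda>x. f (z + r *\<^sub>R x)) (\<lambda>x. r * f1 (z + r *\<^sub>R x)) (\<lambda>x. r * f2 (z + r *\<^sub>R x))"
proof -
  obtain z1 z2 where z: "z = (z1, z2)" by fastforce
  have A: "((\<lambda>s. f (z1 + r * s, z2 + r * b)) has_real_derivative f1 (z1 + r * a, z2 + r * b) * r) (at a)"
    for a b
    by (rule DERIV_chain2[of "\<lambda>s. f (s, z2 + r * b)" _ "\<lambda>s. z1 + r * s"])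
      (auto intro!: derivative_eq_intros has_partialsD[OF assms])
  have B: "((\<lambda>s. f (z1 + r * a, z2 + r * s)) has_real_derivative f2 (z1 + r * a, z2 + r * b) * r) (at b)"
    for a b
    by (rule DERIV_chain2[of "\<lambda>s. f (z1 + r * a, s)" _ "\<lambda>s. z2 + r * s"])
      (auto intro!: derivative_eq_intros has_partialsD[OF assms])
  show ?thesis unfolding has_partials_def
    using A B has_partialsD(3-5)[OF assms]
    by (auto simp: z mult.commute intro!: cont_compose[of f] cont_compose[of f1] cont_compose[of f2] continuous_intros)
qed

lemma has_partials_shift:
  assumes "has_partials f f1 f2"
  shows "has_partials (\<lambda>x. f (x + z)) (\<lambda>x. f1 (x + z)) (\<lambda>x. f2 (x + z))"
  using has_partials_affine[OF assms, of z 1] by (simp add: add.commute)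

text \<open>The chain rule along a ray needs the total derivative, which exists because one of the
  two partials is continuous (\<open>has_derivative_partialsI\<close>).\<close>

lemma has_partials_ray:
  assumes "has_partials f f1 f2"
  shows "((\<lambda>s. f (s *\<^sub>R y)) has_real_derivative
            fst y * f1 (s *\<^sub>R y) + snd y * f2 (s *\<^sub>R y)) (at s)"
proof -
  obtain y1 y2 where y: "y = (y1, y2)" by fastforce
  let ?p = "(s * y1, s * y2)"
  have tot: "((\<lambda>(a, b). f (a, b)) has_derivative
      (\<lambda>(ta, tb). f1 ?p * ta + blinfun_apply (blinfun_mult_right (f2 ?p)) tb)) (at ?p within UNIV \<times> UNIV)"
  proof (rule has_derivative_partialsI[of "\<lambda>a b. f (a, b)"])
    show "((\<lambda>a. f (a, s * y2)) has_derivative (\<lambda>ta. f1 ?p * ta)) (at (s * y1) within UNIV)"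
      using has_partialsD(1)[OF assms] has_field_derivative_def by (metis)
    show "((\<lambda>b. f (a, b)) has_derivative blinfun_apply (blinfun_mult_right (f2 (a, b)))) (at b within UNIV)"
      for a b
      using has_partialsD(2)[OF assms, of a b] by (simp add: has_field_derivative_def)
    have "continuous_on UNIV (\<lambda>x. blinfun_mult_right (f2 x))"
      by (intro continuous_intros has_partialsD(5)[OF assms])
    then show "continuous (at ?p within UNIV \<times> UNIV) (\<lambda>(a, b). blinfun_mult_right (f2 (a, b)))"
      by (simp add: continuous_on_eq_continuous_within case_prod_unfold del: split_paired_All)
  qed auto
  have lin: "((\<lambda>s. (s * y1, s * y2)) has_derivative (\<lambda>h. (h * y1, h * y2))) (at s)"
    by (auto intro!: derivative_eq_intros)
  have "((\<lambda>s. f (s * y1, s * y2)) has_derivative (\<lambda>h. f1 ?p * (h * y1) + f2 ?p * (h * y2))) (at s)"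
    using has_derivative_compose[OF lin, of "\<lambda>(a, b). f (a, b)" "\<lambda>(ta, tb). f1 ?p * ta + blinfun_apply (blinfun_mult_right (f2 ?p)) tb"] tot
    by (simp add: case_prod_beta)
  moreover have "(\<lambda>h. f1 ?p * (h * y1) + f2 ?p * (h * y2)) = (*) (y1 * f1 ?p + y2 * f2 ?p)"
    by (auto simp: algebra_simps)
  ultimately show ?thesis
    by (simp add: has_field_derivative_def y)
qed

lemma periodic2D:
  assumes "periodic2 f" shows "f (a + 2 * pi, b) = f (a, b)" "f (a, b + 2 * pi) = f (a, b)"
  using assms unfolding periodic2_def by (metis add.right_neutral add_Pair)+

text \<open>A window of one period may slide by at most \<open>L\<close>, since the piece lost on
  one side reappears on the other. Whole periods follow by induction; for a negative floor the
  induction starts at the left end \<open>of_int k * L\<close> and runs up to 0.\<close>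

lemma integral_shift_periodic:
  fixes g :: "real \<Rightarrow> real"
  assumes c: "continuous_on UNIV g" and p: "\<And>s. g (s + L) = g s" and L: "L > 0"
  shows "integral {z..z + L} g = integral {0..L} g"
proof -
  have st: "integral {z..z + L} g = integral {y..y + L} g" if "y \<le> z" "z \<le> y + L" for z y
  proof -
    have i: "g integrable_on {a..b}" for a b
      using cont_int[OF c, of a b] by simp
    have "integral {y..z} g = integral {y + L..z + L} g"
      using integral_shift_real_ivl[of "y + L" L "z + L" g] p by simp
    moreover have "integral {y..z} g + integral {z..y + L} g = integral {y..y + L} g"
      "integral {z..y + L} g + integral {y + L..z + L} g = integral {z..z + L} g"
      using that L by (auto intro!: Henstock_Kurzweil_Integration.integral_combine i)
    ultimately show ?thesis by simp
  qed
  have n: "integral {y + real n * L..y + real n * L + L} g = integral {y..y + L} g" for n y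
  proof (induction n)
    case (Suc n)
    have "integral {y + real (Suc n) * L..y + real (Suc n) * L + L} g
        = integral {y + real n * L..y + real n * L + L} g"
      by (rule st) (use L in \<open>auto simp: algebra_simps\<close>)
    then show ?case using Suc by simp
  qed simp
  define k where "k = \<lfloor>z / L\<rfloor>"
  have k: "of_int k * L \<le> z" "z < of_int k * L + L"
    using floor_divide_lower[OF L, of z] floor_divide_upper[OF L, of z] unfolding k_def
    by (auto simp: algebra_simps)
  have "integral {z..z + L} g = integral {of_int k * L..of_int k * L + L} g"
    by (rule st) (use k in auto)
  also have "\<dots> = integral {0..L} g"
  proof (cases "k \<ge> 0")
    case True
    then show ?thesis using n[of 0 "nat k"] by simp
  next
    case False
    then show ?thesis using n[of "of_int k * L" "nat (- k)"] by simp
  qed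
  finally show ?thesis .
qed

lemma cont_slice:
  fixes f :: "pt \<Rightarrow> real"
  assumes "continuous_on UNIV f"
  shows "continuous_on S (\<lambda>b. f (a, b))" "continuous_on S (\<lambda>a. f (a, b))"
  by (auto intro!: cont_compose[OF assms] continuous_intros)

lemma integral_iterated:
  fixes f :: "pt \<Rightarrow> real"
  assumes "continuous_on UNIV f"
  shows "integral (cbox (a, c) (b, d)) f = integral {a..b} (\<lambda>x. integral {c..d} (\<lambda>y. f (x, y)))"
    and "integral (cbox (a, c) (b, d)) f = integral {c..d} (\<lambda>y. integral {a..b} (\<lambda>x. f (x, y)))"
proof -
  show 1: "integral (cbox (a, c) (b, d)) f = integral {a..b} (\<lambda>x. integral {c..d} (\<lambda>y. f (x, y)))"
    using integral_prod_continuous[of a c b d f] continuous_on_subset[OF assms] by (simp add: cbox_interval)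
  show "integral (cbox (a, c) (b, d)) f = integral {c..d} (\<lambda>y. integral {a..b} (\<lambda>x. f (x, y)))"
    unfolding 1 using integral_swap_continuous[of a c b d "\<lambda>x y. f (x, y)"] continuous_on_subset[OF assms]
    by (simp add: cbox_interval)
qed

lemma integral_cbox_shift_periodic:
  assumes c: "continuous_on UNIV f" and p: "periodic2 f"
  shows "integral (cbox z (z + (2 * pi, 2 * pi))) f = integral Q0 (f :: pt \<Rightarrow> real)"
proof -
  obtain z1 z2 where z: "z = (z1, z2)" by fastforce
  have "integral (cbox z (z + (2 * pi, 2 * pi))) f
      = integral {z1..z1 + 2 * pi} (\<lambda>x. integral {z2..z2 + 2 * pi} (\<lambda>y. f (x, y)))"
    by (simp add: z integral_iterated(1)[OF c])
  also have "\<dots> = integral {z1..z1 + 2 * pi} (\<lambda>x. integral {0..2 * pi} (\<lambda>y. f (x, y)))"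
    by (subst integral_shift_periodic) (auto intro!: cont_slice c simp: periodic2D[OF p])
  also have "\<dots> = integral {0..2 * pi} (\<lambda>y. integral {z1..z1 + 2 * pi} (\<lambda>x. f (x, y)))"
    using integral_iterated[OF c, of z1 0 "z1 + 2 * pi" "2 * pi"] by simp
  also have "\<dots> = integral {0..2 * pi} (\<lambda>y. integral {0..2 * pi} (\<lambda>x. f (x, y)))"
    by (subst integral_shift_periodic) (auto intro!: cont_slice c simp: periodic2D[OF p])
  also have "\<dots> = integral Q0 f"
    by (simp add: Q0_def integral_iterated(2)[OF c])
  finally show ?thesis .
qed

lemma integral_translate:
  assumes c: "continuous_on UNIV f" and p: "periodic2 f"
  shows "integral Q0 (\<lambda>x. f (x + z)) = integral Q0 (f :: pt \<Rightarrow> real)"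
proof -
  have "integral Q0 (\<lambda>x. f (x + z)) = integral (cbox z (z + (2 * pi, 2 * pi))) f"
    using integral_shift_cbox_plus[of 0 "(2 * pi, 2 * pi)" f z]
    unfolding Q0_def zero_prod_def[symmetric] by (simp add: o_def add.commute)
  then show ?thesis using integral_cbox_shift_periodic[OF c p] by simp
qed

lemma integral_partial_zero:
  assumes h: "has_partials h h1 h2"
  shows "(\<And>b. h (c1, b) = h (a1, b)) \<Longrightarrow> a1 \<le> c1 \<Longrightarrow> integral (cbox (a1, a2) (c1, c2)) h1 = 0"
    and "(\<And>a. h (a, c2) = h (a, a2)) \<Longrightarrow> a2 \<le> c2 \<Longrightarrow> integral (cbox (a1, a2) (c1, c2)) h2 = 0"
proof -
  assume e: "\<And>b. h (c1, b) = h (a1, b)" and le: "a1 \<le> c1"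
  have "((\<lambda>x. h1 (x, y)) has_integral (h (c1, y) - h (a1, y))) {a1..c1}" for y
    using le has_partialsD(1)[OF h, of y]
    by (intro fundamental_theorem_of_calculus)
      (auto simp: has_real_derivative_iff_has_vector_derivative intro: has_vector_derivative_at_within)
  then have "integral {a1..c1} (\<lambda>x. h1 (x, y)) = 0" for y
    using e integral_unique by fastforce
  then show "integral (cbox (a1, a2) (c1, c2)) h1 = 0"
    by (simp add: integral_iterated(2)[OF has_partialsD(4)[OF h]])
next
  assume e: "\<And>a. h (a, c2) = h (a, a2)" and le: "a2 \<le> c2"
  have "((\<lambda>y. h2 (x, y)) has_integral (h (x, c2) - h (x, a2))) {a2..c2}" for x
    using le has_partialsD(2)[OF h, of x]
    by (intro fundamental_theorem_of_calculus)
      (auto simp: has_real_derivative_iff_has_vector_derivative intro: has_vector_derivative_at_within)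
  then have "integral {a2..c2} (\<lambda>y. h2 (x, y)) = 0" for x
    using e integral_unique by fastforce
  then show "integral (cbox (a1, a2) (c1, c2)) h2 = 0"
    by (simp add: integral_iterated(1)[OF has_partialsD(5)[OF h]])
qed

lemma integral_torus_partial_zero:
  assumes "has_partials h h1 h2" "periodic2 h"
  shows "integral Q0 h1 = 0" "integral Q0 h2 = 0"
  unfolding Q0_def
  using integral_partial_zero[OF assms(1)] periodic2D[OF assms(2), of 0] periodic2D[OF assms(2), of _ 0]
  by (auto)

lemma periodic2_mult: "periodic2 f \<Longrightarrow> periodic2 g \<Longrightarrow> periodic2 (\<lambda>x. f x * (g x :: real))"
  and periodic2_diff: "periodic2 f \<Longrightarrow> periodic2 g \<Longrightarrow> periodic2 (\<lambda>x. f x - g x)"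
  and periodic2_compose: "periodic2 h \<Longrightarrow> periodic2 (\<lambda>x. k (h x))"
  by (auto simp: periodic2_def)

lemma periodic2_shift: "periodic2 f \<Longrightarrow> periodic2 (\<lambda>x. f (x + z))"
  unfolding periodic2_def by (metis add.assoc add.commute)

text \<open>A periodic function equals its translate by a period, so uniqueness of derivatives
  passes the periodicity on to the partials.\<close>

lemma periodic2_partials:
  assumes h: "has_partials h h1 h2" and p: "periodic2 h"
  shows "periodic2 h1" "periodic2 h2"
proof -
  note sh = has_partials_shift[OF h]
  have eq: "(\<lambda>x. h (x + (2 * pi, 0))) = h" "(\<lambda>x. h (x + (0, 2 * pi))) = h"
    using p by (auto simp: periodic2_def)
  have un: "g1 = h1 \<and> g2 = h2" if "has_partials h g1 g2" for g1 g2
    using has_partialsD(1,2)[OF that] has_partialsD(1,2)[OF h] DERIV_unique by (metis surj_pair ext)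
  show "periodic2 h1" "periodic2 h2"
    using un[OF sh[of "(2 * pi, 0)", unfolded eq]] un[OF sh[of "(0, 2 * pi)", unfolded eq]]
    unfolding periodic2_def by metis+
qed

lemma integral_by_parts:
  assumes f: "has_partials f f1 f2" and g: "has_partials g g1 g2" and pf: "periodic2 f" and pg: "periodic2 g"
  shows "integral Q0 (\<lambda>x. f x * g1 x) = - integral Q0 (\<lambda>x. f1 x * g x)"
    and "integral Q0 (\<lambda>x. f x * g2 x) = - integral Q0 (\<lambda>x. f2 x * g x)"
proof -
  note h = has_partials_mult[OF f g]
  note c = has_partialsD(3-5)[OF f] has_partialsD(3-5)[OF g]
  have "integral Q0 (\<lambda>x. f1 x * g x) + integral Q0 (\<lambda>x. f x * g1 x) = 0"
    unfolding integral_torus_partial_zero(1)[OF h periodic2_mult[OF pf pg], symmetric]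
    unfolding Q0_def by (intro integral_add[symmetric] cont_int continuous_intros c)
  then show "integral Q0 (\<lambda>x. f x * g1 x) = - integral Q0 (\<lambda>x. f1 x * g x)" by simp
  have "integral Q0 (\<lambda>x. f2 x * g x) + integral Q0 (\<lambda>x. f x * g2 x) = 0"
    unfolding integral_torus_partial_zero(2)[OF h periodic2_mult[OF pf pg], symmetric]
    unfolding Q0_def by (intro integral_add[symmetric] cont_int continuous_intros c)
  then show "integral Q0 (\<lambda>x. f x * g2 x) = - integral Q0 (\<lambda>x. f2 x * g x)" by simp
qed

text \<open>Serves both correlations (\<open>p\<close> is one factor, \<open>r = 1\<close>) and
  mollification (\<open>p\<close> is the kernel): the variable enters as a translation, the domain
  stays fixed.\<close>

lemma has_partials_weighted_integral:
  assumes g: "has_partials g g1 g2" and c: "continuous_on UNIV p"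
  shows "has_partials (\<lambda>z. integral (cbox a b) (\<lambda>x. p x * g (z + r *\<^sub>R x)))
     (\<lambda>z. integral (cbox a b) (\<lambda>x. p x * g1 (z + r *\<^sub>R x)))
     (\<lambda>z. integral (cbox a b) (\<lambda>x. p (x::pt) * g2 (z + r *\<^sub>R x)))"
proof -
  note gc = has_partialsD(3-5)[OF g]
  have cont: "continuous_on UNIV (\<lambda>z. integral (cbox a b) (\<lambda>x. p x * k (z + r *\<^sub>R x)))"
    if "continuous_on UNIV k" for k :: "pt \<Rightarrow> real"
    by (intro integral_continuous_on_param)
      (auto simp: case_prod_beta intro!: continuous_intros cont_compose[OF that] cont_compose[OF c])
  have 1: "((\<lambda>s. integral (cbox a b) (\<lambda>x. p x * g ((s, d) + r *\<^sub>R x)))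
      has_real_derivative integral (cbox a b) (\<lambda>x. p x * g1 ((e, d) + r *\<^sub>R x))) (at e within UNIV)" for d e
  proof (rule leibniz_rule_field_derivative)
    fix s x
    show "((\<lambda>s. p x * g ((s, d) + r *\<^sub>R x)) has_real_derivative p x * g1 ((s, d) + r *\<^sub>R x)) (at s within UNIV)"
      using DERIV_cmult[OF has_partialsD(1)[OF has_partials_shift[OF g, of "r *\<^sub>R x"], of d s], of "p x"] by simp
  qed (auto simp: case_prod_beta intro!: cont_int continuous_intros cont_compose[OF gc(1)] cont_compose[OF gc(2)] cont_compose[OF c])
  have 2: "((\<lambda>s. integral (cbox a b) (\<lambda>x. p x * g ((d, s) + r *\<^sub>R x)))
      has_real_derivative integral (cbox a b) (\<lambda>x. p x * g2 ((d, e) + r *\<^sub>R x))) (at e within UNIV)" for d e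
  proof (rule leibniz_rule_field_derivative)
    fix s x
    show "((\<lambda>s. p x * g ((d, s) + r *\<^sub>R x)) has_real_derivative p x * g2 ((d, s) + r *\<^sub>R x)) (at s within UNIV)"
      using DERIV_cmult[OF has_partialsD(2)[OF has_partials_shift[OF g, of "r *\<^sub>R x"], of d s], of "p x"] by simp
  qed (auto simp: case_prod_beta intro!: cont_int continuous_intros cont_compose[OF gc(1)] cont_compose[OF gc(3)] cont_compose[OF c])
  show ?thesis unfolding has_partials_def using 1 2 cont gc by auto
qed

section \<open>Correlations, and integration by parts for C^1 functions\<close>

definition corr :: "(pt \<Rightarrow> real) \<Rightarrow> (pt \<Rightarrow> real) \<Rightarrow> pt \<Rightarrow> real" where
  "corr f g z = integral Q0 (\<lambda>x. f x * g (x + z))"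

text \<open>Differentiation in the shift loads only the second factor; \<open>corr_swap\<close> and
  \<open>corr_by_parts\<close> move derivatives to the first. Two derivatives can thus be shared by
  two C^1 functions.\<close>

lemma has_partials_corr:
  assumes g: "has_partials g g1 g2" and c: "continuous_on UNIV f"
  shows "has_partials (corr f g) (corr f g1) (corr f g2)"
  using has_partials_weighted_integral[OF g c, of 0 "(2 * pi, 2 * pi)" 1]
  unfolding corr_def[abs_def] Q0_def by (simp add: zero_prod_def add.commute)

lemma corr_swap:
  assumes "continuous_on UNIV f" "continuous_on UNIV g" "periodic2 f" "periodic2 g"
  shows "corr f g z = corr g f (- z)"
proof -
  have "corr f g z = integral Q0 (\<lambda>x. (\<lambda>x. f (x + - z) * g x) (x + z))"
    by (simp add: corr_def)
  also have "\<dots> = integral Q0 (\<lambda>x. f (x + - z) * g x)"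
    by (intro integral_translate continuous_intros assms cont_compose[OF assms(1)]
        periodic2_mult periodic2_shift)
  finally show ?thesis by (simp add: corr_def mult.commute)
qed

lemma corr_by_parts:
  assumes f: "has_partials f f1 f2" and g: "has_partials g g1 g2" and pf: "periodic2 f" and pg: "periodic2 g"
  shows "corr f g1 z = - corr f1 g z" "corr f g2 z = - corr f2 g z"
  using integral_by_parts[OF f has_partials_shift[OF g, of z] pf periodic2_shift[OF pg]]
  by (auto simp: corr_def)

text \<open>Integration by parts for two \<open>C\<^sup>1\<close> functions, obtained by differentiating
  \<open>corr f1 g (0,h) = - corr f g1 (0,h)\<close> in \<open>h\<close> once through \<open>g\<close> and once through \<open>f\<close>.\<close>
lemma integral_partials_exchange:
  assumes f: "has_partials f f1 f2" and g: "has_partials g g1 g2" and pf: "periodic2 f" and pg: "periodic2 g"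
  shows "integral Q0 (\<lambda>x. f1 x * g2 x) = integral Q0 (\<lambda>x. f2 x * g1 x)"
proof -
  note cf = has_partialsD(3-5)[OF f] and cg = has_partialsD(3-5)[OF g]
  have "((\<lambda>h. corr f1 g (0, h)) has_real_derivative corr f1 g2 (0, 0)) (at 0)"
    by (rule has_partialsD[OF has_partials_corr[OF g cf(2)]])
  moreover have "(\<lambda>h. corr f1 g (0, h)) = (\<lambda>h. - corr g1 f (0, - h))"
  proof
    fix h
    have "corr f1 g (0, h) = - corr f g1 (0, h)"
      using corr_by_parts(1)[OF f g pf pg, of "(0, h)"] by linarith
    also have "corr f g1 (0, h) = corr g1 f (- (0, h))"
      by (rule corr_swap[OF cf(1) cg(2) pf periodic2_partials(1)[OF g pg]])
    finally show "corr f1 g (0, h) = - corr g1 f (0, - h)" by simp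
  qed
  moreover have "((\<lambda>h. - corr g1 f (0, - h)) has_real_derivative - (corr g1 f2 (0, - 0) * (- 1))) (at 0)"
    by (intro DERIV_minus DERIV_chain2[of "\<lambda>h. corr g1 f (0, h)" _ "\<lambda>h. - h"]
        has_partialsD[OF has_partials_corr[OF f cg(2)]]) (auto intro!: derivative_eq_intros)
  ultimately have "corr f1 g2 (0, 0) = corr g1 f2 (0, 0)"
    using DERIV_unique by fastforce
  then show ?thesis by (simp add: corr_def zero_prod_def[symmetric] mult.commute)
qed

text \<open>Schwarz's theorem. Integrating \<open>a\<close> in the first variable recovers
  \<open>u\<close>; differentiating that formula under the integral in the second variable writes
  \<open>b\<close> as an integral of \<open>a2\<close>, and one more derivative in the first
  variable returns \<open>a2\<close>.\<close>

lemma mixed_partials_eq: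
  assumes u: "has_partials u a b" and a: "has_partials a a1 a2" and b: "has_partials b b1 b2"
  shows "a2 = b1"
proof -
  have "a2 (x0, y0) = b1 (x0, y0)" for x0 y0
  proof -
    \<comment> \<open>The base point \<open>x0 - 1\<close> keeps \<open>x0\<close> in the interior,
      so that the derivative within the interval of integration becomes a full derivative.\<close>
    have rep: "u (x, y) = u (x0 - 1, y) + integral {x0 - 1..x} (\<lambda>s. a (s, y))" if "x \<ge> x0 - 1" for x y
    proof -
      have "((\<lambda>s. a (s, y)) has_integral (u (x, y) - u (x0 - 1, y))) {x0 - 1..x}"
        using that has_partialsD(1)[OF u, of y]
        by (intro fundamental_theorem_of_calculus)
          (auto simp: has_real_derivative_iff_has_vector_derivative intro: has_vector_derivative_at_within)
      then show ?thesis by (simp add: integral_unique)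
    qed
    have der: "b (x, y0) = b (x0 - 1, y0) + integral {x0 - 1..x} (\<lambda>s. a2 (s, y0))" if x: "x \<ge> x0 - 1" for x
    proof -
      have "((\<lambda>y. integral (cbox (x0 - 1) x) (\<lambda>s. a (s, y))) has_real_derivative
          integral (cbox (x0 - 1) x) (\<lambda>s. a2 (s, y0))) (at y0 within UNIV)"
        by (rule leibniz_rule_field_derivative)
          (auto simp: case_prod_beta simp del: cbox_interval box_real intro!: has_partialsD(2)[OF a] cont_int continuous_intros
             cont_compose[OF has_partialsD(3)[OF a]] cont_compose[OF has_partialsD(5)[OF a]])
      then have "((\<lambda>y. u (x, y)) has_real_derivative b (x0 - 1, y0) + integral {x0 - 1..x} (\<lambda>s. a2 (s, y0))) (at y0)"
        unfolding rep[OF x] by (intro DERIV_add has_partialsD[OF u]) auto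
      then show ?thesis using has_partialsD(2)[OF u] DERIV_unique by blast
    qed
    have "((\<lambda>x. integral {x0 - 1..x} (\<lambda>s. a2 (s, y0))) has_real_derivative a2 (x0, y0)) (at x0 within {x0 - 1..x0 + 1})"
      by (rule integral_has_real_derivative) (auto intro!: cont_slice has_partialsD[OF a])
    then have "((\<lambda>x. b (x0 - 1, y0) + integral {x0 - 1..x} (\<lambda>s. a2 (s, y0))) has_real_derivative a2 (x0, y0)) (at x0 within {x0 - 1..x0 + 1})"
      using DERIV_add[OF DERIV_const] by fastforce
    then have "((\<lambda>x. b (x, y0)) has_real_derivative a2 (x0, y0)) (at x0 within {x0 - 1..x0 + 1})"
    proof (rule has_field_derivative_transform_within[where d=1])
      fix x assume "x \<in> {x0 - 1..x0 + 1}"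
      then show "b (x0 - 1, y0) + integral {x0 - 1..x} (\<lambda>s. a2 (s, y0)) = b (x, y0)"
        using der[of x] by auto
    qed auto
    then have "((\<lambda>x. b (x, y0)) has_real_derivative a2 (x0, y0)) (at x0)"
      using at_within_Icc_at[of "x0 - 1" x0 "x0 + 1"] by simp
    then show ?thesis using has_partialsD(1)[OF b] DERIV_unique by blast
  qed
  then show ?thesis by auto
qed

section \<open>Dyadic grids\<close>

text \<open>Integer indices, unlike the natural ones of \<open>dyadic_square\<close>, admit the
  neighbours of a square at the edge of \<open>Q0\<close>; periodicity folds these back in
  \<open>integral_cell_periodic\<close>.\<close>

definition cell :: "real \<Rightarrow> int \<Rightarrow> int \<Rightarrow> pt set" where
  "cell l i j = cbox (l * of_int i, l * of_int j) (l * (of_int i + 1), l * (of_int j + 1))"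

lemma integral_strip1:
  fixes f :: "pt \<Rightarrow> real"
  assumes "f integrable_on cbox (l * of_int a, b) (l * (of_int a + real p), d)" "l > 0"
  shows "integral (cbox (l * of_int a, b) (l * (of_int a + real p), d)) f =
    (\<Sum>i<p. integral (cbox (l * of_int (a + int i), b) (l * (of_int (a + int i) + 1), d)) f)"
  using assms(1)
proof (induction p)
  case 0
  then show ?case by (simp add: integral_null content_Pair)
next
  case (Suc p)
  let ?c = "l * (of_int a + real p)"
  have le: "?c \<le> l * (of_int a + real (Suc p))" "l * of_int a \<le> ?c" using \<open>l > 0\<close> by auto
  have inter: "cbox (l * of_int a, b) (l * (of_int a + real (Suc p)), d) \<inter> {x. x \<bullet> (1, 0) \<le> ?c}
      = cbox (l * of_int a, b) (?c, d)"
    "cbox (l * of_int a, b) (l * (of_int a + real (Suc p)), d) \<inter> {x. x \<bullet> (1, 0) \<ge> ?c}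
      = cbox (?c, b) (l * (of_int a + real (Suc p)), d)"
    using le by (auto simp: cbox_Pair_eq)
  have "integral (cbox (l * of_int a, b) (l * (of_int a + real (Suc p)), d)) f =
      integral (cbox (l * of_int a, b) (?c, d)) f
      + integral (cbox (?c, b) (l * (of_int a + real (Suc p)), d)) f"
    using integral_split[OF Suc.prems, of "(1, 0)" ?c] unfolding inter by (auto simp: Basis_prod_def)
  moreover have "f integrable_on cbox (l * of_int a, b) (?c, d)"
    by (rule integrable_on_subcbox[OF Suc.prems]) (use le in \<open>auto simp: cbox_Pair_eq\<close>)
  ultimately show ?case using Suc.IH by (simp add: algebra_simps)
qed

lemma integral_strip2:
  fixes f :: "pt \<Rightarrow> real"
  assumes "f integrable_on cbox (b, l * of_int a) (d, l * (of_int a + real p))" "l > 0"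
  shows "integral (cbox (b, l * of_int a) (d, l * (of_int a + real p))) f =
    (\<Sum>i<p. integral (cbox (b, l * of_int (a + int i)) (d, l * (of_int (a + int i) + 1))) f)"
  using assms(1)
proof (induction p)
  case 0
  then show ?case by (simp add: integral_null content_Pair)
next
  case (Suc p)
  let ?c = "l * (of_int a + real p)"
  have le: "?c \<le> l * (of_int a + real (Suc p))" "l * of_int a \<le> ?c" using \<open>l > 0\<close> by auto
  have inter: "cbox (b, l * of_int a) (d, l * (of_int a + real (Suc p))) \<inter> {x. x \<bullet> (0, 1) \<le> ?c}
      = cbox (b, l * of_int a) (d, ?c)"
    "cbox (b, l * of_int a) (d, l * (of_int a + real (Suc p))) \<inter> {x. x \<bullet> (0, 1) \<ge> ?c}
      = cbox (b, ?c) (d, l * (of_int a + real (Suc p)))"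
    using le by (auto simp: cbox_Pair_eq)
  have "integral (cbox (b, l * of_int a) (d, l * (of_int a + real (Suc p)))) f =
      integral (cbox (b, l * of_int a) (d, ?c)) f
      + integral (cbox (b, ?c) (d, l * (of_int a + real (Suc p)))) f"
    using integral_split[OF Suc.prems, of "(0, 1)" ?c] unfolding inter by (auto simp: Basis_prod_def)
  moreover have "f integrable_on cbox (b, l * of_int a) (d, ?c)"
    by (rule integrable_on_subcbox[OF Suc.prems]) (use le in \<open>auto simp: cbox_Pair_eq\<close>)
  ultimately show ?case using Suc.IH by (simp add: algebra_simps)
qed

lemma integral_grid:
  fixes f :: "pt \<Rightarrow> real"
  assumes f: "f integrable_on cbox (l * of_int a, l * of_int b) (l * (of_int a + real p), l * (of_int b + real q))"
    and l: "l > 0"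
  shows "integral (cbox (l * of_int a, l * of_int b) (l * (of_int a + real p), l * (of_int b + real q))) f =
    (\<Sum>i<p. \<Sum>j<q. integral (cell l (a + int i) (b + int j)) f)"
proof -
  have "integral (cbox (l * of_int (a + int i), l * of_int b) (l * (of_int (a + int i) + 1), l * (of_int b + real q))) f
    = (\<Sum>j<q. integral (cell l (a + int i) (b + int j)) f)" if "i < p" for i
    unfolding cell_def
  proof (intro integral_strip2 l)
    have "real i + 1 \<le> real p" using that by linarith
    then have le: "l * of_int a \<le> l * of_int (a + int i)"
      "l * (of_int (a + int i) + 1) \<le> l * (of_int a + real p)"
      using l by (auto intro!: mult_left_mono)
    show "f integrable_on cbox (l * of_int (a + int i), l * of_int b) (l * (of_int (a + int i) + 1), l * (of_int b + real q))"
    proof (rule integrable_on_subcbox[OF f], unfold cbox_Pair_eq, rule Sigma_mono)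
      show "cbox (l * of_int (a + int i)) (l * (of_int (a + int i) + 1)) \<subseteq> cbox (l * of_int a) (l * (of_int a + real p))"
        using le by (simp del: of_int_add)
    qed simp
  qed
  then show ?thesis
    using integral_strip1[OF f l] by simp
qed

lemma dyadic_square_cell: "dyadic_square j k1 k2 = cell (2 * pi / 2 ^ j) (int k1) (int k2)"
  by (simp add: dyadic_square_def cell_def algebra_simps add_divide_distrib)

lemma Q0_grid: "Q0 = cbox ((2 * pi / 2 ^ j) * of_int 0, (2 * pi / 2 ^ j) * of_int 0)
   ((2 * pi / 2 ^ j) * (of_int 0 + real (2 ^ j)), (2 * pi / 2 ^ j) * (of_int 0 + real (2 ^ j)))"
  by (simp add: Q0_def)

lemma integral_Q0_dyadic:
  fixes f :: "pt \<Rightarrow> real"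
  assumes "f integrable_on Q0"
  shows "integral Q0 f = (\<Sum>k1<2 ^ j. \<Sum>k2<2 ^ j. integral (dyadic_square j k1 k2) f)"
  using integral_grid[OF assms[unfolded Q0_grid[of j]]]
  unfolding Q0_grid[of j, symmetric] by (simp add: dyadic_square_cell)

lemma dyadic_square_grid2:
  "dyadic_square j k1 k2 = cbox ((2 * pi / 2 ^ Suc j) * of_int (int (2 * k1)), (2 * pi / 2 ^ Suc j) * of_int (int (2 * k2)))
   ((2 * pi / 2 ^ Suc j) * (of_int (int (2 * k1)) + real 2), (2 * pi / 2 ^ Suc j) * (of_int (int (2 * k2)) + real 2))"
  by (simp add: dyadic_square_def field_simps)

lemma integral_dyadic_children:
  fixes f :: "pt \<Rightarrow> real"
  assumes "f integrable_on dyadic_square j k1 k2"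
  shows "integral (dyadic_square j k1 k2) f =
    (\<Sum>s<2. \<Sum>t<2. integral (dyadic_square (Suc j) (2 * k1 + s) (2 * k2 + t)) f)"
  using integral_grid[OF assms[unfolded dyadic_square_grid2]]
  unfolding dyadic_square_grid2[symmetric] by (simp add: dyadic_square_cell)

lemma content_cell: "l > 0 \<Longrightarrow> measure lborel (cell l i j) = l\<^sup>2"
proof -
  assume l: "l > 0"
  have "measure lborel (cell l i j) = measure lborel {l * of_int i..l * (of_int i + 1)} * measure lborel {l * of_int j..l * (of_int j + 1)}"
    by (simp add: cell_def content_Pair)
  also have "\<dots> = l * l" using l by (simp add: algebra_simps)
  finally show ?thesis by (simp add: power2_eq_square)
qed

lemma sidelen_dyadic: "sidelen (dyadic_square j k1 k2) = 2 * pi / 2 ^ j"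
  by (simp add: sidelen_def dyadic_square_cell content_cell)

lemma sidelen_Q0: "sidelen Q0 = 2 * pi"
  using sidelen_dyadic[of 0 0 0] by (simp add: Q0_def dyadic_square_def)

text \<open>The area gives the level and the lower corner the indices. Sparse families are sets of
  squares whereas the sums run over index triples; injectivity makes the two agree.\<close>

lemma dyadic_square_inj:
  assumes "dyadic_square j k1 k2 = dyadic_square i m1 m2"
  shows "j = i" "k1 = m1" "k2 = m2"
proof -
  have "2 * pi / 2 ^ j = 2 * pi / 2 ^ i" using sidelen_dyadic assms by metis
  then have "(2::real) ^ j = 2 ^ i" by (simp add: field_simps)
  then show [simp]: "j = i" by simp
  have ne: "dyadic_square j k1 k2 \<noteq> {}"
    unfolding dyadic_square_def box_ne_empty by (auto simp: Basis_prod_def divide_right_mono inner_Pair)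
  have "(2 * pi * real k1 / 2 ^ j, 2 * pi * real k2 / 2 ^ j) = (2 * pi * real m1 / 2 ^ i, 2 * pi * real m2 / 2 ^ i)"
    using assms ne unfolding dyadic_square_def eq_cbox by simp
  then show "k1 = m1" "k2 = m2" by auto
qed

section \<open>Principal squares\<close>

lemma sum_lessThan_double: "(\<Sum>k<2 * n. h k) = (\<Sum>k<n. h (2 * k) + h (2 * k + 1) :: real)" for n :: nat
  by (induction n) (auto simp: sum.distrib)

lemma sum_grid_children:
  fixes h :: "nat \<Rightarrow> nat \<Rightarrow> real"
  shows "(\<Sum>k1<2 ^ Suc j. \<Sum>k2<2 ^ Suc j. h k1 k2) =
    (\<Sum>k1<2 ^ j. \<Sum>k2<2 ^ j. \<Sum>s<2. \<Sum>t<2. h (2 * k1 + s) (2 * k2 + t))"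
  unfolding power_Suc sum_lessThan_double
  by (simp add: numeral_2_eq_2 sum.distrib add_ac)

text \<open>Up to the factor \<open>|Q0|\<close>, \<open>4 ^ j * a j k1 k2\<close> is the average over a level \<open>j\<close> square. A square is principal
  if its average exceeds twice that of its closest principal ancestor; \<open>running_max a N i\<close> is the average
  over the closest principal ancestor of a square of level \<open>N + i\<close>.\<close>
primrec running_max :: "(nat \<Rightarrow> nat \<Rightarrow> nat \<Rightarrow> real) \<Rightarrow> nat \<Rightarrow> nat \<Rightarrow> nat \<Rightarrow> nat \<Rightarrow> real" where
  "running_max a N 0 k1 k2 = 4 ^ N * a N k1 k2"
| "running_max a N (Suc i) k1 k2 =
    (if 4 ^ (N + Suc i) * a (N + Suc i) k1 k2 > 2 * running_max a N i (k1 div 2) (k2 div 2)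
     then 4 ^ (N + Suc i) * a (N + Suc i) k1 k2 else running_max a N i (k1 div 2) (k2 div 2))"

definition principal :: "(nat \<Rightarrow> nat \<Rightarrow> nat \<Rightarrow> real) \<Rightarrow> nat \<Rightarrow> nat \<Rightarrow> nat \<Rightarrow> nat \<Rightarrow> bool" where
  "principal a N i k1 k2 \<longleftrightarrow> a (N + i) k1 k2 > 0 \<and>
    (i = 0 \<or> 4 ^ (N + i) * a (N + i) k1 k2 > 2 * running_max a N (i - 1) (k1 div 2) (k2 div 2))"

text \<open>The stopping-time argument is kept apart from integration: it sees a nonnegative
  additive weight on the dyadic tree. Below, \<open>a\<close> becomes the integral of |f| over a
  square.\<close>

locale dyadic_measure =
  fixes a :: "nat \<Rightarrow> nat \<Rightarrow> nat \<Rightarrow> real" and N :: nat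
  assumes nonneg: "a j k1 k2 \<ge> 0"
    and children: "a j k1 k2 = (\<Sum>s<2. \<Sum>t<2. a (Suc j) (2 * k1 + s) (2 * k2 + t))"
begin

abbreviation "lam \<equiv> running_max a N"

lemma lam_nonneg: "lam i k1 k2 \<ge> 0"
  by (induction i arbitrary: k1 k2) (auto simp: nonneg)

text \<open>A square that is not selected has at most twice the average recorded for its parent; a
  selected one records its own average.\<close>

lemma avg_le: "4 ^ (N + i) * a (N + i) k1 k2 \<le> 2 * lam i k1 k2"
proof (cases i)
  case 0
  then show ?thesis using nonneg[of N k1 k2] by simp
next
  case (Suc m)
  then show ?thesis using nonneg[of "N + Suc m" k1 k2] by auto
qed

lemma lam_principal: "principal a N i k1 k2 \<Longrightarrow> lam i k1 k2 = 4 ^ (N + i) * a (N + i) k1 k2"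
  by (cases i) (auto simp: principal_def)

lemma lam_mono: "lam i (k1 div 2 ^ d) (k2 div 2 ^ d) \<le> lam (i + d) k1 k2"
proof (induction d arbitrary: k1 k2)
  case (Suc d)
  have "lam i (k1 div 2 ^ Suc d) (k2 div 2 ^ Suc d) \<le> lam (i + d) (k1 div 2) (k2 div 2)"
    using Suc[of "k1 div 2" "k2 div 2"] by (simp add: div_mult2_eq)
  also have "\<dots> \<le> lam (i + Suc d) k1 k2"
  proof -
    have *: "l \<le> (if v > 2 * l then v else l)" if "l \<ge> 0" for l v :: real using that by auto
    show ?thesis unfolding add_Suc_right running_max.simps(2) by (rule *[OF lam_nonneg])
  qed
  finally show ?case .
qed simp

text \<open>Intermediate between all squares and the principal ones: each term dominates half of the
  squared weight by \<open>avg_le\<close>, and on a principal square it equals the squared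
  weight.\<close>

definition tot :: "nat \<Rightarrow> real" where
  "tot i = (\<Sum>k1<2 ^ (N + i). \<Sum>k2<2 ^ (N + i). lam i k1 k2 * a (N + i) k1 k2 / 4 ^ (N + i))"

definition ptot :: "nat \<Rightarrow> real" where
  "ptot i = (\<Sum>k1<2 ^ (N + i). \<Sum>k2<2 ^ (N + i). if principal a N i k1 k2 then (a (N + i) k1 k2)\<^sup>2 else 0)"

lemma tot_0: "tot 0 = ptot 0"
proof -
  have "lam 0 k1 k2 * a (N + 0) k1 k2 / 4 ^ (N + 0) = (if principal a N 0 k1 k2 then (a (N + 0) k1 k2)\<^sup>2 else 0)"
    for k1 k2
    using nonneg[of N k1 k2] by (cases "a N k1 k2 = 0") (auto simp: principal_def power2_eq_square)
  then show ?thesis unfolding tot_def ptot_def by simp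
qed

text \<open>Non-principal children inherit the recorded average of the parent and their weights add
  up to at most its weight, while the normalization gains a factor 1/4. So \<open>tot\<close>
  contracts from level to level, except for newly selected squares.\<close>

lemma tot_Suc: "tot (Suc i) \<le> tot i / 4 + ptot (Suc i)"
proof -
  have "lam (Suc i) k1 k2 * a (N + Suc i) k1 k2 / 4 ^ (N + Suc i) \<le>
     lam i (k1 div 2) (k2 div 2) * a (N + Suc i) k1 k2 / 4 ^ (N + Suc i) +
     (if principal a N (Suc i) k1 k2 then (a (N + Suc i) k1 k2)\<^sup>2 else 0)" for k1 k2
  proof (cases "principal a N (Suc i) k1 k2")
    case True
    then show ?thesis using lam_principal[OF True] lam_nonneg[of i] nonneg[of "N + Suc i" k1 k2]
      by (simp add: power2_eq_square)
  next
    case False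
    then show ?thesis using nonneg[of "N + Suc i" k1 k2]
      by (cases "a (N + Suc i) k1 k2 = 0") (auto simp: principal_def)
  qed
  then have "tot (Suc i) \<le> (\<Sum>k1<2 ^ (N + Suc i). \<Sum>k2<2 ^ (N + Suc i).
     lam i (k1 div 2) (k2 div 2) * a (N + Suc i) k1 k2 / 4 ^ (N + Suc i)) + ptot (Suc i)"
    unfolding tot_def ptot_def sum.distrib[symmetric] by (intro sum_mono)
  also have "(\<Sum>k1<2 ^ (N + Suc i). \<Sum>k2<2 ^ (N + Suc i).
     lam i (k1 div 2) (k2 div 2) * a (N + Suc i) k1 k2 / 4 ^ (N + Suc i)) = tot i / 4"
    unfolding add_Suc_right sum_grid_children tot_def sum_divide_distrib
  proof (intro sum.cong refl)
    fix k1 k2 :: nat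
    have "(\<Sum>s<2. \<Sum>t<2. lam i ((2 * k1 + s) div 2) ((2 * k2 + t) div 2) * a (Suc (N + i)) (2 * k1 + s) (2 * k2 + t) / 4 ^ Suc (N + i))
      = (\<Sum>s<2. \<Sum>t<2. lam i k1 k2 / 4 ^ Suc (N + i) * a (Suc (N + i)) (2 * k1 + s) (2 * k2 + t))"
      by (intro sum.cong refl) auto
    also have "\<dots> = lam i k1 k2 / 4 ^ Suc (N + i) * a (N + i) k1 k2"
      by (subst children[of "N + i"]) (simp add: sum_distrib_left)
    finally show "(\<Sum>s<2. \<Sum>t<2. lam i ((2 * k1 + s) div 2) ((2 * k2 + t) div 2) * a (Suc (N + i)) (2 * k1 + s) (2 * k2 + t) / 4 ^ Suc (N + i))
      = lam i k1 k2 * a (N + i) k1 k2 / 4 ^ (N + i) / 4" by simp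
  qed
  finally show ?thesis .
qed

lemma tot_nonneg: "tot i \<ge> 0"
  unfolding tot_def by (intro sum_nonneg divide_nonneg_nonneg mult_nonneg_nonneg lam_nonneg nonneg) auto

text \<open>Geometric summation of \<open>tot_Suc\<close>. The extra \<open>tot n\<close> on the
  left is what lets the induction close.\<close>

lemma sum_tot_le: "3 * (\<Sum>i\<le>n. tot i) + tot n \<le> 4 * (\<Sum>i\<le>n. ptot i)"
proof (induction n)
  case 0
  then show ?case using tot_0 by simp
next
  case (Suc n)
  then show ?case using tot_Suc[of n] by simp
qed

text \<open>The constant is 2 times 4/3: the factor 2 of \<open>avg_le\<close> and the geometric
  series of ratio 1/4.\<close>

lemma sum_squares_le_principal:
  "(\<Sum>i\<le>n. \<Sum>k1<2 ^ (N + i). \<Sum>k2<2 ^ (N + i). (a (N + i) k1 k2)\<^sup>2) \<le> 8 / 3 * (\<Sum>i\<le>n. ptot i)"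
proof -
  have "(a (N + i) k1 k2)\<^sup>2 \<le> 2 * (lam i k1 k2 * a (N + i) k1 k2 / 4 ^ (N + i))" for i k1 k2
    using mult_right_mono[OF avg_le[of i k1 k2] nonneg[of "N + i" k1 k2]]
    by (simp add: field_simps power2_eq_square)
  then have "(\<Sum>i\<le>n. \<Sum>k1<2 ^ (N + i). \<Sum>k2<2 ^ (N + i). (a (N + i) k1 k2)\<^sup>2) \<le> 2 * (\<Sum>i\<le>n. tot i)"
    unfolding tot_def sum_distrib_left by (intro sum_mono)
  then show ?thesis using sum_tot_le[of n] tot_nonneg[of n] by simp
qed

section \<open>Sparsity of the principal squares\<close>

definition exceed :: "nat \<Rightarrow> nat \<Rightarrow> nat \<Rightarrow> nat \<Rightarrow> real \<Rightarrow> real" where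
  "exceed d i k1 k2 l = (\<Sum>s<2 ^ d. \<Sum>t<2 ^ d. of_bool (lam (i + d) (2 ^ d * k1 + s) (2 ^ d * k2 + t) > l))"

lemma exceed_Suc: "exceed (Suc d) i k1 k2 l = (\<Sum>s<2. \<Sum>t<2. exceed d (Suc i) (2 * k1 + s) (2 * k2 + t) l)"
proof -
  have dbl: "(\<Sum>s<2 ^ Suc d. h s) = (\<Sum>s<2 ^ d. h s) + (\<Sum>s<2 ^ d. h (2 ^ d + s))" for h :: "nat \<Rightarrow> real"
    by (simp add: mult_2 sum.nat_group[symmetric] lessThan_atLeast0 sum.atLeastLessThan_concat[of 0 "2 ^ d" "2 ^ d + 2 ^ d", symmetric]
        sum.shift_bounds_nat_ivl[of h 0 "2 ^ d" "2 ^ d", simplified] add.commute)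
  show ?thesis
    unfolding exceed_def dbl by (simp add: numeral_2_eq_2 sum.distrib algebra_simps)
qed

text \<open>A child whose recorded average changes has average above \<open>2 * l\<close>, so that
  even counting all its descendants is affordable; the other children fall under the induction
  hypothesis. For a principal square \<open>l\<close> is its own average, and the bound says that at
  most half of the descendants exceed \<open>l\<close>.\<close>

lemma exceed_le:
  assumes "lam i k1 k2 = l"
  shows "2 * l * exceed d i k1 k2 l \<le> 4 ^ (N + i + d) * a (N + i) k1 k2"
  using assms
proof (induction d arbitrary: i k1 k2)
  case 0
  then show ?case using nonneg[of "N + i" k1 k2] by (simp add: exceed_def)
next
  case (Suc d)
  have l: "l \<ge> 0" using Suc.prems lam_nonneg by auto
  have ch: "2 * l * exceed d (Suc i) (2 * k1 + s) (2 * k2 + t) l \<le> 4 ^ (N + i + Suc d) * a (Suc (N + i)) (2 * k1 + s) (2 * k2 + t)"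
    if "s < 2" "t < 2" for s t
  proof (cases "lam (Suc i) (2 * k1 + s) (2 * k2 + t) = l")
    case True
    then show ?thesis using Suc.IH[OF True] by simp
  next
    case False
    have dv: "(2 * k1 + s) div 2 = k1" "(2 * k2 + t) div 2 = k2" using that by auto
    have big: "4 ^ (N + Suc i) * a (N + Suc i) (2 * k1 + s) (2 * k2 + t) > 2 * l"
      using False Suc.prems by (simp add: dv split: if_splits)
    have "exceed d (Suc i) (2 * k1 + s) (2 * k2 + t) l \<le> (\<Sum>s<(2::nat) ^ d. \<Sum>t<(2::nat) ^ d. 1)"
      unfolding exceed_def by (intro sum_mono) auto
    also have "\<dots> = 4 ^ d" by (simp add: power_mult_distrib[symmetric])
    finally have "2 * l * exceed d (Suc i) (2 * k1 + s) (2 * k2 + t) l \<le> 2 * l * 4 ^ d"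
      using l by (intro mult_left_mono) auto
    also have "\<dots> \<le> 4 ^ (N + Suc i) * a (N + Suc i) (2 * k1 + s) (2 * k2 + t) * 4 ^ d"
      using big by (intro mult_right_mono) auto
    finally show ?thesis by (simp add: power_add algebra_simps)
  qed
  have "2 * l * exceed (Suc d) i k1 k2 l = (\<Sum>s<2. \<Sum>t<2. 2 * l * exceed d (Suc i) (2 * k1 + s) (2 * k2 + t) l)"
    by (simp add: exceed_Suc sum_distrib_left)
  also have "\<dots> \<le> (\<Sum>s<2. \<Sum>t<2. 4 ^ (N + i + Suc d) * a (Suc (N + i)) (2 * k1 + s) (2 * k2 + t))"
    by (intro sum_mono ch) auto
  also have "\<dots> = 4 ^ (N + i + Suc d) * a (N + i) k1 k2"
    by (subst children[of "N + i"]) (simp add: sum_distrib_left)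
  finally show ?case .
qed

text \<open>Closed squares of one level share edges, but sparsity asks for genuinely disjoint sets;
  the open cells are disjoint and lose no area.\<close>

definition open_cell :: "nat \<Rightarrow> nat \<Rightarrow> nat \<Rightarrow> pt set" where
  "open_cell j k1 k2 = box (2 * pi / 2 ^ j * real k1, 2 * pi / 2 ^ j * real k2)
     (2 * pi / 2 ^ j * (real k1 + 1), 2 * pi / 2 ^ j * (real k2 + 1))"

lemma open_cell_disjoint:
  assumes "x \<in> open_cell j k1 k2" "x \<in> open_cell j m1 m2" shows "k1 = m1 \<and> k2 = m2"
proof -
  have *: "k = m" if "l * real k < y" "y < l * (real k + 1)" "l * real m < y" "y < l * (real m + 1)" "l > 0" for l y k m
  proof -
    have "l * real k < l * (real m + 1)" "l * real m < l * (real k + 1)" using that by linarith+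
    then have "real k < real m + 1" "real m < real k + 1" using \<open>l > 0\<close> mult_less_cancel_left_pos by blast+
    then show ?thesis by linarith
  qed
  show ?thesis using assms unfolding open_cell_def mem_box
    by (cases x) (auto simp: Basis_prod_def inner_Pair intro: *[of "2 * pi / 2 ^ j"])
qed

lemma measure_open_cell: "measure lborel (open_cell j k1 k2) = (2 * pi / 2 ^ j)\<^sup>2"
proof -
  have "measure lborel (open_cell j k1 k2) = measure lborel (cell (2 * pi / 2 ^ j) (int k1) (int k2))"
    unfolding open_cell_def cell_def measure_lborel_box_eq measure_lborel_cbox_eq by simp
  then show ?thesis by (simp add: content_cell)
qed

text \<open>The disjoint sets witnessing sparsity, up to level \<open>N + L\<close>: the points of a square that lie in no
  principal square further down.\<close>
definition stay :: "nat \<Rightarrow> nat \<Rightarrow> nat \<Rightarrow> nat \<Rightarrow> (nat \<times> nat) set" where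
  "stay L i k1 k2 = {(s, t). s < 2 ^ (L - i) \<and> t < 2 ^ (L - i) \<and>
     lam L (2 ^ (L - i) * k1 + s) (2 ^ (L - i) * k2 + t) = lam i k1 k2}"

definition core :: "nat \<Rightarrow> nat \<Rightarrow> nat \<Rightarrow> nat \<Rightarrow> pt set" where
  "core L i k1 k2 = (\<Union>(s, t)\<in>stay L i k1 k2. open_cell (N + L) (2 ^ (L - i) * k1 + s) (2 ^ (L - i) * k2 + t))"

lemma finite_stay: "finite (stay L i k1 k2)"
  by (rule finite_subset[of _ "{..<2 ^ (L - i)} \<times> {..<2 ^ (L - i)}"]) (auto simp: stay_def)

lemma core_measurable: "core L i k1 k2 \<in> sets lborel"
  unfolding core_def open_cell_def using finite_stay by (auto intro!: sets.finite_UN)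

lemma core_subset:
  assumes "i \<le> L" shows "core L i k1 k2 \<subseteq> dyadic_square (N + i) k1 k2"
proof -
  have e: "(2::real) ^ (N + L) = 2 ^ (N + i) * 2 ^ (L - i)" using assms by (simp flip: power_add)
  have *: "2 * pi * real k / 2 ^ (N + i) \<le> y \<and> y \<le> 2 * pi * (real k + 1) / 2 ^ (N + i)"
    if y: "2 * pi / 2 ^ (N + L) * real (2 ^ (L - i) * k + s) < y" "y < 2 * pi / 2 ^ (N + L) * (real (2 ^ (L - i) * k + s) + 1)"
      and s: "s < 2 ^ (L - i)" for y k s
  proof -
    have s': "real s + 1 \<le> 2 ^ (L - i)" using s by (metis Suc_leI of_nat_Suc of_nat_le_iff of_nat_numeral of_nat_power add.commute)
    have "2 * pi * real k / 2 ^ (N + i) \<le> 2 * pi / 2 ^ (N + L) * real (2 ^ (L - i) * k + s)"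
      unfolding e by (simp add: field_simps)
    moreover have "2 * pi / 2 ^ (N + L) * (real (2 ^ (L - i) * k + s) + 1) \<le> 2 * pi / 2 ^ (N + L) * (2 ^ (L - i) * (real k + 1))"
      using s' by (intro mult_left_mono) (auto simp: algebra_simps)
    moreover have "2 * pi / 2 ^ (N + L) * (2 ^ (L - i) * (real k + 1)) = 2 * pi * (real k + 1) / 2 ^ (N + i)"
      unfolding e by (simp add: field_simps)
    ultimately show ?thesis using y by linarith
  qed
  show ?thesis
  proof
    fix x assume "x \<in> core L i k1 k2"
    then obtain s t where st: "s < 2 ^ (L - i)" "t < 2 ^ (L - i)"
      and x: "x \<in> open_cell (N + L) (2 ^ (L - i) * k1 + s) (2 ^ (L - i) * k2 + t)"
      unfolding core_def stay_def by blast
    obtain x1 x2 where xx: "x = (x1, x2)" by fastforce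
    have "2 * pi / 2 ^ (N + L) * real (2 ^ (L - i) * k1 + s) < x1" "x1 < 2 * pi / 2 ^ (N + L) * (real (2 ^ (L - i) * k1 + s) + 1)"
      "2 * pi / 2 ^ (N + L) * real (2 ^ (L - i) * k2 + t) < x2" "x2 < 2 * pi / 2 ^ (N + L) * (real (2 ^ (L - i) * k2 + t) + 1)"
      using x unfolding open_cell_def xx mem_box by (auto simp: Basis_prod_def inner_Pair)
    then show "x \<in> dyadic_square (N + i) k1 k2"
      using *[OF _ _ st(1)] *[OF _ _ st(2)] by (auto simp: dyadic_square_def xx cbox_Pair_eq)
  qed
qed

text \<open>A common point lies in a single open cell of level \<open>N + L\<close>, whose recorded
  average would equal that of both squares. If \<open>i < j\<close>, selecting the smaller square
  has more than doubled a value that was at least \<open>lam i k1 k2\<close>, which is impossible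
  for equal positive numbers.\<close>

lemma core_disjoint:
  assumes "x \<in> core L i k1 k2" "x \<in> core L j m1 m2" "i \<le> j" "j \<le> L" "principal a N j m1 m2"
  shows "i = j \<and> k1 = m1 \<and> k2 = m2"
proof -
  obtain s t where st: "s < 2 ^ (L - i)" "t < 2 ^ (L - i)" "lam L (2 ^ (L - i) * k1 + s) (2 ^ (L - i) * k2 + t) = lam i k1 k2"
    "x \<in> open_cell (N + L) (2 ^ (L - i) * k1 + s) (2 ^ (L - i) * k2 + t)"
    using assms(1) unfolding core_def stay_def by blast
  obtain s' t' where st': "s' < 2 ^ (L - j)" "t' < 2 ^ (L - j)" "lam L (2 ^ (L - j) * m1 + s') (2 ^ (L - j) * m2 + t') = lam j m1 m2"
    "x \<in> open_cell (N + L) (2 ^ (L - j) * m1 + s') (2 ^ (L - j) * m2 + t')"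
    using assms(2) unfolding core_def stay_def by blast
  have eq: "2 ^ (L - i) * k1 + s = 2 ^ (L - j) * m1 + s'" "2 ^ (L - i) * k2 + t = 2 ^ (L - j) * m2 + t'"
    using open_cell_disjoint[OF st(4) st'(4)] by auto
  have anc: "k = m div 2 ^ (j - i)" if "2 ^ (L - i) * k + u = 2 ^ (L - j) * m + u'" "u < 2 ^ (L - i)" "u' < 2 ^ (L - j)" for k m u u' :: nat
  proof -
    have "k = (2 ^ (L - i) * k + u) div 2 ^ (L - i)" using that(2) by simp
    also have "\<dots> = (2 ^ (L - j) * m + u') div (2 ^ (L - j) * 2 ^ (j - i))"
      using that(1) assms(3,4) by (simp flip: power_add)
    also have "\<dots> = m div 2 ^ (j - i)" using that(3) by (simp add: div_mult2_eq)
    finally show ?thesis .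
  qed
  have k: "k1 = m1 div 2 ^ (j - i)" "k2 = m2 div 2 ^ (j - i)" using anc[OF eq(1)] anc[OF eq(2)] st st' by auto
  have leq: "lam i k1 k2 = lam j m1 m2" using st(3) st'(3) eq by simp
  show ?thesis
  proof (cases "i = j")
    case False
    then obtain d where d: "j = Suc (i + d)" using assms(3) by (metis le_imp_less_or_eq less_imp_Suc_add)
    have "lam i k1 k2 \<le> lam (i + d) (m1 div 2) (m2 div 2)"
      using lam_mono[of i "m1 div 2" d "m2 div 2"] by (simp add: k d div_mult2_eq)
    moreover have "2 * lam (i + d) (m1 div 2) (m2 div 2) < lam j m1 m2" "lam j m1 m2 > 0"
      using assms(5) lam_principal[OF assms(5)] by (auto simp: principal_def d)
    ultimately show ?thesis using leq lam_nonneg[of "i + d" "m1 div 2" "m2 div 2"] by linarith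
  qed (use k in auto)
qed

text \<open>Here the selection threshold 2 becomes the sparsity constant 1/2: the core is made of
  the descendants not counted by \<open>exceed\<close>, and \<open>exceed_le\<close> bounds those by
  half.\<close>

lemma measure_core:
  assumes "i \<le> L" "principal a N i k1 k2"
  shows "measure lborel (core L i k1 k2) \<ge> measure lborel (dyadic_square (N + i) k1 k2) / 2"
proof -
  define d where "d = L - i"
  define l where "l = lam i k1 k2"
  have L: "L = i + d" using assms by (simp add: d_def)
  have "measure lborel (core L i k1 k2) =
    (\<Sum>p\<in>stay L i k1 k2. measure lborel (case p of (s, t) \<Rightarrow> open_cell (N + L) (2 ^ (L - i) * k1 + s) (2 ^ (L - i) * k2 + t)))"
    unfolding core_def
  proof (rule measure_finite_Union[OF finite_stay])
    show "disjoint_family_on (\<lambda>(s, t). open_cell (N + L) (2 ^ (L - i) * k1 + s) (2 ^ (L - i) * k2 + t)) (stay L i k1 k2)"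
      unfolding disjoint_family_on_def using open_cell_disjoint by fastforce
  qed (auto simp: open_cell_def emeasure_lborel_box_eq)
  also have "\<dots> = real (card (stay L i k1 k2)) * (2 * pi / 2 ^ (N + L))\<^sup>2"
    by (simp add: case_prod_beta measure_open_cell)
  finally have m: "measure lborel (core L i k1 k2) = real (card (stay L i k1 k2)) * (2 * pi / 2 ^ (N + L))\<^sup>2" .
  have "real (card (stay L i k1 k2)) = (\<Sum>p\<in>{..<2 ^ d} \<times> {..<2 ^ d}. of_bool (p \<in> stay L i k1 k2))"
    by (subst sum_of_bool_eq) (auto simp: stay_def d_def intro!: arg_cong[where f=card])
  also have "\<dots> = (\<Sum>p\<in>{..<2 ^ d} \<times> {..<2 ^ d}. 1 - of_bool (lam (i + d) (2 ^ d * k1 + fst p) (2 ^ d * k2 + snd p) > l))"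
  proof (intro sum.cong refl)
    fix p :: "nat \<times> nat" assume p: "p \<in> {..<2 ^ d} \<times> {..<2 ^ d}"
    \<comment> \<open>Recorded averages never decrease along a branch, so a descendant that does not
      exceed \<open>l\<close> has recorded average exactly \<open>l\<close>.\<close>
    have "l \<le> lam (i + d) (2 ^ d * k1 + fst p) (2 ^ d * k2 + snd p)"
      using lam_mono[of i "2 ^ d * k1 + fst p" d "2 ^ d * k2 + snd p"] p by (auto simp: l_def)
    then show "(of_bool (p \<in> stay L i k1 k2) :: real) = 1 - of_bool (lam (i + d) (2 ^ d * k1 + fst p) (2 ^ d * k2 + snd p) > l)"
      using p by (auto simp: stay_def L l_def)
  qed
  also have "\<dots> = 4 ^ d - exceed d i k1 k2 l"
    unfolding exceed_def sum.cartesian_product case_prod_beta sum_subtractf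
    by (simp add: power_mult_distrib[symmetric] del: sum_of_bool_eq)
  finally have card: "real (card (stay L i k1 k2)) = 4 ^ d - exceed d i k1 k2 l" .
  have l: "l = 4 ^ (N + i) * a (N + i) k1 k2" "l > 0"
    using lam_principal[OF assms(2)] assms(2) by (auto simp: l_def principal_def)
  have "l * (2 * exceed d i k1 k2 l) \<le> l * 4 ^ d"
    using exceed_le[of i k1 k2 l d] l(1) by (simp add: l_def power_add algebra_simps)
  then have "2 * exceed d i k1 k2 l \<le> 4 ^ d" using l(2) by simp
  then have "real (card (stay L i k1 k2)) \<ge> 4 ^ d / 2" using card by simp
  then have "measure lborel (core L i k1 k2) \<ge> 4 ^ d / 2 * (2 * pi / 2 ^ (N + L))\<^sup>2"
    unfolding m by (rule mult_right_mono) simp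
  moreover have "4 ^ d / 2 * (2 * pi / 2 ^ (N + L))\<^sup>2 = (2 * pi / 2 ^ (N + i))\<^sup>2 / 2"
    by (simp add: L power_add power2_eq_square field_simps power_mult_distrib[symmetric])
  ultimately show ?thesis by (simp add: dyadic_square_cell content_cell)
qed

definition index_set :: "nat \<Rightarrow> (nat \<times> nat \<times> nat) set" where
  "index_set L = {(i, k1, k2). i \<le> L \<and> k1 < 2 ^ (N + i) \<and> k2 < 2 ^ (N + i) \<and> principal a N i k1 k2}"

definition dsq :: "nat \<times> nat \<times> nat \<Rightarrow> pt set" where
  "dsq = (\<lambda>(i, k1, k2). dyadic_square (N + i) k1 k2)"

lemma inj_dsq: "inj_on dsq X"
  by (auto simp: inj_on_def dsq_def dest: dyadic_square_inj)

lemma finite_index_set: "finite (index_set L)"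
proof -
  have "index_set L \<subseteq> (SIGMA i:{..L}. {..<2 ^ (N + i)} \<times> {..<2 ^ (N + i)})"
    by (auto simp: index_set_def)
  then show ?thesis by (rule finite_subset) auto
qed

lemma sparse_principal: "sparse_family (dsq ` index_set L)"
  unfolding sparse_family_def
proof (intro conjI exI)
  show "dsq ` index_set L \<subseteq> dyadic_squares"
    by (auto simp: dsq_def index_set_def dyadic_squares_def)
  show "countable (dsq ` index_set L)" using finite_index_set by (simp add: countable_finite)
  \<comment> \<open>Sparsity asks for a set attached to the square itself; \<open>inj_dsq\<close>
    recovers the index from the square.\<close>
  let ?E = "\<lambda>Q. case inv_into (index_set L) dsq Q of (i, k1, k2) \<Rightarrow> core L i k1 k2"
  show "\<forall>Q\<in>dsq ` index_set L. ?E Q \<in> sets lborel \<and> ?E Q \<subseteq> Q \<and> measure lborel Q / 2 \<le> measure lborel (?E Q)"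
  proof (clarsimp simp: inv_into_f_f[OF inj_dsq], intro conjI)
    fix i k1 k2 assume i: "(i, k1, k2) \<in> index_set L"
    show "core L i k1 k2 \<in> sets borel" using core_measurable by simp
    show "core L i k1 k2 \<subseteq> dsq (i, k1, k2)" using i core_subset by (simp add: index_set_def dsq_def)
    show "measure lborel (dsq (i, k1, k2)) \<le> measure lborel (core L i k1 k2) * 2"
      using i measure_core[of i L k1 k2] by (simp add: index_set_def dsq_def)
  qed
  show "disjoint_family_on ?E (dsq ` index_set L)"
    unfolding disjoint_family_on_def
  proof (clarsimp simp: inv_into_f_f[OF inj_dsq])
    fix i k1 k2 j m1 m2
    assume i: "(i, k1, k2) \<in> index_set L" and j: "(j, m1, m2) \<in> index_set L"
      and ne: "dsq (i, k1, k2) \<noteq> dsq (j, m1, m2)"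
    show "core L i k1 k2 \<inter> core L j m1 m2 = {}"
      using i j ne core_disjoint[of _ L i k1 k2 j m1 m2] core_disjoint[of _ L j m1 m2 i k1 k2]
      by (cases "i \<le> j") (auto simp: index_set_def)
  qed
qed

lemma sum_index_set: "(\<Sum>(i, k1, k2)\<in>index_set L. (a (N + i) k1 k2)\<^sup>2) = (\<Sum>i\<le>L. ptot i)"
proof -
  let ?S = "SIGMA i:{..L}. {..<2 ^ (N + i)} \<times> {..<2 ^ (N + i)}"
  have "(\<Sum>i\<le>L. ptot i) = (\<Sum>(i, k1, k2)\<in>?S. if principal a N i k1 k2 then (a (N + i) k1 k2)\<^sup>2 else 0)"
    unfolding ptot_def by (simp add: sum.cartesian_product sum.Sigma case_prod_beta)
  also have "\<dots> = (\<Sum>(i, k1, k2)\<in>index_set L. (a (N + i) k1 k2)\<^sup>2)"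
    by (rule sum.mono_neutral_cong_right) (auto simp: index_set_def split: if_splits)
  finally show ?thesis by simp
qed

end

section \<open>From principal squares to the sparse seminorm\<close>

lemma dyadic_measure_integral:
  assumes "continuous_on UNIV f"
  shows "dyadic_measure (\<lambda>j k1 k2. integral (dyadic_square j k1 k2) (\<lambda>x. \<bar>f x\<bar> :: real))"
proof
  have i: "(\<lambda>x. \<bar>f x\<bar>) integrable_on dyadic_square j k1 k2" for j k1 k2
    unfolding dyadic_square_def by (intro cont_int continuous_intros assms)
  show "integral (dyadic_square j k1 k2) (\<lambda>x. \<bar>f x\<bar>) \<ge> 0" for j k1 k2
    by (rule integral_nonneg[OF i]) auto
  show "integral (dyadic_square j k1 k2) (\<lambda>x. \<bar>f x\<bar>) =
     (\<Sum>s<2. \<Sum>t<2. integral (dyadic_square (Suc j) (2 * k1 + s) (2 * k2 + t)) (\<lambda>x. \<bar>f x\<bar>))" for j k1 k2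
    by (rule integral_dyadic_children[OF i])
qed

lemma nn_integral_dyadic:
  assumes "continuous_on UNIV f"
  shows "(\<integral>\<^sup>+ x\<in>dyadic_square j k1 k2. ennreal \<bar>f x\<bar> \<partial>lborel) = ennreal (integral (dyadic_square j k1 k2) (\<lambda>x. \<bar>f x\<bar>))"
proof -
  have s: "set_integrable lborel (dyadic_square j k1 k2) (\<lambda>x. \<bar>f x\<bar>)"
    unfolding dyadic_square_def set_integrable_def
    by (rule borel_integrable_compact) (auto intro!: continuous_intros continuous_on_subset[OF assms])
  have "(\<integral>\<^sup>+ x\<in>dyadic_square j k1 k2. ennreal \<bar>f x\<bar> \<partial>lborel)
    = (\<integral>\<^sup>+ x. ennreal (indicator (dyadic_square j k1 k2) x *\<^sub>R \<bar>f x\<bar>) \<partial>lborel)"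
    by (intro nn_integral_cong) (auto split: split_indicator)
  also have "\<dots> = ennreal (LINT x:dyadic_square j k1 k2|lborel. \<bar>f x\<bar>)"
    unfolding set_lebesgue_integral_def
    by (rule nn_integral_eq_integral) (use s in \<open>auto simp: set_integrable_def\<close>)
  finally show ?thesis by (simp add: set_borel_integral_eq_integral(2)[OF s])
qed

lemma ennsqrt_ennreal: "x \<ge> 0 \<Longrightarrow> ennsqrt (ennreal x) = ennreal (sqrt x)"
  by (simp add: ennsqrt_def)

text \<open>For \<open>Suc N\<close> the size threshold is 2^(-N) times the side of
  \<open>Q0\<close>, that is level at least \<open>N\<close>, so nothing of the family is filtered
  out. Finiteness turns the \<open>infsum\<close> in \<open>ennreal\<close> into a sum of
  reals.\<close>

lemma finite_sparse_sum_le: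
  assumes c: "continuous_on UNIV f" and sp: "sparse_family (sq ` X)" and fin: "finite X"
    and inj: "inj_on sq X"
    and lev: "\<And>p. p \<in> X \<Longrightarrow> \<exists>j k1 k2. sq p = dyadic_square j k1 k2 \<and> N \<le> j"
    and s: "sN f (Suc N) \<le> ennreal B" and B: "B \<ge> 0"
  shows "(\<Sum>p\<in>X. (integral (sq p) (\<lambda>x. \<bar>f x\<bar>))\<^sup>2) \<le> B\<^sup>2"
proof -
  let ?S = "\<Sum>p\<in>X. (integral (sq p) (\<lambda>x. \<bar>f x\<bar>))\<^sup>2"
  have S: "?S \<ge> 0" by (intro sum_nonneg) auto
  have le: "sidelen Q \<le> 2 powr (- (real (Suc N) - 1)) * sidelen Q0" if Q: "Q \<in> sq ` X" for Q
  proof -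
    obtain p where p: "p \<in> X" "Q = sq p" using Q by blast
    obtain j k1 k2 where "Q = dyadic_square j k1 k2" "N \<le> j" using lev[OF p(1)] p(2) by blast
    then show ?thesis by (auto simp: sidelen_dyadic sidelen_Q0 powr_minus powr_realpow divide_simps)
  qed
  have I: "0 \<le> integral (sq p) (\<lambda>x. \<bar>f x\<bar>)"
    "(\<integral>\<^sup>+ x\<in>sq p. ennreal \<bar>f x\<bar> \<partial>lborel) = ennreal (integral (sq p) (\<lambda>x. \<bar>f x\<bar>))" if pX: "p \<in> X" for p
  proof -
    obtain j k1 k2 where p: "sq p = dyadic_square j k1 k2" using lev[OF pX] by blast
    show "0 \<le> integral (sq p) (\<lambda>x. \<bar>f x\<bar>)" unfolding p dyadic_square_def
      by (intro integral_nonneg cont_int continuous_intros c) auto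
    show "(\<integral>\<^sup>+ x\<in>sq p. ennreal \<bar>f x\<bar> \<partial>lborel) = ennreal (integral (sq p) (\<lambda>x. \<bar>f x\<bar>))"
      unfolding p by (rule nn_integral_dyadic[OF c])
  qed
  have "ennreal ?S = (\<Sum>p\<in>X. (ennreal (integral (sq p) (\<lambda>x. \<bar>f x\<bar>)))\<^sup>2)"
    using I by (subst sum_ennreal[symmetric]) (auto simp: ennreal_power)
  also have "\<dots> = (\<Sum>Q\<in>sq ` X. (\<integral>\<^sup>+ x\<in>Q. ennreal \<bar>f x\<bar> \<partial>lborel)\<^sup>2)"
    using I by (simp add: sum.reindex[OF inj])
  also have "sq ` X = {Q \<in> sq ` X. sidelen Q \<le> 2 powr (- (real (Suc N) - 1)) * sidelen Q0}"
    using le by auto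
  also have "(\<Sum>Q\<in>\<dots>. (\<integral>\<^sup>+ x\<in>Q. ennreal \<bar>f x\<bar> \<partial>lborel)\<^sup>2) = infsum (\<lambda>Q. (\<integral>\<^sup>+ x\<in>Q. ennreal \<bar>f x\<bar> \<partial>lborel)\<^sup>2) \<dots>"
    by (rule infsum_finite[symmetric]) (use fin in auto)
  finally have eq: "infsum (\<lambda>Q. (\<integral>\<^sup>+ x\<in>Q. ennreal \<bar>f x\<bar> \<partial>lborel)\<^sup>2) {Q \<in> sq ` X. sidelen Q \<le> 2 powr (- (real (Suc N) - 1)) * sidelen Q0} = ennreal ?S"
    by simp
  have "ennsqrt (ennreal ?S) \<le> sN f (Suc N)"
    unfolding sN_def eq[symmetric] by (rule SUP_upper) (use sp in auto)
  then have "ennreal (sqrt ?S) \<le> ennreal B" using s S by (simp add: ennsqrt_ennreal)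
  then have "sqrt ?S \<le> B" using B by (simp add: ennreal_le_iff)
  then show ?thesis using S by (simp add: sqrt_le_D)
qed

text \<open>One sparse family, the principal squares down to level \<open>N + L\<close>, pays for
  all squares of these levels. The bound does not depend on \<open>L\<close>, so finite families
  suffice to control every level from \<open>N\<close> on.\<close>

lemma dyadic_sum_le_sN:
  assumes c: "continuous_on UNIV f" and s: "sN f (Suc N) \<le> ennreal B" and B: "B \<ge> 0"
  shows "(\<Sum>i\<le>L. \<Sum>k1<2 ^ (N + i). \<Sum>k2<2 ^ (N + i). (integral (dyadic_square (N + i) k1 k2) (\<lambda>x. \<bar>f x\<bar>))\<^sup>2)
    \<le> 8 / 3 * B\<^sup>2"
proof -
  interpret dyadic_measure "\<lambda>j k1 k2. integral (dyadic_square j k1 k2) (\<lambda>x. \<bar>f x\<bar>)" N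
    by (rule dyadic_measure_integral[OF c])
  have "(\<Sum>p\<in>index_set L. (integral (dsq p) (\<lambda>x. \<bar>f x\<bar>))\<^sup>2) \<le> B\<^sup>2"
    by (rule finite_sparse_sum_le[OF c sparse_principal finite_index_set inj_dsq _ s B])
      (auto simp: dsq_def index_set_def intro: le_add1)
  then have "(\<Sum>i\<le>L. ptot i) \<le> B\<^sup>2"
    unfolding sum_index_set[symmetric] by (simp add: dsq_def case_prod_beta)
  then show ?thesis using sum_squares_le_principal[of L] by linarith
qed

section \<open>Autocorrelation and dyadic squares\<close>

text \<open>A square instead of a disc: its dilates and translates are boxes, directly comparable
  with dyadic cells, and it contains the support of \<open>bump\<close>.\<close>

definition unit_box :: "pt set" where "unit_box = cbox (-1, -1) (1, 1)"

lemma mem_unit_box: "y \<in> unit_box \<longleftrightarrow> \<bar>fst y\<bar> \<le> 1 \<and> \<bar>snd y\<bar> \<le> 1"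
  by (cases y) (auto simp: unit_box_def cbox_Pair_eq)

lemma integral_unit_box_scale:
  fixes f :: "pt \<Rightarrow> real"
  assumes f: "continuous_on UNIV f" and r: "r > 0"
  shows "r\<^sup>2 * integral unit_box (\<lambda>y. f (x + r *\<^sub>R y)) = integral (cbox (x - (r, r)) (x + (r, r))) f"
proof -
  have "(f has_integral integral (cbox (x - (r, r)) (x + (r, r))) f) (cbox (x - (r, r)) (x + (r, r)))"
    by (intro integrable_integral cont_int f)
  from has_integral_affinity'[OF this r, of x]
  have "((\<lambda>y. f (r *\<^sub>R y + x)) has_integral integral (cbox (x - (r, r)) (x + (r, r))) f /\<^sub>R r\<^sup>2) unit_box"
    using r by (simp add: unit_box_def algebra_simps power2_eq_square)
  then show ?thesis using r by (simp add: integral_unique add.commute)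
qed

lemma integral_cell_periodic:
  fixes f :: "pt \<Rightarrow> real"
  assumes "periodic2 f" "l * of_int n = 2 * pi"
  shows "integral (cell l (i + n) j) f = integral (cell l i j) f"
    and "integral (cell l i (j + n)) f = integral (cell l i j) f"
proof -
  have e: "l * (of_int i + of_int n) = l * of_int i + 2 * pi" "l * (of_int i + of_int n + 1) = l * (of_int i + 1) + 2 * pi" for i :: int
    using assms(2) by (auto simp: algebra_simps)
  have "(\<lambda>x. f ((2 * pi, 0) + x)) = f" "(\<lambda>x. f ((0, 2 * pi) + x)) = f"
    using assms(1) by (auto simp: periodic2_def add.commute simp del: add_Pair)
  then show "integral (cell l (i + n) j) f = integral (cell l i j) f"
    "integral (cell l i (j + n)) f = integral (cell l i j) f"
    using integral_shift_cbox_plus[of "(l * of_int i, l * of_int j)" "(l * (of_int i + 1), l * (of_int j + 1))" f "(2 * pi, 0)"]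
      integral_shift_cbox_plus[of "(l * of_int i, l * of_int j)" "(l * (of_int i + 1), l * (of_int j + 1))" f "(0, 2 * pi)"]
    by (simp_all add: cell_def e o_def)
qed

text \<open>A square of half-side at most \<open>l\<close> about a point of a cell stays within the
  3 x 3 block of cells around it.\<close>

lemma integral_square_le_cells:
  fixes f :: "pt \<Rightarrow> real"
  assumes f: "continuous_on UNIV f" "\<And>x. f x \<ge> 0" and x: "x \<in> cell l i j" and s: "0 < s" "s \<le> l"
  shows "integral (cbox (x - (s, s)) (x + (s, s))) f \<le> (\<Sum>p<3. \<Sum>q<3. integral (cell l (i - 1 + int p) (j - 1 + int q)) f)"
proof -
  obtain x1 x2 where xx: "x = (x1, x2)" by fastforce
  have x': "l * of_int i \<le> x1" "x1 \<le> l * of_int i + l" "l * of_int j \<le> x2" "x2 \<le> l * of_int j + l"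
    using x by (auto simp: cell_def xx cbox_Pair_eq algebra_simps)
  have "integral (cbox (x - (s, s)) (x + (s, s))) f \<le>
    integral (cbox (l * of_int (i - 1), l * of_int (j - 1)) (l * (of_int (i - 1) + real 3), l * (of_int (j - 1) + real 3))) f"
  proof (rule integral_subset_le)
    have "cbox (x1 - s) (x1 + s) \<subseteq> cbox (l * of_int (i - 1)) (l * (of_int (i - 1) + real 3))"
      "cbox (x2 - s) (x2 + s) \<subseteq> cbox (l * of_int (j - 1)) (l * (of_int (j - 1) + real 3))"
      using x' s by (auto simp: algebra_simps)
    then show "cbox (x - (s, s)) (x + (s, s)) \<subseteq>
      cbox (l * of_int (i - 1), l * of_int (j - 1)) (l * (of_int (i - 1) + real 3), l * (of_int (j - 1) + real 3))"
      unfolding xx diff_Pair add_Pair cbox_Pair_eq by blast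
  qed (use f in \<open>auto intro: cont_int\<close>)
  also have "\<dots> = (\<Sum>p<3. \<Sum>q<3. integral (cell l (i - 1 + int p) (j - 1 + int q)) f)"
    using s by (intro integral_grid cont_int f) auto
  finally show ?thesis .
qed

lemma sum_period_shift1:
  fixes g :: "int \<Rightarrow> real"
  assumes "\<And>k. g (k + int n) = g k"
  shows "(\<Sum>k<n. g (int k + 1)) = (\<Sum>k<n. g (int k))"
proof -
  have "(\<Sum>k<m. g (int k + 1)) = (\<Sum>k<m. g (int k)) + g (int m) - g 0" for m
    by (induction m) (auto simp: add.commute)
  from this[of n] show ?thesis using assms[of 0] by simp
qed

lemma sum_period_shift3:
  fixes g :: "int \<Rightarrow> real"
  assumes g: "\<And>k. g (k + int n) = g k" and p: "p < 3"
  shows "(\<Sum>k<n. g (int k - 1 + int p)) = (\<Sum>k<n. g (int k))"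
proof -
  have g': "g (k + int n - 1) = g (k - 1)" for k using g[of "k - 1"] by (simp add: algebra_simps)
  have "(\<Sum>k<n. g (int k - 1)) = (\<Sum>k<n. g (int k))"
    using sum_period_shift1[of "\<lambda>k. g (k - 1)" n] g' by simp
  moreover have "(\<Sum>k<n. g (int k + 1)) = (\<Sum>k<n. g (int k))"
    by (rule sum_period_shift1) (rule g)
  moreover have "int k - 1 + int 0 = int k - 1" "int k - 1 + int 1 = int k" "int k - 1 + int 2 = int k + 1" for k
    by auto
  moreover have "p = 0 \<or> p = 1 \<or> p = 2" using p by linarith
  ultimately show ?thesis by (elim disjE) (simp_all only:)
qed

text \<open>By Fubini the left side integrates f(x) against the mass of \<open>f\<close> in the
  square of half-side \<open>s\<close> about x, and that square lies in the 3 x 3 block around the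
  cell of x. By 2ab <= a^2 + b^2 each of the nine pairings of a cell with a neighbour costs one full
  sum of squares, because an index shift permutes the periodic grid.\<close>

lemma corr_abs_box_le:
  fixes f :: "pt \<Rightarrow> real"
  assumes f: "continuous_on UNIV f" "\<And>x. f x \<ge> 0" and per: "periodic2 f" and s: "0 < s" "s \<le> 2 * pi / 2 ^ n"
  shows "s\<^sup>2 * integral unit_box (\<lambda>y. corr f f (s *\<^sub>R y)) \<le>
    9 * (\<Sum>k1<2 ^ n. \<Sum>k2<2 ^ n. (integral (dyadic_square n k1 k2) f)\<^sup>2)"
proof -
  define l where "l = 2 * pi / 2 ^ n"
  define c where "c = (\<lambda>i j. integral (cell l i j) f)"
  define w where "w = (\<lambda>x. integral (cbox (x - (s, s)) (x + (s, s))) f)"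
  have w: "w = (\<lambda>x. s\<^sup>2 * integral unit_box (\<lambda>y. f (x + s *\<^sub>R y)))"
    unfolding w_def integral_unit_box_scale[OF f(1) s(1)] ..
  have wc: "continuous_on UNIV w"
    unfolding w unit_box_def
    by (intro continuous_intros integral_continuous_on_param)
      (auto simp: case_prod_beta intro!: continuous_intros cont_compose[OF f(1)])
  have per_c: "c (i + 2 ^ n) j = c i j" "c i (j + 2 ^ n) = c i j" for i j
    unfolding c_def using integral_cell_periodic[OF per, of l "2 ^ n"] by (auto simp: l_def)
  have c0: "c i j \<ge> 0" for i j
    unfolding c_def cell_def by (intro integral_nonneg cont_int f)
  have "integral unit_box (\<lambda>y. corr f f (s *\<^sub>R y)) = integral Q0 (\<lambda>x. integral unit_box (\<lambda>y. f x * f (x + s *\<^sub>R y)))"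
    unfolding corr_def unit_box_def Q0_def
    by (rule integral_swap_continuous)
      (auto simp: case_prod_beta intro!: continuous_intros cont_compose[OF f(1)])
  then have "s\<^sup>2 * integral unit_box (\<lambda>y. corr f f (s *\<^sub>R y)) = integral Q0 (\<lambda>x. f x * w x)"
    unfolding w by (simp add: integral_mult_right[symmetric] mult_ac del: integral_mult_right)
  also have "\<dots> = (\<Sum>k1<2 ^ n. \<Sum>k2<2 ^ n. integral (dyadic_square n k1 k2) (\<lambda>x. f x * w x))"
    by (rule integral_Q0_dyadic) (auto simp: Q0_def intro!: cont_int continuous_intros f wc)
  also have "\<dots> \<le> (\<Sum>k1<2 ^ n. \<Sum>k2<2 ^ n. \<Sum>p<3. \<Sum>q<3. c (int k1) (int k2) * c (int k1 - 1 + int p) (int k2 - 1 + int q))"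
  proof (intro sum_mono)
    fix k1 k2 :: nat
    let ?S = "\<Sum>p<3. \<Sum>q<3. c (int k1 - 1 + int p) (int k2 - 1 + int q)"
    have "integral (cell l (int k1) (int k2)) (\<lambda>x. f x * w x) \<le> integral (cell l (int k1) (int k2)) (\<lambda>x. f x * ?S)"
    proof (rule integral_le)
      fix x assume "x \<in> cell l (int k1) (int k2)"
      from integral_square_le_cells[OF f this s(1)] s(2)
      show "f x * w x \<le> f x * ?S"
        unfolding w_def c_def l_def by (intro mult_left_mono f) auto
    qed (auto simp: cell_def intro!: cont_int continuous_intros f wc)
    then show "integral (dyadic_square n k1 k2) (\<lambda>x. f x * w x) \<le> (\<Sum>p<3. \<Sum>q<3. c (int k1) (int k2) * c (int k1 - 1 + int p) (int k2 - 1 + int q))"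
      by (simp add: dyadic_square_cell l_def[symmetric] fun_cong[OF fun_cong[OF c_def], of "int k1" "int k2", symmetric] sum_distrib_left[symmetric])
  qed
  also have "\<dots> \<le> (\<Sum>k1<2 ^ n. \<Sum>k2<2 ^ n. \<Sum>p<3. \<Sum>q<3. (c (int k1) (int k2))\<^sup>2 / 2 + (c (int k1 - 1 + int p) (int k2 - 1 + int q))\<^sup>2 / 2)"
  proof (intro sum_mono)
    fix k1 k2 p q :: nat
    have "x * y \<le> x\<^sup>2 / 2 + y\<^sup>2 / 2" for x y :: real
      using sum_squares_bound[of x y] by simp
    then show "c (int k1) (int k2) * c (int k1 - 1 + int p) (int k2 - 1 + int q) \<le> (c (int k1) (int k2))\<^sup>2 / 2 + (c (int k1 - 1 + int p) (int k2 - 1 + int q))\<^sup>2 / 2" .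
  qed
  also have "\<dots> = (\<Sum>p<3. \<Sum>q<3. (\<Sum>k1<2 ^ n. \<Sum>k2<2 ^ n. (c (int k1) (int k2))\<^sup>2 / 2 + (c (int k1 - 1 + int p) (int k2 - 1 + int q))\<^sup>2 / 2))"
    unfolding sum.swap[of _ "{..<3}" "{..<2 ^ n}"] by (rule refl)
  also have "\<dots> = (\<Sum>p<3::nat. \<Sum>q<3::nat. (\<Sum>k1<2 ^ n. \<Sum>k2<2 ^ n. (c (int k1) (int k2))\<^sup>2))"
  proof (rule sum.cong[OF refl], rule sum.cong[OF refl])
    fix p q :: nat assume pq: "p \<in> {..<3}" "q \<in> {..<3}"
    have "(\<Sum>k1<2 ^ n. \<Sum>k2<2 ^ n. (c (int k1 - 1 + int p) (int k2 - 1 + int q))\<^sup>2)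
      = (\<Sum>k1<2 ^ n. \<Sum>k2<2 ^ n. (c (int k1 - 1 + int p) (int k2))\<^sup>2)"
      using pq per_c by (intro sum.cong refl sum_period_shift3[of "\<lambda>k. (c (int k1 - 1 + int p) k)\<^sup>2" "2 ^ n" q for k1]) auto
    also have "\<dots> = (\<Sum>k1<2 ^ n. \<Sum>k2<2 ^ n. (c (int k1) (int k2))\<^sup>2)"
      using pq per_c by (intro sum_period_shift3[of "\<lambda>k. \<Sum>k2<2 ^ n. (c k (int k2))\<^sup>2" "2 ^ n" p]) auto
    finally show "(\<Sum>k1<2 ^ n. \<Sum>k2<2 ^ n. (c (int k1) (int k2))\<^sup>2 / 2 + (c (int k1 - 1 + int p) (int k2 - 1 + int q))\<^sup>2 / 2)
      = (\<Sum>k1<2 ^ n. \<Sum>k2<2 ^ n. (c (int k1) (int k2))\<^sup>2)"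
      by (simp add: sum.distrib sum_divide_distrib[symmetric])
  qed
  also have "\<dots> = 9 * (\<Sum>k1<2 ^ n. \<Sum>k2<2 ^ n. (integral (dyadic_square n k1 k2) f)\<^sup>2)"
    by (simp add: dyadic_square_cell c_def l_def)
  finally show ?thesis .
qed

lemma corr_continuous:
  assumes "continuous_on UNIV f" "continuous_on UNIV g"
  shows "continuous_on UNIV (corr f g)"
  unfolding corr_def[abs_def] Q0_def
  by (intro integral_continuous_on_param)
    (auto simp: case_prod_beta intro!: continuous_intros cont_compose[OF assms(1)] cont_compose[OF assms(2)])

lemma corr_abs_le:
  assumes "continuous_on UNIV f" "continuous_on UNIV g"
  shows "\<bar>corr f g z\<bar> \<le> corr (\<lambda>x. \<bar>f x\<bar>) (\<lambda>x. \<bar>g x\<bar>) z"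
proof -
  have "norm (integral Q0 (\<lambda>x. f x * g (x + z))) \<le> integral Q0 (\<lambda>x. \<bar>f x\<bar> * \<bar>g (x + z)\<bar>)"
    unfolding Q0_def
    by (rule integral_norm_bound_integral)
      (auto simp: abs_mult intro!: cont_int continuous_intros assms(1) cont_compose[OF assms(2)])
  then show ?thesis by (simp add: corr_def)
qed

lemma corr_box_le:
  fixes f :: "pt \<Rightarrow> real"
  assumes f: "continuous_on UNIV f" and per: "periodic2 f" and s: "0 < s" "s \<le> 2 * pi / 2 ^ n"
  shows "s\<^sup>2 * integral unit_box (\<lambda>y. \<bar>corr f f (s *\<^sub>R y)\<bar>) \<le>
    9 * (\<Sum>k1<2 ^ n. \<Sum>k2<2 ^ n. (integral (dyadic_square n k1 k2) (\<lambda>x. \<bar>f x\<bar>))\<^sup>2)"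
proof -
  have fa: "continuous_on UNIV (\<lambda>x. \<bar>f x\<bar>)" by (intro continuous_intros f)
  have "integral unit_box (\<lambda>y. \<bar>corr f f (s *\<^sub>R y)\<bar>) \<le> integral unit_box (\<lambda>y. corr (\<lambda>x. \<bar>f x\<bar>) (\<lambda>x. \<bar>f x\<bar>) (s *\<^sub>R y))"
    unfolding unit_box_def
    by (intro integral_le corr_abs_le f cont_int continuous_intros cont_compose[OF corr_continuous[OF f f]]
        cont_compose[OF corr_continuous[OF fa fa]])
  then have "s\<^sup>2 * integral unit_box (\<lambda>y. \<bar>corr f f (s *\<^sub>R y)\<bar>) \<le> s\<^sup>2 * integral unit_box (\<lambda>y. corr (\<lambda>x. \<bar>f x\<bar>) (\<lambda>x. \<bar>f x\<bar>) (s *\<^sub>R y))"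
    by (intro mult_left_mono) auto
  also have "\<dots> \<le> 9 * (\<Sum>k1<2 ^ n. \<Sum>k2<2 ^ n. (integral (dyadic_square n k1 k2) (\<lambda>x. \<bar>f x\<bar>))\<^sup>2)"
    by (rule corr_abs_box_le[OF fa _ periodic2_compose[OF per] s]) auto
  finally show ?thesis .
qed

section \<open>A radial kernel\<close>

text \<open>\<open>bump ^ 3\<close> is a potential for \<open>kern\<close>: its gradient is -y times
  \<open>kern\<close>, which fixes the factor 6. The exponent 2 makes \<open>kern\<close> C^1, as
  required when derivatives are moved onto it in \<open>mollify_partials_le\<close>.\<close>

definition bump :: "pt \<Rightarrow> real" where "bump y = max 0 (1 - (fst y)\<^sup>2 - (snd y)\<^sup>2)"
definition kern :: "pt \<Rightarrow> real" where "kern y = 6 * (bump y) ^ 2"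

lemma bump_continuous: "continuous_on UNIV bump"
  unfolding bump_def[abs_def] by (intro continuous_intros)

lemma kern_continuous: "continuous_on UNIV kern"
  unfolding kern_def[abs_def] by (intro continuous_intros bump_continuous)

lemma bump_bounds: "0 \<le> bump y" "bump y \<le> 1"
  by (auto simp: bump_def)

lemma kern_nonneg: "kern y \<ge> 0" by (simp add: kern_def)

lemma bump_boundary: "bump (1, b) = 0" "bump (-1, b) = 0" "bump (a, 1) = 0" "bump (a, -1) = 0"
  by (auto simp: bump_def)

text \<open>Exponents from 2 on make the truncated power C^1 across 0, where the difference quotient
  is of order |h|^(n + 1).\<close>

lemma DERIV_max0_power:
  "((\<lambda>t::real. (max 0 t) ^ (n + 2)) has_real_derivative (real n + 2) * (max 0 t) ^ (n + 1)) (at t)"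
proof -
  consider "t > 0" | "t < 0" | "t = 0" by linarith
  then show ?thesis
  proof cases
    case 1
    have "((\<lambda>t::real. t ^ (n + 2)) has_real_derivative (real n + 2) * (max 0 t) ^ (n + 1)) (at t)"
      using 1 DERIV_pow[of "n + 2" t] by (simp add: add.commute)
    then show ?thesis
      by (rule has_field_derivative_transform_within_open[of _ _ _ "{0<..}"]) (use 1 in auto)
  next
    case 2
    have "((\<lambda>t::real. 0) has_real_derivative (real n + 2) * (max 0 t) ^ (n + 1)) (at t)"
      using 2 by auto
    then show ?thesis
      by (rule has_field_derivative_transform_within_open[of _ _ _ "{..<0}"]) (use 2 in auto)
  next
    case 3
    have "((\<lambda>h::real. ((max 0 (0 + h)) ^ (n + 2) - (max 0 0) ^ (n + 2)) / h) \<longlongrightarrow> 0) (at 0)"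
    proof (rule Lim_null_comparison)
      show "\<forall>\<^sub>F h::real in at 0. norm (((max 0 (0 + h)) ^ (n + 2) - (max 0 0) ^ (n + 2)) / h) \<le> \<bar>h\<bar> ^ (n + 1)"
      proof (intro always_eventually allI)
        fix h :: real
        show "norm (((max 0 (0 + h)) ^ (n + 2) - (max 0 0) ^ (n + 2)) / h) \<le> \<bar>h\<bar> ^ (n + 1)"
        proof (cases "h > 0")
          case False
          then show ?thesis by (simp add: max_absorb1 abs_mult del: power_Suc)
        qed (simp add: abs_mult)
      qed
      show "((\<lambda>h::real. \<bar>h\<bar> ^ (n + 1)) \<longlongrightarrow> 0) (at 0)"
        by (auto intro!: tendsto_eq_intros)
    qed
    then show ?thesis using 3 by (simp add: DERIV_def)
  qed
qed

lemma has_partials_bump_power: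
  "has_partials (\<lambda>y. (bump y) ^ (n + 2)) (\<lambda>y. - (2 * (real n + 2)) * fst y * (bump y) ^ (n + 1))
     (\<lambda>y. - (2 * (real n + 2)) * snd y * (bump y) ^ (n + 1))"
proof -
  have 1: "((\<lambda>s. (max 0 (1 - s\<^sup>2 - b\<^sup>2)) ^ (n + 2)) has_real_derivative
      (real n + 2) * (max 0 (1 - a\<^sup>2 - b\<^sup>2)) ^ (n + 1) * (- 2 * a)) (at a)" for a b :: real
    by (rule DERIV_chain2[OF DERIV_max0_power]) (auto intro!: derivative_eq_intros)
  have 2: "((\<lambda>s. (max 0 (1 - a\<^sup>2 - s\<^sup>2)) ^ (n + 2)) has_real_derivative
      (real n + 2) * (max 0 (1 - a\<^sup>2 - b\<^sup>2)) ^ (n + 1) * (- 2 * b)) (at b)" for a b :: real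
    by (rule DERIV_chain2[OF DERIV_max0_power]) (auto intro!: derivative_eq_intros)
  show ?thesis
    unfolding has_partials_def
  proof (intro conjI allI)
    fix a b :: real
    show "((\<lambda>s. (bump (s, b)) ^ (n + 2)) has_real_derivative - (2 * (real n + 2)) * fst (a, b) * (bump (a, b)) ^ (n + 1)) (at a)"
      by (rule DERIV_cong[OF 1[of b a, folded bump_def[of "(_, _)", simplified]]]) (simp add: bump_def algebra_simps)
    show "((\<lambda>s. (bump (a, s)) ^ (n + 2)) has_real_derivative - (2 * (real n + 2)) * snd (a, b) * (bump (a, b)) ^ (n + 1)) (at b)"
      by (rule DERIV_cong[OF 2[of a b, folded bump_def[of "(_, _)", simplified]]]) (simp add: bump_def algebra_simps)
  qed (intro continuous_intros bump_continuous)+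
qed

lemma has_partials_bump3: "has_partials (\<lambda>y. (bump y) ^ 3) (\<lambda>y. - fst y * kern y) (\<lambda>y. - snd y * kern y)"
  using has_partials_bump_power[of 1] by (simp add: kern_def numeral_3_eq_3 numeral_2_eq_2 mult_ac)

lemma has_partials_kern: "has_partials kern (\<lambda>y. - 24 * fst y * bump y) (\<lambda>y. - 24 * snd y * bump y)"
  using has_partials_cmult[OF has_partials_bump_power[of 0], of 6]
  by (simp add: kern_def[abs_def] numeral_2_eq_2 mult_ac)

definition kmass :: real where "kmass = integral unit_box kern"

definition kavg :: "(pt \<Rightarrow> real) \<Rightarrow> real \<Rightarrow> real" where
  "kavg F s = integral unit_box (\<lambda>y. kern y * F (s *\<^sub>R y))"

lemma kmass_pos: "kmass > 0"
proof -
  have "integral unit_box kern \<noteq> 0"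
  proof
    assume "integral unit_box kern = 0"
    then have "kern (0, 0) = 0"
      unfolding unit_box_def
      using integral_cbox_eq_0_iff[of "(-1, -1)" "(1, 1)" kern] continuous_on_subset[OF kern_continuous] kern_nonneg
      by (auto simp: box_ne_empty Basis_prod_def inner_Pair cbox_Pair_eq)
    then show False by (simp add: kern_def bump_def)
  qed
  moreover have "integral unit_box kern \<ge> 0"
    unfolding unit_box_def by (intro integral_nonneg cont_int kern_continuous kern_nonneg)
  ultimately show ?thesis by (simp add: kmass_def)
qed

text \<open>The scale derivative produces \<open>kern\<close> times y . grad of the correlation,
  that is minus the gradient of \<open>bump ^ 3\<close> against that gradient. Integration by parts
  leaves \<open>s\<close> times \<open>bump ^ 3\<close> against the Laplacian of the
  autocorrelation, which is minus the autocorrelation of the gradient.\<close>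

lemma kavg_corr_DERIV:
  assumes f: "has_partials f f1 f2" and per: "periodic2 f"
  shows "(kavg (corr f f) has_real_derivative
    - s * integral unit_box (\<lambda>y. bump y ^ 3 * (corr f1 f1 (s *\<^sub>R y) + corr f2 f2 (s *\<^sub>R y)))) (at s)"
proof -
  note c = has_partialsD(3-5)[OF f]
  have F: "has_partials (corr f f) (corr f f1) (corr f f2)" by (rule has_partials_corr[OF f c(1)])
  note cc = has_partialsD(3-5)[OF F]
  have c11: "continuous_on UNIV (corr f1 f1)" "continuous_on UNIV (corr f2 f2)"
    by (intro corr_continuous c)+
  have d: "(kavg (corr f f) has_real_derivative
     integral unit_box (\<lambda>y. kern y * (fst y * corr f f1 (s *\<^sub>R y) + snd y * corr f f2 (s *\<^sub>R y)))) (at s within UNIV)"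
    unfolding kavg_def unit_box_def
  proof (rule leibniz_rule_field_derivative)
    show "((\<lambda>s. kern y * corr f f (s *\<^sub>R y)) has_real_derivative
      kern y * (fst y * corr f f1 (s *\<^sub>R y) + snd y * corr f f2 (s *\<^sub>R y))) (at s within UNIV)" for s y
      by (intro DERIV_cmult has_partials_ray F)
  qed (auto simp: case_prod_beta intro!: cont_int continuous_intros cont_compose[OF cc(1)] cont_compose[OF cc(2)]
      cont_compose[OF cc(3)] cont_compose[OF kern_continuous])
  \<comment> \<open>\<open>corr f f1 = - corr f1 f\<close> moves the derivative already taken to the
    first factor and frees the second to be differentiated again; \<open>f\<close> itself is only
    C^1.\<close>
  have F1: "has_partials (corr f f1) (\<lambda>z. - 1 * corr f1 f1 z) (\<lambda>z. - 1 * corr f1 f2 z)"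
    using has_partials_cmult[OF has_partials_corr[OF f c(2)], of "-1"] corr_by_parts(1)[OF f f per per]
    by (simp add: has_partials_def)
  have F2: "has_partials (corr f f2) (\<lambda>z. - 1 * corr f2 f1 z) (\<lambda>z. - 1 * corr f2 f2 z)"
    using has_partials_cmult[OF has_partials_corr[OF f c(3)], of "-1"] corr_by_parts(2)[OF f f per per]
    by (simp add: has_partials_def)
  have h1: "has_partials (\<lambda>y. bump y ^ 3 * corr f f1 (s *\<^sub>R y))
     (\<lambda>y. - fst y * kern y * corr f f1 (s *\<^sub>R y) + bump y ^ 3 * (s * (- 1 * corr f1 f1 (s *\<^sub>R y))))
     (\<lambda>y. - snd y * kern y * corr f f1 (s *\<^sub>R y) + bump y ^ 3 * (s * (- 1 * corr f1 f2 (s *\<^sub>R y))))"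
    using has_partials_mult[OF has_partials_bump3 has_partials_affine[OF F1, of 0 s]] by simp
  have h2: "has_partials (\<lambda>y. bump y ^ 3 * corr f f2 (s *\<^sub>R y))
     (\<lambda>y. - fst y * kern y * corr f f2 (s *\<^sub>R y) + bump y ^ 3 * (s * (- 1 * corr f2 f1 (s *\<^sub>R y))))
     (\<lambda>y. - snd y * kern y * corr f f2 (s *\<^sub>R y) + bump y ^ 3 * (s * (- 1 * corr f2 f2 (s *\<^sub>R y))))"
    using has_partials_mult[OF has_partials_bump3 has_partials_affine[OF F2, of 0 s]] by simp
  \<comment> \<open>No boundary terms, since \<open>bump\<close> vanishes on the boundary of
    \<open>unit_box\<close>.\<close>
  have z1: "integral unit_box (\<lambda>y. - fst y * kern y * corr f f1 (s *\<^sub>R y) + bump y ^ 3 * (s * (- 1 * corr f1 f1 (s *\<^sub>R y)))) = 0"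
    unfolding unit_box_def by (rule integral_partial_zero(1)[OF h1]) (auto simp: bump_boundary)
  have z2: "integral unit_box (\<lambda>y. - snd y * kern y * corr f f2 (s *\<^sub>R y) + bump y ^ 3 * (s * (- 1 * corr f2 f2 (s *\<^sub>R y)))) = 0"
    unfolding unit_box_def by (rule integral_partial_zero(2)[OF h2]) (auto simp: bump_boundary)
  note ci = continuous_intros cont_compose[OF cc(1)] cont_compose[OF cc(2)]
      cont_compose[OF cc(3)] kern_continuous bump_continuous cont_compose[OF c11(1)] cont_compose[OF c11(2)]
  have "integral unit_box (\<lambda>y. kern y * (fst y * corr f f1 (s *\<^sub>R y) + snd y * corr f f2 (s *\<^sub>R y)))
     = integral unit_box (\<lambda>y. (- s * (bump y ^ 3 * (corr f1 f1 (s *\<^sub>R y) + corr f2 f2 (s *\<^sub>R y))))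
      - (- fst y * kern y * corr f f1 (s *\<^sub>R y) + bump y ^ 3 * (s * (- 1 * corr f1 f1 (s *\<^sub>R y))))
      - (- snd y * kern y * corr f f2 (s *\<^sub>R y) + bump y ^ 3 * (s * (- 1 * corr f2 f2 (s *\<^sub>R y)))))"
    by (intro arg_cong[where f="integral unit_box"]) (auto simp: algebra_simps)
  also have "\<dots> = integral unit_box (\<lambda>y. - s * (bump y ^ 3 * (corr f1 f1 (s *\<^sub>R y) + corr f2 f2 (s *\<^sub>R y))))
     - integral unit_box (\<lambda>y. - fst y * kern y * corr f f1 (s *\<^sub>R y) + bump y ^ 3 * (s * (- 1 * corr f1 f1 (s *\<^sub>R y))))
     - integral unit_box (\<lambda>y. - snd y * kern y * corr f f2 (s *\<^sub>R y) + bump y ^ 3 * (s * (- 1 * corr f2 f2 (s *\<^sub>R y))))"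
    unfolding unit_box_def
    by (subst Henstock_Kurzweil_Integration.integral_diff, (intro cont_int ci)+)+ simp
  finally show ?thesis using d z1 z2 by simp
qed

lemma corr_exchange:
  assumes "has_partials f f1 f2" "has_partials g g1 g2" "periodic2 f" "periodic2 g"
  shows "corr f1 g2 z = corr f2 g1 z"
  using integral_partials_exchange[OF assms(1) has_partials_shift[OF assms(2), of z] assms(3) periodic2_shift[OF assms(4)]]
  by (simp add: corr_def)

lemma corr_diff:
  assumes "continuous_on UNIV f" "continuous_on UNIV g" "continuous_on UNIV h"
  shows "corr (\<lambda>x. f x - g x) h z = corr f h z - corr g h z" "corr h (\<lambda>x. f x - g x) z = corr h f z - corr h g z"
  unfolding corr_def Q0_def left_diff_distrib right_diff_distrib
  by (intro integral_diff cont_int continuous_intros assms cont_compose[OF assms(1)]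
      cont_compose[OF assms(2)] cont_compose[OF assms(3)])+

text \<open>Shifted version of the equality of the L^2 norms of gradient and curl for a
  divergence-free field: the cross terms \<open>corr a21 a12\<close> and \<open>corr a12 a21\<close>
  become correlations of \<open>a11\<close> with \<open>a22\<close> by \<open>corr_exchange\<close>,
  and a22 = -a11.\<close>

lemma vorticity_corr:
  assumes u1: "has_partials u1 a11 a12" and u2: "has_partials u2 a21 a22"
    and per: "periodic2 u1" "periodic2 u2" and div: "\<And>x. a11 x + a22 x = 0"
  shows "corr a11 a11 z + corr a12 a12 z + (corr a21 a21 z + corr a22 a22 z)
    = corr (\<lambda>x. a21 x - a12 x) (\<lambda>x. a21 x - a12 x) z"
proof -
  note c = has_partialsD(4,5)[OF u1] has_partialsD(4,5)[OF u2]
  have a22: "a22 = (\<lambda>x. - a11 x)" using div by (auto simp: eq_neg_iff_add_eq_0 add.commute)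
  have neg: "corr a22 a11 z = - corr a11 a11 z" "corr a11 a22 z = - corr a11 a11 z" "corr a22 a22 z = corr a11 a11 z"
    unfolding a22 by (simp_all add: corr_def)
  have "corr (\<lambda>x. a21 x - a12 x) (\<lambda>x. a21 x - a12 x) z
    = corr a21 a21 z - corr a21 a12 z - (corr a12 a21 z - corr a12 a12 z)"
    using c by (simp add: corr_diff continuous_on_diff)
  then show ?thesis
    using corr_exchange[OF u2 u1 per(2,1), of z] corr_exchange[OF u1 u2 per(1,2), of z] neg by linarith
qed

lemma kavg_0: "kavg F 0 = kmass * F 0"
  by (simp add: kavg_def kmass_def)

text \<open>The terms of the sparse seminorm, summed over all squares of one level. No power of the
  side length appears: in two dimensions a squared circulation has the scaling of kinetic
  energy.\<close>

definition dyadic_energy :: "(pt \<Rightarrow> real) \<Rightarrow> nat \<Rightarrow> real" where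
  "dyadic_energy f n = (\<Sum>k1<2 ^ n. \<Sum>k2<2 ^ n. (integral (dyadic_square n k1 k2) (\<lambda>x. \<bar>f x\<bar>))\<^sup>2)"

text \<open>The scale derivative of the averaged autocorrelation of the velocity is an integral of the
  autocorrelation of the vorticity; since the kernel is radial no Green function is needed.\<close>
lemma energy_minus_kavg_le:
  assumes u1: "has_partials u1 a11 a12" and u2: "has_partials u2 a21 a22"
    and per: "periodic2 u1" "periodic2 u2" and div: "\<And>x. a11 x + a22 x = 0"
    and b: "\<And>L. (\<Sum>i\<le>L. dyadic_energy (\<lambda>x. a21 x - a12 x) (N + i)) \<le> b"
  shows "kmass * (corr u1 u1 0 + corr u2 u2 0) - (kavg (corr u1 u1) (2 * pi / 2 ^ N) + kavg (corr u2 u2) (2 * pi / 2 ^ N)) \<le> 9 * b"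
proof -
  let ?w = "\<lambda>x. a21 x - a12 x"
  define m where "m = (\<lambda>s. kavg (corr u1 u1) s + kavg (corr u2 u2) s)"
  define r where "r = (\<lambda>n::nat. 2 * pi / 2 ^ n)"
  note c = has_partialsD(4,5)[OF u1] has_partialsD(4,5)[OF u2]
  have wc: "continuous_on UNIV ?w" and wp: "periodic2 ?w"
    by (intro continuous_intros c periodic2_diff periodic2_partials[OF u1] periodic2_partials[OF u2] per)+
  have cw: "continuous_on UNIV (\<lambda>y. corr ?w ?w (s *\<^sub>R y))" for s
    by (intro cont_compose[OF corr_continuous[OF wc wc]] continuous_intros)
  have dm: "(m has_real_derivative - s * integral unit_box (\<lambda>y. bump y ^ 3 * corr ?w ?w (s *\<^sub>R y))) (at s)" for s
  proof -
    have ii: "(\<lambda>y. bump y ^ 3 * (corr f f (s *\<^sub>R y) + corr g g (s *\<^sub>R y))) integrable_on unit_box"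
      if "continuous_on UNIV f" "continuous_on UNIV g" for f g
      unfolding unit_box_def using that
      by (intro cont_int continuous_intros bump_continuous cont_compose[OF corr_continuous])
    have "integral unit_box (\<lambda>y. bump y ^ 3 * corr ?w ?w (s *\<^sub>R y)) =
      integral unit_box (\<lambda>y. bump y ^ 3 * (corr a11 a11 (s *\<^sub>R y) + corr a12 a12 (s *\<^sub>R y)) + bump y ^ 3 * (corr a21 a21 (s *\<^sub>R y) + corr a22 a22 (s *\<^sub>R y)))"
      by (simp only: vorticity_corr[OF u1 u2 per div, symmetric] distrib_left)
    also have "\<dots> = integral unit_box (\<lambda>y. bump y ^ 3 * (corr a11 a11 (s *\<^sub>R y) + corr a12 a12 (s *\<^sub>R y)))
       + integral unit_box (\<lambda>y. bump y ^ 3 * (corr a21 a21 (s *\<^sub>R y) + corr a22 a22 (s *\<^sub>R y)))"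
      by (intro Henstock_Kurzweil_Integration.integral_add ii c)
    finally show ?thesis
      unfolding m_def using DERIV_add[OF kavg_corr_DERIV[OF u1 per(1), of s] kavg_corr_DERIV[OF u2 per(2), of s]]
      by (simp add: algebra_simps)
  qed
  have step: "m (r (Suc n)) - m (r n) \<le> 9 * dyadic_energy ?w n" for n
  proof -
    have r0: "r (Suc n) > 0" "r (Suc n) < r n" "r n = 2 * r (Suc n)" by (auto simp: r_def field_simps)
    obtain s where s: "r (Suc n) < s" "s < r n"
      and ms: "m (r n) - m (r (Suc n)) = (r n - r (Suc n)) * (- s * integral unit_box (\<lambda>y. bump y ^ 3 * corr ?w ?w (s *\<^sub>R y)))"
      using MVT2[OF r0(2) dm] by blast
    define X where "X = integral unit_box (\<lambda>y. \<bar>corr ?w ?w (s *\<^sub>R y)\<bar>)"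
    have X: "s\<^sup>2 * X \<le> 9 * dyadic_energy ?w n"
      unfolding X_def dyadic_energy_def by (rule corr_box_le[OF wc wp]) (use s r0 in \<open>auto simp: r_def\<close>)
    have X0: "X \<ge> 0" unfolding X_def unit_box_def by (intro integral_nonneg cont_int continuous_intros cw) auto
    have "integral unit_box (\<lambda>y. bump y ^ 3 * corr ?w ?w (s *\<^sub>R y)) \<le> X"
      unfolding X_def unit_box_def
    proof (intro integral_le cont_int continuous_intros cw bump_continuous)
      fix y
      have "bump y ^ 3 * corr ?w ?w (s *\<^sub>R y) \<le> bump y ^ 3 * \<bar>corr ?w ?w (s *\<^sub>R y)\<bar>"
        by (intro mult_left_mono) (auto simp: bump_bounds)
      also have "\<dots> \<le> 1 * \<bar>corr ?w ?w (s *\<^sub>R y)\<bar>"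
        by (intro mult_right_mono) (auto simp: bump_bounds power_le_one)
      finally show "bump y ^ 3 * corr ?w ?w (s *\<^sub>R y) \<le> \<bar>corr ?w ?w (s *\<^sub>R y)\<bar>" by simp
    qed
    then have "(r n - r (Suc n)) * (s * integral unit_box (\<lambda>y. bump y ^ 3 * corr ?w ?w (s *\<^sub>R y))) \<le> (r n - r (Suc n)) * (s * X)"
      using r0 s by (intro mult_left_mono) auto
    \<comment> \<open>Because scales are halved, the length of the interval equals its left end and
      is at most \<open>s\<close>. This yields the factor s^2 that \<open>corr_box_le\<close>
      absorbs at level \<open>n\<close>.\<close>
    also have "\<dots> \<le> s * (s * X)"
      using r0 s X0 by (intro mult_right_mono) auto
    finally show ?thesis using X ms by (simp add: power2_eq_square algebra_simps)
  qed
  have "m (r (N + Suc L)) - m (r N) \<le> 9 * (\<Sum>i\<le>L. dyadic_energy ?w (N + i))" for L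
  proof (induction L)
    case (Suc L)
    then show ?case using step[of "N + Suc L"] by simp
  qed (use step[of N] in simp)
  then have le: "m (r (N + Suc L)) - m (r N) \<le> 9 * b" for L
    using b[of L] by (smt (verit))
  \<comment> \<open>After telescoping over the levels, continuity of \<open>m\<close> at scale 0
    brings in the energy itself: \<open>m 0\<close> is \<open>kmass\<close> times the
    energy.\<close>
  have "(\<lambda>L. m (r (N + Suc L)) - m (r N)) \<longlonglongrightarrow> m 0 - m (r N)"
  proof (intro tendsto_intros isCont_tendsto_compose[of 0 m])
    show "isCont m 0" using dm[of 0] DERIV_isCont by blast
    have "(\<lambda>L. 2 * pi * (1 / 2) ^ (L + (N + 1))) \<longlonglongrightarrow> 2 * pi * 0"
      by (intro tendsto_mult tendsto_const LIMSEQ_ignore_initial_segment LIMSEQ_power_zero) auto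
    then show "(\<lambda>L. r (N + Suc L)) \<longlonglongrightarrow> 0"
      by (simp add: r_def power_divide add.commute field_simps)
  qed
  then have "m 0 - m (r N) \<le> 9 * b"
    by (rule LIMSEQ_le_const2) (use le in auto)
  then show ?thesis by (simp add: m_def r_def kavg_0 distrib_left)
qed

section \<open>Autocorrelation near the origin and a localized Nash inequality\<close>

lemma corr_00: "corr f g 0 = integral Q0 (\<lambda>x. f x * g x)"
  by (simp add: corr_def)

lemma corr_le_half:
  assumes f: "continuous_on UNIV f" "periodic2 f" and g: "continuous_on UNIV g" "periodic2 g"
  shows "\<bar>corr f g z\<bar> \<le> (corr f f 0 + corr g g 0) / 2"
proof -
  have *: "corr f k z \<le> (corr f f 0 + corr k k 0) / 2" if "continuous_on UNIV k" "periodic2 k" for k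
  proof -
    have ks: "continuous_on UNIV (\<lambda>x. k (x + z))" by (intro cont_compose[OF that(1)] continuous_intros)
    have "corr f k z \<le> integral Q0 (\<lambda>x. f x * f x / 2 + k (x + z) * k (x + z) / 2)"
      unfolding corr_def Q0_def
    proof (intro integral_le cont_int continuous_intros f ks)
      fix x show "f x * k (x + z) \<le> f x * f x / 2 + k (x + z) * k (x + z) / 2"
        using sum_squares_bound[of "f x" "k (x + z)"] by (simp add: power2_eq_square)
    qed auto
    also have "\<dots> = integral Q0 (\<lambda>x. f x * f x / 2) + integral Q0 (\<lambda>x. k (x + z) * k (x + z) / 2)"
      unfolding Q0_def by (intro Henstock_Kurzweil_Integration.integral_add cont_int continuous_intros f ks) auto
    also have "integral Q0 (\<lambda>x. k (x + z) * k (x + z) / 2) = integral Q0 (\<lambda>x. k x * k x / 2)"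
      by (rule integral_translate[of "\<lambda>x. k x * k x / 2"])
        (use that in \<open>auto intro!: continuous_intros simp: periodic2_def\<close>)
    finally show ?thesis by (simp add: corr_00)
  qed
  have "corr f (\<lambda>x. - g x) z = - corr f g z" "corr (\<lambda>x. - g x) (\<lambda>x. - g x) 0 = corr g g 0"
    by (simp_all add: corr_def)
  then show ?thesis
    using *[OF g] *[of "\<lambda>x. - g x"] g by (auto simp: periodic2_def continuous_on_minus)
qed

text \<open>Second-order Taylor estimate at the maximum. Up to sign, \<open>h\<close> is the
  derivative along the ray; it vanishes at 0 because the integral of w times a partial of w is zero.
  Its own derivative is a combination of gradient correlations, bounded by twice the palinstrophy
  through \<open>corr_le_half\<close>.\<close>

lemma corr_ray_diff_le:
  assumes w: "has_partials w w1 w2" and per: "periodic2 w" and y: "y \<in> unit_box" and r: "r > 0"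
  shows "corr w w 0 - corr w w (r *\<^sub>R y) \<le> 2 * r\<^sup>2 * (corr w1 w1 0 + corr w2 w2 0)"
proof -
  note c = has_partialsD(3-5)[OF w]
  note p = periodic2_partials[OF w per]
  define Z where "Z = corr w1 w1 0 + corr w2 w2 0"
  have y': "\<bar>fst y\<bar> \<le> 1" "\<bar>snd y\<bar> \<le> 1" using y by (auto simp: mem_unit_box)
  define h where "h = (\<lambda>s. fst y * corr w1 w (s *\<^sub>R y) + snd y * corr w2 w (s *\<^sub>R y))"
  have Z0: "corr w1 w1 0 \<ge> 0" "corr w2 w2 0 \<ge> 0"
    unfolding corr_00 Q0_def by (intro integral_nonneg cont_int continuous_intros c; simp)+
  have d1: "((\<lambda>s. corr w w (s *\<^sub>R y)) has_real_derivative - h s) (at s)" for s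
    using has_partials_ray[OF has_partials_corr[OF w c(1)], of y s] corr_by_parts[OF w w per per]
    by (simp add: h_def)
  have d2: "(h has_real_derivative
     fst y * (fst y * corr w1 w1 (s *\<^sub>R y) + snd y * corr w1 w2 (s *\<^sub>R y))
     + snd y * (fst y * corr w2 w1 (s *\<^sub>R y) + snd y * corr w2 w2 (s *\<^sub>R y))) (at s)" for s
    unfolding h_def
    by (intro DERIV_add DERIV_cmult has_partials_ray has_partials_corr[OF w] c)
  have "corr w1 w 0 = - corr w1 w 0" "corr w2 w 0 = - corr w2 w 0"
    using corr_by_parts[OF w w per per, of 0] by (simp_all add: corr_00 mult.commute)
  then have h0: "h 0 = 0" by (simp add: h_def)
  have small: "\<bar>a * (b * e)\<bar> \<le> q" if "\<bar>a\<bar> \<le> 1" "\<bar>b\<bar> \<le> 1" "\<bar>e\<bar> \<le> q" for a b e q :: real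
  proof -
    have "\<bar>a * (b * e)\<bar> \<le> 1 * (1 * q)"
      unfolding abs_mult using that by (intro mult_mono) auto
    then show ?thesis by simp
  qed
  have hb: "h s \<le> s * (2 * Z)" if s0: "s > 0" for s
  proof -
    obtain t where "h s - h 0 = (s - 0) * (fst y * (fst y * corr w1 w1 (t *\<^sub>R y) + snd y * corr w1 w2 (t *\<^sub>R y))
     + snd y * (fst y * corr w2 w1 (t *\<^sub>R y) + snd y * corr w2 w2 (t *\<^sub>R y)))"
      using MVT2[OF s0 d2] by blast
    moreover have "fst y * (fst y * corr w1 w1 (t *\<^sub>R y) + snd y * corr w1 w2 (t *\<^sub>R y))
     + snd y * (fst y * corr w2 w1 (t *\<^sub>R y) + snd y * corr w2 w2 (t *\<^sub>R y)) \<le> 2 * Z"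
    proof -
      have aux: "A + B + (C + D) \<le> 2 * p + 2 * q"
        if "\<bar>A\<bar> \<le> (p + p) / 2" "\<bar>B\<bar> \<le> (p + q) / 2" "\<bar>C\<bar> \<le> (q + p) / 2" "\<bar>D\<bar> \<le> (q + q) / 2"
        for A B C D p q :: real
      proof -
        have "A \<le> (p + p) / 2" "B \<le> (p + q) / 2" "C \<le> (q + p) / 2" "D \<le> (q + q) / 2"
          using that by (auto dest: abs_le_D1)
        then show ?thesis by (simp add: field_simps)
      qed
      show ?thesis
        unfolding distrib_left Z_def
        by (rule aux[OF small[OF y'(1) y'(1) corr_le_half[OF c(2) p(1) c(2) p(1)]]
          small[OF y'(1) y'(2) corr_le_half[OF c(2) p(1) c(3) p(2)]]
          small[OF y'(2) y'(1) corr_le_half[OF c(3) p(2) c(2) p(1)]]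
          small[OF y'(2) y'(2) corr_le_half[OF c(3) p(2) c(3) p(2)]]])
    qed
    ultimately show ?thesis using s0 h0 by (simp add: mult_left_mono)
  qed
  obtain s where s: "0 < s" "s < r" "corr w w (r *\<^sub>R y) - corr w w (0 *\<^sub>R y) = (r - 0) * (- h s)"
    using MVT2[of 0 r "\<lambda>s. corr w w (s *\<^sub>R y)", OF r d1] by blast
  have "h s \<le> r * (2 * Z)"
    using hb[OF s(1)] s Z0 mult_right_mono[of s r "2 * Z"] by (simp add: Z_def)
  then have "r * h s \<le> r * (r * (2 * Z))" using r by (intro mult_left_mono) auto
  moreover have "corr w w 0 - corr w w (r *\<^sub>R y) = r * h s" using s(3) by simp
  moreover have "r * (r * (2 * Z)) = 2 * r\<^sup>2 * Z" by (simp add: power2_eq_square)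
  ultimately show ?thesis unfolding Z_def by simp
qed

text \<open>Averaging \<open>corr_ray_diff_le\<close> over \<open>unit_box\<close>, of area 4,
  compares the value at 0 with a mean of the autocorrelation, which \<open>corr_box_le\<close>
  bounds by nine dyadic energies over r^2. This is Nash's inequality with the L^1 norm localized to
  squares of side \<open>r\<close>.\<close>

lemma enstrophy_interpolation:
  assumes w: "has_partials w w1 w2" and per: "periodic2 w" and r: "r = 2 * pi / 2 ^ N"
  shows "corr w w 0 \<le> 2 * r\<^sup>2 * (corr w1 w1 0 + corr w2 w2 0) + 9 / 4 * dyadic_energy w N / r\<^sup>2"
proof -
  note c = has_partialsD(3-5)[OF w]
  have r0: "r > 0" using r by simp
  define Z where "Z = 2 * r\<^sup>2 * (corr w1 w1 0 + corr w2 w2 0)"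
  have cw: "continuous_on UNIV (\<lambda>y. \<bar>corr w w (r *\<^sub>R y)\<bar>)"
    by (intro cont_compose[OF corr_continuous[OF c(1) c(1)]] continuous_intros)
  have area: "integral unit_box (\<lambda>y. k) = 4 * k" for k :: real
    by (simp add: unit_box_def content_Pair)
  have "4 * corr w w 0 = integral unit_box (\<lambda>y. corr w w 0)" by (simp add: area)
  also have "\<dots> \<le> integral unit_box (\<lambda>y. Z + \<bar>corr w w (r *\<^sub>R y)\<bar>)"
  proof (rule integral_le)
    fix y assume "y \<in> unit_box"
    from corr_ray_diff_le[OF w per this r0]
    show "corr w w 0 \<le> Z + \<bar>corr w w (r *\<^sub>R y)\<bar>" unfolding Z_def by linarith
  qed (auto simp: unit_box_def intro!: cont_int continuous_intros cw)
  also have "\<dots> = 4 * Z + integral unit_box (\<lambda>y. \<bar>corr w w (r *\<^sub>R y)\<bar>)"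
    using cont_int[OF cw] area[of Z] unfolding unit_box_def
    by (subst Henstock_Kurzweil_Integration.integral_add) auto
  finally have 1: "4 * corr w w 0 \<le> 4 * Z + integral unit_box (\<lambda>y. \<bar>corr w w (r *\<^sub>R y)\<bar>)" .
  have "r\<^sup>2 * integral unit_box (\<lambda>y. \<bar>corr w w (r *\<^sub>R y)\<bar>) \<le> 9 * dyadic_energy w N"
    unfolding dyadic_energy_def by (rule corr_box_le[OF c(1) per]) (use r0 r in auto)
  then have "integral unit_box (\<lambda>y. \<bar>corr w w (r *\<^sub>R y)\<bar>) \<le> 9 * dyadic_energy w N / r\<^sup>2"
    using r0 by (simp add: field_simps)
  with 1 show ?thesis unfolding Z_def by simp
qed

section \<open>Mollification\<close>

definition mollify :: "real \<Rightarrow> (pt \<Rightarrow> real) \<Rightarrow> pt \<Rightarrow> real" where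
  "mollify r f x = integral unit_box (\<lambda>y. kern y * f (x + r *\<^sub>R y)) / kmass"

lemma has_partials_mollify:
  assumes "has_partials f f1 f2"
  shows "has_partials (mollify r f) (mollify r f1) (mollify r f2)"
  using has_partials_cmult[OF has_partials_weighted_integral[OF assms kern_continuous, of "(-1, -1)" "(1, 1)" r], of "1 / kmass"]
  by (simp add: mollify_def[abs_def] unit_box_def)

lemma periodic2_mollify: "periodic2 f \<Longrightarrow> periodic2 (mollify r f)"
proof -
  assume p: "periodic2 f"
  have "f (x + z + v) = f (x + v)" if "\<forall>x. f (x + z) = f x" for x z v
    using that[rule_format, of "x + v"] by (simp add: add_ac del: add_Pair)
  then show ?thesis using p unfolding periodic2_def mollify_def by (simp del: add_Pair split_paired_All)
qed

lemma mollify_continuous: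
  assumes "continuous_on UNIV f" shows "continuous_on UNIV (mollify r f)"
  unfolding mollify_def[abs_def] unit_box_def using kmass_pos
  by (intro continuous_intros integral_continuous_on_param)
    (auto simp: case_prod_beta intro!: continuous_intros cont_compose[OF kern_continuous] cont_compose[OF assms])

text \<open>By Fubini, testing against a mollification is an averaged correlation. For
  \<open>g = f\<close> its deficit from the energy is what \<open>variation\<close>
  measures.\<close>

lemma integral_mult_mollify:
  assumes f: "continuous_on UNIV f" and g: "continuous_on UNIV g"
  shows "kmass * integral Q0 (\<lambda>x. g x * mollify r f x) = kavg (corr g f) r"
proof -
  have "kavg (corr g f) r = integral unit_box (\<lambda>y. integral Q0 (\<lambda>x. kern y * (g x * f (x + r *\<^sub>R y))))"
    by (simp add: kavg_def corr_def)
  also have "\<dots> = integral Q0 (\<lambda>x. integral unit_box (\<lambda>y. kern y * (g x * f (x + r *\<^sub>R y))))"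
    unfolding unit_box_def Q0_def
    by (rule integral_swap_continuous)
      (auto simp: case_prod_beta intro!: continuous_intros cont_compose[OF kern_continuous] cont_compose[OF f] cont_compose[OF g])
  also have "\<dots> = integral Q0 (\<lambda>x. kmass * (g x * mollify r f x))"
    using kmass_pos by (intro arg_cong[where f="integral Q0"] ext) (simp add: mollify_def mult.left_commute[of "kern _"])
  finally show ?thesis by simp
qed

text \<open>By \<open>variation_eq\<close> this is the kernel average of squared L^2 translation
  differences at scale \<open>r\<close>. The correlation form is the one that
  \<open>energy_minus_kavg_le\<close> estimates.\<close>

definition variation :: "(pt \<Rightarrow> real) \<Rightarrow> real \<Rightarrow> real" where
  "variation f r = 2 * (kmass * corr f f 0 - kavg (corr f f) r)"

lemma variation_eq:
  assumes f: "continuous_on UNIV f" and per: "periodic2 f"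
  shows "variation f r = integral unit_box (\<lambda>y. kern y * integral Q0 (\<lambda>x. (f (x + r *\<^sub>R y) - f x)\<^sup>2))"
proof -
  have *: "integral Q0 (\<lambda>x. (f (x + z) - f x)\<^sup>2) = 2 * (corr f f 0 - corr f f z)" for z
  proof -
    have fz: "continuous_on UNIV (\<lambda>x. f (x + z))" by (intro cont_compose[OF f] continuous_intros)
    have "integral Q0 (\<lambda>x. (f (x + z) - f x)\<^sup>2) = integral Q0 (\<lambda>x. f (x + z) * f (x + z) + f x * f x - 2 * (f x * f (x + z)))"
      by (simp add: power2_eq_square algebra_simps)
    also have "\<dots> = integral Q0 (\<lambda>x. f (x + z) * f (x + z)) + integral Q0 (\<lambda>x. f x * f x) - 2 * corr f f z"
      unfolding Q0_def corr_def
      by (subst Henstock_Kurzweil_Integration.integral_diff Henstock_Kurzweil_Integration.integral_add,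
          (intro cont_int continuous_intros f fz)+)+ simp
    also have "integral Q0 (\<lambda>x. f (x + z) * f (x + z)) = corr f f 0"
      unfolding corr_00 by (rule integral_translate[of "\<lambda>x. f x * f x"]) (use f per in \<open>auto intro!: continuous_intros periodic2_mult\<close>)
    finally show ?thesis by (simp add: corr_00)
  qed
  have cc: "continuous_on UNIV (\<lambda>y. corr f f (r *\<^sub>R y))"
    by (intro cont_compose[OF corr_continuous[OF f f]] continuous_intros)
  have "integral unit_box (\<lambda>y. kern y * integral Q0 (\<lambda>x. (f (x + r *\<^sub>R y) - f x)\<^sup>2))
    = integral unit_box (\<lambda>y. 2 * corr f f 0 * kern y - 2 * (kern y * corr f f (r *\<^sub>R y)))"
    unfolding * by (simp add: algebra_simps)
  also have "\<dots> = 2 * corr f f 0 * kmass - 2 * kavg (corr f f) r"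
    unfolding kmass_def kavg_def unit_box_def
    by (subst Henstock_Kurzweil_Integration.integral_diff, (intro cont_int continuous_intros kern_continuous cc)+) simp
  finally show ?thesis by (simp add: variation_def)
qed

lemma translate_diff_continuous:
  fixes f :: "pt \<Rightarrow> real"
  assumes "continuous_on UNIV f"
  shows "continuous_on UNIV (\<lambda>y. integral Q0 (\<lambda>x. (f (x + r *\<^sub>R y) - f x)\<^sup>2))"
  unfolding Q0_def
  by (intro integral_continuous_on_param)
    (auto simp: case_prod_beta intro!: continuous_intros cont_compose[OF assms])

lemma variation_diff_le:
  assumes f: "continuous_on UNIV f" "periodic2 f" and g: "continuous_on UNIV g" "periodic2 g"
  shows "variation (\<lambda>x. f x - g x) r \<le> 2 * variation f r + 2 * variation g r"
proof -
  have fg: "continuous_on UNIV (\<lambda>x. f x - g x)" by (intro continuous_intros f g)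
  let ?V = "\<lambda>h y. integral Q0 (\<lambda>x. (h (x + r *\<^sub>R y) - h x)\<^sup>2)"
  have V: "?V (\<lambda>x. f x - g x) y \<le> 2 * ?V f y + 2 * ?V g y" for y
  proof -
    have s: "continuous_on UNIV (\<lambda>x. h (x + r *\<^sub>R y))" if "continuous_on UNIV h" for h :: "pt \<Rightarrow> real"
      by (intro cont_compose[OF that] continuous_intros)
    have "?V (\<lambda>x. f x - g x) y \<le> integral Q0 (\<lambda>x. 2 * (f (x + r *\<^sub>R y) - f x)\<^sup>2 + 2 * (g (x + r *\<^sub>R y) - g x)\<^sup>2)"
      unfolding Q0_def
    proof (intro integral_le cont_int continuous_intros f g s)
      fix x
      have "(a - b)\<^sup>2 \<le> 2 * a\<^sup>2 + 2 * b\<^sup>2" for a b :: real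
        using zero_le_power2[of "a + b"] by (simp add: power2_eq_square algebra_simps)
      from this[of "f (x + r *\<^sub>R y) - f x" "g (x + r *\<^sub>R y) - g x"]
      show "(f (x + r *\<^sub>R y) - g (x + r *\<^sub>R y) - (f x - g x))\<^sup>2 \<le> 2 * (f (x + r *\<^sub>R y) - f x)\<^sup>2 + 2 * (g (x + r *\<^sub>R y) - g x)\<^sup>2"
        by (simp add: algebra_simps)
    qed
    also have "\<dots> = 2 * ?V f y + 2 * ?V g y"
      unfolding Q0_def
      by (subst Henstock_Kurzweil_Integration.integral_add, (intro cont_int continuous_intros f g s)+) simp
    finally show ?thesis .
  qed
  have "integral unit_box (\<lambda>y. kern y * ?V (\<lambda>x. f x - g x) y) \<le> integral unit_box (\<lambda>y. 2 * (kern y * ?V f y) + 2 * (kern y * ?V g y))"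
    unfolding unit_box_def
  proof (intro integral_le cont_int continuous_intros kern_continuous translate_diff_continuous f g fg)
    fix y show "kern y * ?V (\<lambda>x. f x - g x) y \<le> 2 * (kern y * ?V f y) + 2 * (kern y * ?V g y)"
      using mult_left_mono[OF V[of y] kern_nonneg[of y]] by (simp add: algebra_simps)
  qed
  also have "\<dots> = 2 * variation f r + 2 * variation g r"
    unfolding variation_eq[OF f] variation_eq[OF g] unit_box_def
    by (subst Henstock_Kurzweil_Integration.integral_add, (intro cont_int continuous_intros kern_continuous translate_diff_continuous f g)+) simp
  finally show ?thesis
    unfolding variation_eq[OF fg periodic2_diff[OF f(2) g(2)]] .
qed

text \<open>Jensen's inequality, obtained by expanding the nonnegative variance of f(x + r y) about
  its kernel mean; Fubini then gives the variation.\<close>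

lemma mollify_error:
  assumes f: "continuous_on UNIV f" "periodic2 f"
  shows "kmass * integral Q0 (\<lambda>x. (f x - mollify r f x)\<^sup>2) \<le> variation f r"
proof -
  note ci = continuous_intros f mollify_continuous[OF f(1)] kern_continuous
  have pw: "kmass * (f x - mollify r f x)\<^sup>2 \<le> integral unit_box (\<lambda>y. kern y * (f (x + r *\<^sub>R y) - f x)\<^sup>2)" for x
  proof -
    have s: "continuous_on UNIV (\<lambda>y. f (x + r *\<^sub>R y))" by (intro cont_compose[OF f(1)] continuous_intros)
    define d where "d = f x - mollify r f x"
    have "0 \<le> integral unit_box (\<lambda>y. kern y * (f (x + r *\<^sub>R y) - mollify r f x)\<^sup>2)"
      unfolding unit_box_def by (intro integral_nonneg cont_int ci s mult_nonneg_nonneg kern_nonneg) auto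
    also have "\<dots> = integral unit_box (\<lambda>y. kern y * (f (x + r *\<^sub>R y) - f x)\<^sup>2 + 2 * d * (kern y * f (x + r *\<^sub>R y)) + (d\<^sup>2 - 2 * d * f x) * kern y)"
      by (intro arg_cong[where f="integral unit_box"] ext) (simp add: d_def power2_eq_square algebra_simps)
    also have "\<dots> = integral unit_box (\<lambda>y. kern y * (f (x + r *\<^sub>R y) - f x)\<^sup>2)
      + 2 * d * integral unit_box (\<lambda>y. kern y * f (x + r *\<^sub>R y)) + (d\<^sup>2 - 2 * d * f x) * kmass"
      unfolding unit_box_def kmass_def
      by (subst Henstock_Kurzweil_Integration.integral_add, (intro cont_int ci s)+)+ simp
    also have "integral unit_box (\<lambda>y. kern y * f (x + r *\<^sub>R y)) = kmass * (f x - d)"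
      using kmass_pos by (simp add: d_def mollify_def)
    finally show ?thesis unfolding d_def[symmetric] by (simp add: power2_eq_square algebra_simps)
  qed
  have "integral Q0 (\<lambda>x. kmass * (f x - mollify r f x)\<^sup>2) \<le> integral Q0 (\<lambda>x. integral unit_box (\<lambda>y. kern y * (f (x + r *\<^sub>R y) - f x)\<^sup>2))"
    unfolding Q0_def unit_box_def
    by (intro integral_le cont_int ci pw[unfolded unit_box_def] integral_continuous_on_param)
      (auto simp: case_prod_beta intro!: ci cont_compose[OF f(1)] cont_compose[OF kern_continuous])
  also have "\<dots> = integral unit_box (\<lambda>y. integral Q0 (\<lambda>x. kern y * (f (x + r *\<^sub>R y) - f x)\<^sup>2))"
    unfolding Q0_def unit_box_def
    by (rule integral_swap_continuous)
      (auto simp: case_prod_beta intro!: ci cont_compose[OF f(1)] cont_compose[OF kern_continuous])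
  also have "\<dots> = variation f r" by (simp add: variation_eq[OF f])
  finally show ?thesis by simp
qed

lemma integral_abs_square_le:
  assumes f: "continuous_on UNIV f" "periodic2 f" and r: "0 < r" "r \<le> pi"
  shows "r\<^sup>2 * integral unit_box (\<lambda>y. \<bar>f (x + r *\<^sub>R y)\<bar>) \<le> integral Q0 (\<lambda>x. \<bar>f x :: real\<bar>)"
proof -
  have fa: "continuous_on UNIV (\<lambda>x. \<bar>f x\<bar>)" by (intro continuous_intros f)
  have "r\<^sup>2 * integral unit_box (\<lambda>y. \<bar>f (x + r *\<^sub>R y)\<bar>) = integral (cbox (x - (r, r)) (x + (r, r))) (\<lambda>x. \<bar>f x\<bar>)"
    by (rule integral_unit_box_scale[OF fa r(1)])
  also have "\<dots> \<le> integral (cbox (x - (pi, pi)) (x - (pi, pi) + (2 * pi, 2 * pi))) (\<lambda>x. \<bar>f x\<bar>)"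
  proof (rule integral_subset_le)
    show "cbox (x - (r, r)) (x + (r, r)) \<subseteq> cbox (x - (pi, pi)) (x - (pi, pi) + (2 * pi, 2 * pi))"
      by (cases x) (use r in \<open>simp add: cbox_Pair_eq; intro Sigma_mono; simp\<close>)
  qed (simp_all add: cont_int[OF fa])
  also have "\<dots> = integral Q0 (\<lambda>x. \<bar>f x\<bar>)"
    by (rule integral_cbox_shift_periodic[OF fa periodic2_compose[OF f(2)]])
  finally show ?thesis .
qed

text \<open>The derivative is moved onto \<open>kern\<close>, whose partials are at most 24 in
  modulus on \<open>unit_box\<close>. One power of 1/r comes from this integration by parts, two
  from the change of variables in \<open>integral_abs_square_le\<close>.\<close>

lemma mollify_partials_le:
  assumes f: "has_partials f f1 f2" and per: "periodic2 f" and r: "0 < r" "r \<le> pi"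
  shows "\<bar>mollify r f1 x\<bar> \<le> 24 / (kmass * r ^ 3) * integral Q0 (\<lambda>x. \<bar>f x\<bar>)"
    and "\<bar>mollify r f2 x\<bar> \<le> 24 / (kmass * r ^ 3) * integral Q0 (\<lambda>x. \<bar>f x\<bar>)"
proof -
  note c = has_partialsD(3-5)[OF f]
  have s: "continuous_on UNIV (\<lambda>y. k (x + r *\<^sub>R y))" if "continuous_on UNIV k" for k :: "pt \<Rightarrow> real"
    by (intro cont_compose[OF that] continuous_intros)
  note ci = continuous_intros s[OF c(1)] s[OF c(2)] s[OF c(3)] kern_continuous bump_continuous
  note h = has_partials_mult[OF has_partials_kern has_partials_affine[OF f, of x r]]
  define X where "X = integral unit_box (\<lambda>y. \<bar>f (x + r *\<^sub>R y)\<bar>)"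
  have small: "norm (24 * (p y * bump y * f (x + r *\<^sub>R y))) \<le> 24 * \<bar>f (x + r *\<^sub>R y)\<bar>" if "\<bar>p y\<bar> \<le> 1" for p :: "pt \<Rightarrow> real" and y
  proof -
    have "\<bar>p y * bump y\<bar> * \<bar>f (x + r *\<^sub>R y)\<bar> \<le> (1 * 1) * \<bar>f (x + r *\<^sub>R y)\<bar>"
      unfolding abs_mult using that bump_bounds[of y] by (intro mult_mono mult_right_mono) auto
    then show ?thesis by (simp add: abs_mult)
  qed
  have bnd: "\<bar>integral unit_box (\<lambda>y. 24 * (p y * bump y * f (x + r *\<^sub>R y)))\<bar> \<le> 24 * X"
    if p: "continuous_on UNIV p" "\<And>y. y \<in> unit_box \<Longrightarrow> \<bar>p y\<bar> \<le> 1" for p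
  proof -
    have "norm (integral unit_box (\<lambda>y. 24 * (p y * bump y * f (x + r *\<^sub>R y)))) \<le> integral unit_box (\<lambda>y. 24 * \<bar>f (x + r *\<^sub>R y)\<bar>)"
      using p small unfolding unit_box_def by (intro integral_norm_bound_integral cont_int ci) auto
    then show ?thesis by (simp add: X_def)
  qed
  have X: "r\<^sup>2 * X \<le> integral Q0 (\<lambda>x. \<bar>f x\<bar>)"
    unfolding X_def by (rule integral_abs_square_le[OF c(1) per r])
  have fin: "\<bar>M / kmass\<bar> \<le> 24 / (kmass * r ^ 3) * integral Q0 (\<lambda>x. \<bar>f x\<bar>)"
    if "r * M = B" "\<bar>B\<bar> \<le> 24 * X" for M B
  proof -
    have "r\<^sup>2 * \<bar>r * M\<bar> \<le> 24 * (r\<^sup>2 * X)" using that mult_left_mono[of "\<bar>B\<bar>" "24 * X" "r\<^sup>2"] by simp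
    also have "\<dots> \<le> 24 * integral Q0 (\<lambda>x. \<bar>f x\<bar>)" using X by simp
    finally have "r ^ 3 * \<bar>M\<bar> \<le> 24 * integral Q0 (\<lambda>x. \<bar>f x\<bar>)"
      using r by (simp add: abs_mult power3_eq_cube power2_eq_square mult.assoc)
    then show ?thesis using r kmass_pos by (simp add: field_simps)
  qed
  have "r * integral unit_box (\<lambda>y. kern y * f1 (x + r *\<^sub>R y)) = integral unit_box (\<lambda>y. 24 * (fst y * bump y * f (x + r *\<^sub>R y)))"
  proof -
    have "0 = integral unit_box (\<lambda>y. - 24 * fst y * bump y * f (x + r *\<^sub>R y) + kern y * (r * f1 (x + r *\<^sub>R y)))"
      unfolding unit_box_def by (rule integral_partial_zero(1)[OF h, symmetric]) (auto simp: kern_def bump_boundary)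
    also have "\<dots> = integral unit_box (\<lambda>y. r * (kern y * f1 (x + r *\<^sub>R y)) - 24 * (fst y * bump y * f (x + r *\<^sub>R y)))"
      by (intro arg_cong[where f="integral unit_box"] ext) (simp add: algebra_simps)
    also have "\<dots> = r * integral unit_box (\<lambda>y. kern y * f1 (x + r *\<^sub>R y)) - integral unit_box (\<lambda>y. 24 * (fst y * bump y * f (x + r *\<^sub>R y)))"
      unfolding unit_box_def by (subst Henstock_Kurzweil_Integration.integral_diff, (intro cont_int ci)+) simp
    finally show ?thesis by simp
  qed
  from fin[OF this bnd[OF continuous_on_fst[OF continuous_on_id]]]
  show "\<bar>mollify r f1 x\<bar> \<le> 24 / (kmass * r ^ 3) * integral Q0 (\<lambda>x. \<bar>f x\<bar>)"
    by (simp add: mollify_def mem_unit_box)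
  have "r * integral unit_box (\<lambda>y. kern y * f2 (x + r *\<^sub>R y)) = integral unit_box (\<lambda>y. 24 * (snd y * bump y * f (x + r *\<^sub>R y)))"
  proof -
    have "0 = integral unit_box (\<lambda>y. - 24 * snd y * bump y * f (x + r *\<^sub>R y) + kern y * (r * f2 (x + r *\<^sub>R y)))"
      unfolding unit_box_def by (rule integral_partial_zero(2)[OF h, symmetric]) (auto simp: kern_def bump_boundary)
    also have "\<dots> = integral unit_box (\<lambda>y. r * (kern y * f2 (x + r *\<^sub>R y)) - 24 * (snd y * bump y * f (x + r *\<^sub>R y)))"
      by (intro arg_cong[where f="integral unit_box"] ext) (simp add: algebra_simps)
    also have "\<dots> = r * integral unit_box (\<lambda>y. kern y * f2 (x + r *\<^sub>R y)) - integral unit_box (\<lambda>y. 24 * (snd y * bump y * f (x + r *\<^sub>R y)))"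
      unfolding unit_box_def by (subst Henstock_Kurzweil_Integration.integral_diff, (intro cont_int ci)+) simp
    finally show ?thesis by simp
  qed
  from fin[OF this bnd[OF continuous_on_snd[OF continuous_on_id]]]
  show "\<bar>mollify r f2 x\<bar> \<le> 24 / (kmass * r ^ 3) * integral Q0 (\<lambda>x. \<bar>f x\<bar>)"
    by (simp add: mollify_def mem_unit_box)
qed

section \<open>Classical Navier--Stokes flows\<close>

text \<open>Reduces each balance law below to a pointwise polynomial identity, once the flux
  \<open>(A, B)\<close> has been exhibited.\<close>

lemma integral_eq_mod_divergence:
  assumes A: "has_partials A A1 A2" "periodic2 A" and B: "has_partials B B1 B2" "periodic2 B"
    and G: "continuous_on UNIV G" and eq: "\<And>x. F x = G x + (A1 x + B2 x)"
  shows "integral Q0 F = integral Q0 (G :: pt \<Rightarrow> real)"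
proof -
  have "integral Q0 F = integral Q0 (\<lambda>x. G x + (A1 x + B2 x))"
    by (intro arg_cong[where f="integral Q0"] ext eq)
  also have "\<dots> = integral Q0 G + (integral Q0 A1 + integral Q0 B2)"
    unfolding Q0_def
    by (subst Henstock_Kurzweil_Integration.integral_add,
        (intro cont_int continuous_intros G has_partialsD(4)[OF A(1)] has_partialsD(5)[OF B(1)])+)+ simp
  finally show ?thesis
    using integral_torus_partial_zero[OF A] integral_torus_partial_zero[OF B] by simp
qed

lemma integral_const_Q0: "integral Q0 (\<lambda>x. k :: real) = 4 * pi\<^sup>2 * k"
  by (simp add: Q0_def content_Pair power2_eq_square)

lemma corr_self_nonneg: "continuous_on UNIV f \<Longrightarrow> corr f f 0 \<ge> 0"
  unfolding corr_00 Q0_def by (intro integral_nonneg cont_int continuous_intros) auto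

lemma integral_abs_le:
  assumes "continuous_on UNIV f"
  shows "integral Q0 (\<lambda>x. \<bar>f x\<bar>) \<le> 2 * pi\<^sup>2 + corr f f 0 / 2"
proof -
  have pw: "\<bar>f x\<bar> \<le> 1 / 2 + (1 / 2) * (f x * f x)" for x
    using sum_squares_bound[of 1 "\<bar>f x\<bar>"] by (simp add: power2_eq_square)
  have "integral Q0 (\<lambda>x. \<bar>f x\<bar>) \<le> integral Q0 (\<lambda>x. 1 / 2 + (1 / 2) * (f x * f x))"
    unfolding Q0_def by (intro integral_le pw cont_int continuous_intros assms)
  also have "\<dots> = 4 * pi\<^sup>2 * (1 / 2) + corr f f 0 / 2"
    unfolding corr_00 integral_const_Q0[symmetric] Q0_def
    by (subst Henstock_Kurzweil_Integration.integral_add, (intro cont_int continuous_intros assms)+) simp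
  finally show ?thesis by simp
qed

lemma corr_diff_self_le:
  assumes f: "continuous_on UNIV f" and g: "continuous_on UNIV g"
  shows "corr (\<lambda>x. f x - g x) (\<lambda>x. f x - g x) 0 \<le> 2 * corr f f 0 + 2 * corr g g 0"
proof -
  have pw: "(f x - g x) * (f x - g x) \<le> 2 * (f x * f x) + 2 * (g x * g x)" for x
    using zero_le_power2[of "f x + g x"] by (simp add: power2_eq_square algebra_simps)
  have "corr (\<lambda>x. f x - g x) (\<lambda>x. f x - g x) 0 \<le> integral Q0 (\<lambda>x. 2 * (f x * f x) + 2 * (g x * g x))"
    unfolding corr_00 Q0_def by (intro integral_le pw cont_int continuous_intros f g)
  also have "\<dots> = 2 * corr f f 0 + 2 * corr g g 0"
    unfolding corr_00 Q0_def
    by (subst Henstock_Kurzweil_Integration.integral_add, (intro cont_int continuous_intros f g)+) simp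
  finally show ?thesis .
qed

text \<open>Rotation form of the equations: \<open>s1\<close>, \<open>s2\<close> are the time
  derivatives of the velocity, \<open>q\<close> is the Bernoulli pressure, and the Laplacian of the
  velocity is the rotated gradient (-w2, w1) of the vorticity. Neither a time derivative of
  \<open>w\<close> nor second derivatives of \<open>q\<close> are at hand.\<close>

locale ns_flow =
  fixes T e :: real and u1 u2 s1 s2 w w1 w2 q q1 q2 a11 a12 a21 a22 :: "real \<Rightarrow> pt \<Rightarrow> real"
  assumes e_pos: "e > 0"
    and u1: "t \<in> {0<..<T} \<Longrightarrow> has_partials (u1 t) (a11 t) (a12 t)"
    and u2: "t \<in> {0<..<T} \<Longrightarrow> has_partials (u2 t) (a21 t) (a22 t)"
    and w: "t \<in> {0<..<T} \<Longrightarrow> has_partials (w t) (w1 t) (w2 t)"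
    and q: "t \<in> {0<..<T} \<Longrightarrow> has_partials (q t) (q1 t) (q2 t)"
    and per: "t \<in> {0<..<T} \<Longrightarrow> periodic2 (u1 t)" "t \<in> {0<..<T} \<Longrightarrow> periodic2 (u2 t)"
      "t \<in> {0<..<T} \<Longrightarrow> periodic2 (q t)"
    and vort: "t \<in> {0<..<T} \<Longrightarrow> w t x = a21 t x - a12 t x"
    and div: "t \<in> {0<..<T} \<Longrightarrow> a11 t x + a22 t x = 0"
    and du: "t \<in> {0<..<T} \<Longrightarrow> ((\<lambda>s. u1 s x) has_real_derivative s1 t x) (at t)"
      "t \<in> {0<..<T} \<Longrightarrow> ((\<lambda>s. u2 s x) has_real_derivative s2 t x) (at t)"
    and cont: "continuous_on ({0<..<T} \<times> UNIV) (\<lambda>p. u1 (fst p) (snd p))"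
      "continuous_on ({0<..<T} \<times> UNIV) (\<lambda>p. u2 (fst p) (snd p))"
      "continuous_on ({0<..<T} \<times> UNIV) (\<lambda>p. s1 (fst p) (snd p))"
      "continuous_on ({0<..<T} \<times> UNIV) (\<lambda>p. s2 (fst p) (snd p))"
      "continuous_on ({0<..<T} \<times> UNIV) (\<lambda>p. w1 (fst p) (snd p))"
      "continuous_on ({0<..<T} \<times> UNIV) (\<lambda>p. w2 (fst p) (snd p))"
    and momentum: "t \<in> {0<..<T} \<Longrightarrow> s1 t x = - q1 t x + w t x * u2 t x - e * w2 t x"
      "t \<in> {0<..<T} \<Longrightarrow> s2 t x = - q2 t x - w t x * u1 t x + e * w1 t x"
begin

definition energy :: "real \<Rightarrow> real" where "energy t = corr (u1 t) (u1 t) 0 + corr (u2 t) (u2 t) 0"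
definition enstrophy :: "real \<Rightarrow> real" where "enstrophy t = corr (w t) (w t) 0"
definition palinstrophy :: "real \<Rightarrow> real" where "palinstrophy t = corr (w1 t) (w1 t) 0 + corr (w2 t) (w2 t) 0"

lemma per_w: "t \<in> {0<..<T} \<Longrightarrow> periodic2 (w t)"
proof -
  assume t: "t \<in> {0<..<T}"
  have "w t = (\<lambda>x. a21 t x - a12 t x)" using vort[OF t] by auto
  then show ?thesis using periodic2_partials[OF u1[OF t] per(1)[OF t]] periodic2_partials[OF u2[OF t] per(2)[OF t]]
    by (simp add: periodic2_diff)
qed

lemma cont_pair:
  assumes "continuous_on ({0<..<T} \<times> UNIV) (\<lambda>p. f (fst p) (snd p))" "continuous_on S g" "continuous_on S h"
    "\<And>x. x \<in> S \<Longrightarrow> g x \<in> {0<..<T}"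
  shows "continuous_on S (\<lambda>x. f (g x) (h x :: pt) :: real)"
proof -
  have "(\<lambda>x. (g x, h x)) ` S \<subseteq> {0<..<T} \<times> UNIV" using assms(4) by blast
  from continuous_on_compose2[OF assms(1) _ this] show ?thesis
    using assms(2,3) by (simp add: continuous_on_Pair)
qed

lemma velocity_pairing_DERIV:
  assumes t: "t \<in> {0<..<T}" and f: "continuous_on UNIV f" and g: "continuous_on UNIV g"
  shows "((\<lambda>t. integral Q0 (\<lambda>x. u1 t x * f x + u2 t x * g x)) has_real_derivative
     integral Q0 (\<lambda>x. s1 t x * f x + s2 t x * g x)) (at t)"
proof -
  have "((\<lambda>t. integral Q0 (\<lambda>x. u1 t x * f x + u2 t x * g x)) has_real_derivative
     integral Q0 (\<lambda>x. s1 t x * f x + s2 t x * g x)) (at t within {0<..<T})"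
    unfolding Q0_def
  proof (rule leibniz_rule_field_derivative[OF _ _ _ t])
    fix s x assume s: "s \<in> {0<..<T}"
    show "((\<lambda>s. u1 s x * f x + u2 s x * g x) has_real_derivative s1 s x * f x + s2 s x * g x) (at s within {0<..<T})"
      by (rule has_field_derivative_at_within) (intro DERIV_add DERIV_cmult_right du s)
  next
    fix s assume s: "s \<in> {0<..<T}"
    show "(\<lambda>x. u1 s x * f x + u2 s x * g x) integrable_on cbox (0, 0) (2 * pi, 2 * pi)"
      by (intro cont_int continuous_intros f g has_partialsD(3)[OF u1[OF s]] has_partialsD(3)[OF u2[OF s]])
  next
    show "continuous_on ({0<..<T} \<times> cbox (0, 0) (2 * pi, 2 * pi)) (\<lambda>(s, x). s1 s x * f x + s2 s x * g x)"
      unfolding case_prod_beta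
      by (intro continuous_intros cont_pair[OF cont(3)] cont_pair[OF cont(4)] cont_compose[OF f] cont_compose[OF g]) auto
  qed auto
  then show ?thesis using t at_within_open[of t "{0<..<T}"] by simp
qed

text \<open>The force w (u2, -u1) is orthogonal to the velocity. Pressure and viscosity contribute
  the divergence of 2 (e w (u2, -u1) - q (u1, u2)) and the dissipation.\<close>

lemma energy_DERIV:
  assumes t: "t \<in> {0<..<T}"
  shows "(energy has_real_derivative - 2 * e * enstrophy t) (at t)"
proof -
  note cu = has_partialsD(3-5)[OF u1[OF t]] has_partialsD(3-5)[OF u2[OF t]] has_partialsD(3-5)[OF w[OF t]] has_partialsD(3-5)[OF q[OF t]]
  have "((\<lambda>t. integral Q0 (\<lambda>x. u1 t x * u1 t x + u2 t x * u2 t x)) has_real_derivative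
     integral Q0 (\<lambda>x. 2 * (u1 t x * s1 t x + u2 t x * s2 t x))) (at t within {0<..<T})"
    unfolding Q0_def
  proof (rule leibniz_rule_field_derivative[OF _ _ _ t])
    fix s x assume s: "s \<in> {0<..<T}"
    show "((\<lambda>s. u1 s x * u1 s x + u2 s x * u2 s x) has_real_derivative 2 * (u1 s x * s1 s x + u2 s x * s2 s x)) (at s within {0<..<T})"
      by (rule has_field_derivative_at_within) (auto intro!: derivative_eq_intros du s)
  next
    fix s assume s: "s \<in> {0<..<T}"
    show "(\<lambda>x. u1 s x * u1 s x + u2 s x * u2 s x) integrable_on cbox (0, 0) (2 * pi, 2 * pi)"
      by (intro cont_int continuous_intros has_partialsD(3)[OF u1[OF s]] has_partialsD(3)[OF u2[OF s]])
  next
    show "continuous_on ({0<..<T} \<times> cbox (0, 0) (2 * pi, 2 * pi)) (\<lambda>(s, x). 2 * (u1 s x * s1 s x + u2 s x * s2 s x))"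
      unfolding case_prod_beta
      by (intro continuous_intros cont_pair[OF cont(1)] cont_pair[OF cont(2)] cont_pair[OF cont(3)] cont_pair[OF cont(4)]) auto
  qed auto
  moreover have "integral Q0 (\<lambda>x. 2 * (u1 t x * s1 t x + u2 t x * s2 t x)) = integral Q0 (\<lambda>x. - 2 * e * (w t x * w t x))"
  proof (rule integral_eq_mod_divergence)
    show "has_partials (\<lambda>x. 2 * (e * (u2 t x * w t x) - u1 t x * q t x))
      (\<lambda>x. 2 * (e * (a21 t x * w t x + u2 t x * w1 t x) - (a11 t x * q t x + u1 t x * q1 t x)))
      (\<lambda>x. 2 * (e * (a22 t x * w t x + u2 t x * w2 t x) - (a12 t x * q t x + u1 t x * q2 t x)))"
      by (intro has_partials_cmult has_partials_diff has_partials_mult u1 u2 w q t)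
    show "has_partials (\<lambda>x. 2 * ((- e) * (u1 t x * w t x) - u2 t x * q t x))
      (\<lambda>x. 2 * ((- e) * (a11 t x * w t x + u1 t x * w1 t x) - (a21 t x * q t x + u2 t x * q1 t x)))
      (\<lambda>x. 2 * ((- e) * (a12 t x * w t x + u1 t x * w2 t x) - (a22 t x * q t x + u2 t x * q2 t x)))"
      by (intro has_partials_cmult has_partials_diff has_partials_mult u1 u2 w q t)
    show "periodic2 (\<lambda>x. 2 * (e * (u2 t x * w t x) - u1 t x * q t x))" "periodic2 (\<lambda>x. 2 * ((- e) * (u1 t x * w t x) - u2 t x * q t x))"
      using per(1)[OF t] per(2)[OF t] per(3)[OF t] per_w[OF t] by (auto simp: periodic2_def)
    show "continuous_on UNIV (\<lambda>x. - 2 * e * (w t x * w t x))" by (intro continuous_intros cu)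
    fix x
    have a22: "a22 t x = - a11 t x" and a21: "a21 t x = w t x + a12 t x" using div[OF t, of x] vort[OF t, of x] by simp_all
    show "2 * (u1 t x * s1 t x + u2 t x * s2 t x) = - 2 * e * (w t x * w t x) +
      (2 * (e * (a21 t x * w t x + u2 t x * w1 t x) - (a11 t x * q t x + u1 t x * q1 t x)) +
       2 * ((- e) * (a12 t x * w t x + u1 t x * w2 t x) - (a22 t x * q t x + u2 t x * q2 t x)))"
      unfolding momentum[OF t] a22 a21 by (simp add: algebra_simps)
  qed
  ultimately have "((\<lambda>t. integral Q0 (\<lambda>x. u1 t x * u1 t x + u2 t x * u2 t x)) has_real_derivative - 2 * e * enstrophy t) (at t)"
    using t at_within_open[of t "{0<..<T}"] by (simp add: enstrophy_def corr_00)
  then show ?thesis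
  proof (rule has_field_derivative_transform_within_open[of _ _ _ "{0<..<T}"])
    fix s assume s: "s \<in> {0<..<T}"
    show "integral Q0 (\<lambda>x. u1 s x * u1 s x + u2 s x * u2 s x) = energy s"
      unfolding energy_def corr_00 Q0_def
      by (intro Henstock_Kurzweil_Integration.integral_add cont_int continuous_intros has_partialsD(3)[OF u1[OF s]] has_partialsD(3)[OF u2[OF s]])
  qed (use t in auto)
qed

text \<open>Factor the difference of squares; w(t) - w(s) is the curl of the velocity increment, and
  that curl is integrated by parts onto w(t) + w(s). Time increments then concern the velocity
  alone.\<close>

lemma enstrophy_diff:
  assumes t: "t \<in> {0<..<T}" and s: "s \<in> {0<..<T}"
  shows "enstrophy t - enstrophy s = integral Q0 (\<lambda>x. (u1 t x - u1 s x) * (w2 t x + w2 s x) - (u2 t x - u2 s x) * (w1 t x + w1 s x))"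
proof -
  note cw = has_partialsD(3-5)[OF w[OF t]] has_partialsD(3-5)[OF w[OF s]]
  have "enstrophy t - enstrophy s = integral Q0 (\<lambda>x. w t x * w t x - w s x * w s x)"
    unfolding enstrophy_def corr_00 Q0_def
    by (intro Henstock_Kurzweil_Integration.integral_diff[symmetric] cont_int continuous_intros cw)
  also have "\<dots> = integral Q0 (\<lambda>x. (u1 t x - u1 s x) * (w2 t x + w2 s x) - (u2 t x - u2 s x) * (w1 t x + w1 s x))"
  proof (rule integral_eq_mod_divergence)
    show "has_partials (\<lambda>x. (u2 t x - u2 s x) * (w t x + w s x))
      (\<lambda>x. (a21 t x - a21 s x) * (w t x + w s x) + (u2 t x - u2 s x) * (w1 t x + w1 s x))
      (\<lambda>x. (a22 t x - a22 s x) * (w t x + w s x) + (u2 t x - u2 s x) * (w2 t x + w2 s x))"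
      by (intro has_partials_add has_partials_diff has_partials_mult u2 w t s)
    show "has_partials (\<lambda>x. (- 1) * ((u1 t x - u1 s x) * (w t x + w s x)))
      (\<lambda>x. (- 1) * ((a11 t x - a11 s x) * (w t x + w s x) + (u1 t x - u1 s x) * (w1 t x + w1 s x)))
      (\<lambda>x. (- 1) * ((a12 t x - a12 s x) * (w t x + w s x) + (u1 t x - u1 s x) * (w2 t x + w2 s x)))"
      by (intro has_partials_cmult has_partials_add has_partials_diff has_partials_mult u1 w t s)
    show "periodic2 (\<lambda>x. (u2 t x - u2 s x) * (w t x + w s x))" "periodic2 (\<lambda>x. (- 1) * ((u1 t x - u1 s x) * (w t x + w s x)))"
      using per(1)[OF t] per(2)[OF t] per_w[OF t] per(1)[OF s] per(2)[OF s] per_w[OF s] by (auto simp: periodic2_def)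
    show "continuous_on UNIV (\<lambda>x. (u1 t x - u1 s x) * (w2 t x + w2 s x) - (u2 t x - u2 s x) * (w1 t x + w1 s x))"
      by (intro continuous_intros cw has_partialsD(3)[OF u1[OF s]] has_partialsD(3)[OF u2[OF s]] has_partialsD(3)[OF u1[OF t]] has_partialsD(3)[OF u2[OF t]])
    show "w t x * w t x - w s x * w s x = (u1 t x - u1 s x) * (w2 t x + w2 s x) - (u2 t x - u2 s x) * (w1 t x + w1 s x) +
      ((a21 t x - a21 s x) * (w t x + w s x) + (u2 t x - u2 s x) * (w1 t x + w1 s x) +
       (- 1) * ((a12 t x - a12 s x) * (w t x + w s x) + (u1 t x - u1 s x) * (w2 t x + w2 s x)))" for x
      unfolding vort[OF t] vort[OF s] by (simp add: algebra_simps)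
  qed
  finally show ?thesis .
qed

text \<open>Hadamard's form of the quotient: averaging the time derivative along the segment from
  \<open>s\<close> to \<open>t\<close> gives a \<open>k\<close> that is jointly continuous also at
  \<open>t = s\<close>.\<close>

lemma difference_quotient:
  fixes u s' :: "real \<Rightarrow> pt \<Rightarrow> real"
  assumes d: "\<And>t x. t \<in> {0<..<T} \<Longrightarrow> ((\<lambda>s. u s x) has_real_derivative s' t x) (at t)"
    and c: "continuous_on ({0<..<T} \<times> UNIV) (\<lambda>p. s' (fst p) (snd p))" and s: "s \<in> {0<..<T}"
  obtains k where "continuous_on ({0<..<T} \<times> UNIV) (\<lambda>p. k (fst p) (snd p))" "\<And>x. k s x = s' s x"
    "\<And>t x. t \<in> {0<..<T} \<Longrightarrow> u t x - u s x = (t - s) * k t x"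
proof -
  have seg: "s + th * (t - s) \<in> {0<..<T}" if "t \<in> {0<..<T}" "th \<in> {0..1}" for t th
  proof -
    have "s + th * (t - s) = (1 - th) *\<^sub>R s + th *\<^sub>R t" by (simp add: algebra_simps)
    also have "\<dots> \<in> {0<..<T}" using that s by (intro convexD) auto
    finally show ?thesis .
  qed
  define k where "k = (\<lambda>t x. integral (cbox 0 1) (\<lambda>th. s' (s + th * (t - s)) x))"
  have 1: "continuous_on ({0<..<T} \<times> UNIV) (\<lambda>p. k (fst p) (snd p))"
    unfolding k_def
  proof (rule integral_continuous_on_param)
    show "continuous_on (({0<..<T} \<times> UNIV) \<times> cbox 0 1) (\<lambda>(p, th). s' (s + th * (fst p - s)) (snd p))"
      unfolding case_prod_beta
      by (intro cont_pair[OF c] continuous_intros) (use seg in auto)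
  qed
  have 2: "k s x = s' s x" for x by (simp add: k_def)
  have 3: "u t x - u s x = (t - s) * k t x" if t: "t \<in> {0<..<T}" for t x
  proof -
    have "((\<lambda>th. s' (s + th * (t - s)) x * (t - s)) has_integral (u (s + 1 * (t - s)) x - u (s + 0 * (t - s)) x)) {0..1}"
    proof (rule fundamental_theorem_of_calculus)
      fix th :: real assume th: "th \<in> {0..1}"
      have "((\<lambda>th. u (s + th * (t - s)) x) has_real_derivative s' (s + th * (t - s)) x * (t - s)) (at th)"
        by (rule DERIV_chain2[of "\<lambda>s. u s x"], rule d[OF seg[OF t th]]) (auto intro!: derivative_eq_intros)
      then show "((\<lambda>th. u (s + th * (t - s)) x) has_vector_derivative s' (s + th * (t - s)) x * (t - s)) (at th within {0..1})"
        by (simp add: has_real_derivative_iff_has_vector_derivative has_vector_derivative_at_within)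
    qed simp
    from integral_unique[OF this]
    have "u t x - u s x = integral {0..1} (\<lambda>th. s' (s + th * (t - s)) x * (t - s))" by simp
    then show ?thesis by (simp add: k_def mult.commute)
  qed
  show ?thesis by (rule that[OF 1 2 3])
qed

text \<open>Replaces the vorticity equation. In the limit the velocity derivative is tested against
  the rotated gradient of \<open>w\<close>; there the transport term is the divergence of w^2 times
  the velocity.\<close>

lemma enstrophy_DERIV:
  assumes s: "s \<in> {0<..<T}"
  shows "(enstrophy has_real_derivative - 2 * e * palinstrophy s) (at s)"
proof -
  note cs = has_partialsD(3-5)[OF u1[OF s]] has_partialsD(3-5)[OF u2[OF s]] has_partialsD(3-5)[OF w[OF s]] has_partialsD(3-5)[OF q[OF s]]
  obtain k1 where k1: "continuous_on ({0<..<T} \<times> UNIV) (\<lambda>p. k1 (fst p) (snd p))" "\<And>x. k1 s x = s1 s x"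
    "\<And>t x. t \<in> {0<..<T} \<Longrightarrow> u1 t x - u1 s x = (t - s) * k1 t x"
    using difference_quotient[OF du(1) cont(3) s] by blast
  obtain k2 where k2: "continuous_on ({0<..<T} \<times> UNIV) (\<lambda>p. k2 (fst p) (snd p))" "\<And>x. k2 s x = s2 s x"
    "\<And>t x. t \<in> {0<..<T} \<Longrightarrow> u2 t x - u2 s x = (t - s) * k2 t x"
    using difference_quotient[OF du(2) cont(4) s] by blast
  \<comment> \<open>\<open>R t\<close> is the difference quotient of the enstrophy for
    \<open>t \<noteq> s\<close>, written so that it extends continuously to
    \<open>t = s\<close>.\<close>
  define R where "R = (\<lambda>t. integral Q0 (\<lambda>x. k1 t x * (w2 t x + w2 s x) - k2 t x * (w1 t x + w1 s x)))"
  have "continuous_on {0<..<T} R"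
    unfolding R_def Q0_def
  proof (rule integral_continuous_on_param)
    show "continuous_on ({0<..<T} \<times> cbox (0, 0) (2 * pi, 2 * pi)) (\<lambda>(t, x). k1 t x * (w2 t x + w2 s x) - k2 t x * (w1 t x + w1 s x))"
      unfolding case_prod_beta
      by (intro continuous_intros cont_pair[OF k1(1)] cont_pair[OF k2(1)] cont_pair[OF cont(5)] cont_pair[OF cont(6)]
          cont_compose[OF cs(8)] cont_compose[OF cs(9)]) auto
  qed
  then have "(R \<longlongrightarrow> R s) (at s within {0<..<T})" using s by (simp add: continuous_on_def)
  then have "((\<lambda>t. (enstrophy t - enstrophy s) / (t - s)) \<longlongrightarrow> R s) (at s within {0<..<T})"
  proof (rule Lim_transform_eventually)
    have "R t = (enstrophy t - enstrophy s) / (t - s)" if "t \<in> {0<..<T}" "t \<noteq> s" for t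
    proof -
      have "enstrophy t - enstrophy s = integral Q0 (\<lambda>x. (t - s) * (k1 t x * (w2 t x + w2 s x) - k2 t x * (w1 t x + w1 s x)))"
        unfolding enstrophy_diff[OF that(1) s] k1(3)[OF that(1)] k2(3)[OF that(1)] by (simp add: algebra_simps)
      then show ?thesis using that by (simp add: R_def)
    qed
    then show "\<forall>\<^sub>F t in at s within {0<..<T}. R t = (enstrophy t - enstrophy s) / (t - s)"
      by (auto simp: eventually_at_filter)
  qed
  then have D: "(enstrophy has_real_derivative R s) (at s)"
    using s at_within_open[of s "{0<..<T}"] by (simp add: has_field_derivative_iff)
  have "R s = integral Q0 (\<lambda>x. 2 * (s1 s x * w2 s x - s2 s x * w1 s x))"
    unfolding R_def k1(2) k2(2) by (intro arg_cong[where f="integral Q0"] ext) (simp add: algebra_simps)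
  also have "\<dots> = integral Q0 (\<lambda>x. 2 * (q2 s x * w1 s x) - 2 * (q1 s x * w2 s x) - 2 * e * (w1 s x * w1 s x) - 2 * e * (w2 s x * w2 s x))"
  proof (rule integral_eq_mod_divergence)
    show "has_partials (\<lambda>x. u1 s x * (w s x * w s x))
      (\<lambda>x. a11 s x * (w s x * w s x) + u1 s x * (w1 s x * w s x + w s x * w1 s x))
      (\<lambda>x. a12 s x * (w s x * w s x) + u1 s x * (w2 s x * w s x + w s x * w2 s x))"
      by (intro has_partials_mult u1 w s)
    show "has_partials (\<lambda>x. u2 s x * (w s x * w s x))
      (\<lambda>x. a21 s x * (w s x * w s x) + u2 s x * (w1 s x * w s x + w s x * w1 s x))
      (\<lambda>x. a22 s x * (w s x * w s x) + u2 s x * (w2 s x * w s x + w s x * w2 s x))"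
      by (intro has_partials_mult u2 w s)
    show "periodic2 (\<lambda>x. u1 s x * (w s x * w s x))" "periodic2 (\<lambda>x. u2 s x * (w s x * w s x))"
      using per(1)[OF s] per(2)[OF s] per_w[OF s] by (auto simp: periodic2_def)
    show "continuous_on UNIV (\<lambda>x. 2 * (q2 s x * w1 s x) - 2 * (q1 s x * w2 s x) - 2 * e * (w1 s x * w1 s x) - 2 * e * (w2 s x * w2 s x))"
      by (intro continuous_intros cs)
    fix x
    have a22: "a22 s x = - a11 s x" using div[OF s, of x] by simp
    show "2 * (s1 s x * w2 s x - s2 s x * w1 s x) =
      2 * (q2 s x * w1 s x) - 2 * (q1 s x * w2 s x) - 2 * e * (w1 s x * w1 s x) - 2 * e * (w2 s x * w2 s x) +
      (a11 s x * (w s x * w s x) + u1 s x * (w1 s x * w s x + w s x * w1 s x) +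
       (a22 s x * (w s x * w s x) + u2 s x * (w2 s x * w s x + w s x * w2 s x)))"
      unfolding momentum[OF s] a22 by (simp add: algebra_simps)
  qed
  also have "\<dots> = 2 * integral Q0 (\<lambda>x. q2 s x * w1 s x) - 2 * integral Q0 (\<lambda>x. q1 s x * w2 s x)
     - 2 * e * integral Q0 (\<lambda>x. w1 s x * w1 s x) - 2 * e * integral Q0 (\<lambda>x. w2 s x * w2 s x)"
    unfolding Q0_def by (subst Henstock_Kurzweil_Integration.integral_diff, (intro cont_int continuous_intros cs)+)+ simp
  \<comment> \<open>The two pressure integrals cancel: an integrated form of curl grad q = 0 that
    needs only first derivatives of \<open>q\<close>.\<close>
  also have "\<dots> = - 2 * e * palinstrophy s"
    using integral_partials_exchange[OF q[OF s] w[OF s] per(3)[OF s] per_w[OF s]]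
    by (simp add: palinstrophy_def corr_00 algebra_simps)
  finally show ?thesis using D by simp
qed

section \<open>Monotonicity and decay of energy and enstrophy\<close>

lemma energy_nonneg: "t \<in> {0<..<T} \<Longrightarrow> energy t \<ge> 0"
  and enstrophy_nonneg: "t \<in> {0<..<T} \<Longrightarrow> enstrophy t \<ge> 0"
  and palinstrophy_nonneg: "t \<in> {0<..<T} \<Longrightarrow> palinstrophy t \<ge> 0"
  unfolding energy_def enstrophy_def palinstrophy_def
  by (intro add_nonneg_nonneg corr_self_nonneg has_partialsD(3-5)[OF u1] has_partialsD(3-5)[OF u2] has_partialsD(3-5)[OF w]; simp)+

lemma energy_mvt:
  assumes "0 < s" "s < t" "t < T"
  obtains r where "s < r" "r < t" "energy s - energy t = 2 * e * (t - s) * enstrophy r"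
proof -
  have "\<exists>r>s. r < t \<and> energy t - energy s = (t - s) * (- 2 * e * enstrophy r)"
    by (rule MVT2[OF assms(2) energy_DERIV]) (use assms in auto)
  then obtain r where "s < r" "r < t" "energy t - energy s = (t - s) * (- 2 * e * enstrophy r)" by blast
  then show ?thesis by (intro that[of r]) (auto simp: algebra_simps)
qed

lemma enstrophy_mvt:
  assumes "0 < s" "s < t" "t < T"
  obtains r where "s < r" "r < t" "enstrophy s - enstrophy t = 2 * e * (t - s) * palinstrophy r"
proof -
  have "\<exists>r>s. r < t \<and> enstrophy t - enstrophy s = (t - s) * (- 2 * e * palinstrophy r)"
    by (rule MVT2[OF assms(2) enstrophy_DERIV]) (use assms in auto)
  then obtain r where "s < r" "r < t" "enstrophy t - enstrophy s = (t - s) * (- 2 * e * palinstrophy r)" by blast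
  then show ?thesis by (intro that[of r]) (auto simp: algebra_simps)
qed

lemma energy_antimono:
  assumes "0 < s" "s \<le> t" "t < T" shows "energy t \<le> energy s"
proof (cases "s = t")
  case False
  then have "s < t" using assms by simp
  then obtain r where "s < r" "r < t" "energy s - energy t = 2 * e * (t - s) * enstrophy r"
    using energy_mvt assms by blast
  moreover have "2 * e * (t - s) * enstrophy r \<ge> 0"
    using \<open>s < r\<close> \<open>r < t\<close> assms e_pos enstrophy_nonneg[of r] by (intro mult_nonneg_nonneg) auto
  ultimately show ?thesis by linarith
qed simp

lemma enstrophy_antimono:
  assumes "0 < s" "s \<le> t" "t < T" shows "enstrophy t \<le> enstrophy s"
proof (cases "s = t")
  case False
  then have "s < t" using assms by simp
  then obtain r where "s < r" "r < t" "enstrophy s - enstrophy t = 2 * e * (t - s) * palinstrophy r"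
    using enstrophy_mvt assms by blast
  moreover have "2 * e * (t - s) * palinstrophy r \<ge> 0"
    using \<open>s < r\<close> \<open>r < t\<close> assms e_pos palinstrophy_nonneg[of r] by (intro mult_nonneg_nonneg) auto
  ultimately show ?thesis by linarith
qed simp

lemma energy_drop_le:
  assumes "0 < s" "s \<le> t" "t < T" shows "energy s - energy t \<le> 2 * e * (t - s) * enstrophy s"
proof (cases "s = t")
  case False
  then have "s < t" using assms by simp
  then obtain r where r: "s < r" "r < t" "energy s - energy t = 2 * e * (t - s) * enstrophy r"
    using energy_mvt assms by blast
  then show ?thesis using enstrophy_antimono[of s r] assms e_pos by (simp add: mult_left_mono)
qed simp

text \<open>The energy pays for 2 e times the time integral of the enstrophy, and a nonincreasing
  enstrophy makes its final value the smallest. The left end only tends to 0, as the flow is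
  classical for positive times.\<close>

lemma enstrophy_decay:
  assumes E0: "\<And>t. t \<in> {0<..<T} \<Longrightarrow> energy t \<le> E0" and t: "t \<in> {0<..<T}"
  shows "2 * e * t * enstrophy t \<le> E0"
proof -
  have le: "2 * e * (t - s) * enstrophy t \<le> E0" if s: "0 < s" "s < t" for s
  proof -
    obtain r where r: "s < r" "r < t" "energy s - energy t = 2 * e * (t - s) * enstrophy r"
      using energy_mvt s t by auto
    have "2 * e * (t - s) * enstrophy t \<le> 2 * e * (t - s) * enstrophy r"
      using enstrophy_antimono[of r t] r s t e_pos by (intro mult_left_mono) auto
    then show ?thesis using r E0[of s] energy_nonneg[OF t] s t by auto
  qed
  have "((\<lambda>s. 2 * e * (t - s) * enstrophy t) \<longlongrightarrow> 2 * e * (t - 0) * enstrophy t) (at_right 0)"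
    by (intro tendsto_intros)
  moreover have "\<forall>\<^sub>F s in at_right 0. 2 * e * (t - s) * enstrophy t \<le> E0"
    using t le by (auto simp: eventually_at_right[of 0 t] intro!: exI[of _ t])
  ultimately have "2 * e * (t - 0) * enstrophy t \<le> E0"
    by (rule tendsto_upperbound) simp
  then show ?thesis by simp
qed

text \<open>If e times the enstrophy exceeded \<open>l\<close> at \<open>d\<close>, it would do so
  on all of (d/2, d). There the second interpolation term accounts for at most half, so the
  palinstrophy is at least l / (4 e r^2). The mean value theorem then makes the enstrophy at d/2 at
  least e d times this, and \<open>enstrophy_decay\<close> at d/2 forces e l d^2 <= 4 E0 r^2,
  against \<open>small\<close>.\<close>

lemma enstrophy_vanish:
  assumes E0: "\<And>t. t \<in> {0<..<T} \<Longrightarrow> energy t \<le> E0" and d: "d \<in> {0<..<T}" and l: "l > 0" and r: "r > 0"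
    and ip: "\<And>t. t \<in> {0<..<T} \<Longrightarrow> enstrophy t \<le> 2 * r\<^sup>2 * palinstrophy t + 9 / 4 * b / r\<^sup>2"
    and b: "9 / 4 * b / r\<^sup>2 \<le> l / (2 * e)" and small: "4 * E0 * r\<^sup>2 < e * l * d\<^sup>2"
  shows "e * enstrophy d \<le> l"
proof (rule ccontr)
  assume "\<not> e * enstrophy d \<le> l"
  then have big: "enstrophy d > l / e" using e_pos by (simp add: field_simps)
  obtain x where x: "d / 2 < x" "x < d" "enstrophy (d / 2) - enstrophy d = 2 * e * (d - d / 2) * palinstrophy x"
    using enstrophy_mvt[of "d / 2" d] d by auto
  have xT: "x \<in> {0<..<T}" using x d by auto
  have "enstrophy x \<ge> enstrophy d" using enstrophy_antimono[of x d] x d by auto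
  then have "2 * r\<^sup>2 * palinstrophy x \<ge> l / e - l / (2 * e)"
    using ip[OF xT] b big by linarith
  moreover have "l / e - l / (2 * e) = l / (2 * e)" using e_pos by (simp add: field_simps)
  ultimately have pal: "4 * e * r\<^sup>2 * palinstrophy x \<ge> l"
    using e_pos by (simp add: field_simps)
  have en: "enstrophy (d / 2) \<ge> e * d * palinstrophy x"
    using x enstrophy_nonneg[OF d] by simp
  have "e * d * enstrophy (d / 2) \<le> E0"
    using enstrophy_decay[OF E0, of "d / 2"] d by simp
  moreover have "e * d * (e * d * palinstrophy x) \<le> e * d * enstrophy (d / 2)"
    using en e_pos d by (intro mult_left_mono) auto
  ultimately have "4 * r\<^sup>2 * (e * d * (e * d * palinstrophy x)) \<le> 4 * r\<^sup>2 * E0"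
    by (intro mult_left_mono) auto
  moreover have "4 * r\<^sup>2 * (e * d * (e * d * palinstrophy x)) = e * d\<^sup>2 * (4 * e * r\<^sup>2 * palinstrophy x)"
    by (simp add: power2_eq_square)
  moreover have "e * d\<^sup>2 * l \<le> e * d\<^sup>2 * (4 * e * r\<^sup>2 * palinstrophy x)"
    using pal e_pos by (intro mult_left_mono) auto
  moreover have "4 * r\<^sup>2 * E0 < e * d\<^sup>2 * l" using small by (simp add: mult_ac)
  ultimately show False by linarith
qed

text \<open>A divergence-free test field removes the pressure, and integration by parts leaves only
  its gradient: quadratic terms are paid by the energy, viscosity by the L^1 norm of the vorticity.
  This bounds the time derivative of the velocity in a dual Lipschitz norm.\<close>

lemma pairing_derivative_bound:
  assumes t: "t \<in> {0<..<T}" and f: "has_partials f f1 f2" "periodic2 f" and g: "has_partials g g1 g2" "periodic2 g"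
    and fg: "\<And>x. f1 x + g2 x = 0" and B: "\<And>x. \<bar>f1 x\<bar> \<le> B" "\<And>x. \<bar>f2 x\<bar> \<le> B" "\<And>x. \<bar>g1 x\<bar> \<le> B" "\<And>x. \<bar>g2 x\<bar> \<le> B"
  shows "\<bar>integral Q0 (\<lambda>x. s1 t x * f x + s2 t x * g x)\<bar> \<le> 2 * B * energy t + 2 * B * (e * integral Q0 (\<lambda>x. \<bar>w t x\<bar>))"
proof -
  note cu = has_partialsD(3-5)[OF u1[OF t]] has_partialsD(3-5)[OF u2[OF t]] has_partialsD(3-5)[OF w[OF t]] has_partialsD(3-5)[OF q[OF t]]
    has_partialsD(3-5)[OF f(1)] has_partialsD(3-5)[OF g(1)]
  let ?G = "\<lambda>x. u1 t x * u1 t x * f1 x + u1 t x * u2 t x * g1 x + u2 t x * u1 t x * f2 x + u2 t x * u2 t x * g2 x + e * (w t x * (f2 x - g1 x))"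
  let ?k = "\<lambda>x. (1 / 2) * (u1 t x * u1 t x + u2 t x * u2 t x)"
  let ?v = "\<lambda>x. u1 t x * f x + u2 t x * g x"
  \<comment> \<open>With test field phi = (f, g) and k = |u|^2 / 2, the force w (u2, -u1) equals
    grad k - (u . grad) u. Hence the flux is (k - q) phi - u (u . phi) + e w (g, -f).\<close>
  have FG: "integral Q0 (\<lambda>x. s1 t x * f x + s2 t x * g x) = integral Q0 ?G"
  proof (rule integral_eq_mod_divergence)
    show "has_partials (\<lambda>x. e * (w t x * g x) - q t x * f x + (?k x * f x - u1 t x * ?v x))
      (\<lambda>x. e * (w1 t x * g x + w t x * g1 x) - (q1 t x * f x + q t x * f1 x) +
         (((1 / 2) * (a11 t x * u1 t x + u1 t x * a11 t x + (a21 t x * u2 t x + u2 t x * a21 t x)) * f x + ?k x * f1 x)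
          - (a11 t x * ?v x + u1 t x * ((a11 t x * f x + u1 t x * f1 x) + (a21 t x * g x + u2 t x * g1 x)))))
      (\<lambda>x. e * (w2 t x * g x + w t x * g2 x) - (q2 t x * f x + q t x * f2 x) +
         (((1 / 2) * (a12 t x * u1 t x + u1 t x * a12 t x + (a22 t x * u2 t x + u2 t x * a22 t x)) * f x + ?k x * f2 x)
          - (a12 t x * ?v x + u1 t x * ((a12 t x * f x + u1 t x * f2 x) + (a22 t x * g x + u2 t x * g2 x)))))"
      by (intro has_partials_cmult has_partials_add has_partials_diff has_partials_mult u1 u2 w q f g t)
    show "has_partials (\<lambda>x. (- e) * (w t x * f x) - q t x * g x + (?k x * g x - u2 t x * ?v x))
      (\<lambda>x. (- e) * (w1 t x * f x + w t x * f1 x) - (q1 t x * g x + q t x * g1 x) +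
         (((1 / 2) * (a11 t x * u1 t x + u1 t x * a11 t x + (a21 t x * u2 t x + u2 t x * a21 t x)) * g x + ?k x * g1 x)
          - (a21 t x * ?v x + u2 t x * ((a11 t x * f x + u1 t x * f1 x) + (a21 t x * g x + u2 t x * g1 x)))))
      (\<lambda>x. (- e) * (w2 t x * f x + w t x * f2 x) - (q2 t x * g x + q t x * g2 x) +
         (((1 / 2) * (a12 t x * u1 t x + u1 t x * a12 t x + (a22 t x * u2 t x + u2 t x * a22 t x)) * g x + ?k x * g2 x)
          - (a22 t x * ?v x + u2 t x * ((a12 t x * f x + u1 t x * f2 x) + (a22 t x * g x + u2 t x * g2 x)))))"
      by (intro has_partials_cmult has_partials_add has_partials_diff has_partials_mult u1 u2 w q f g t)
    show "periodic2 (\<lambda>x. e * (w t x * g x) - q t x * f x + (?k x * f x - u1 t x * ?v x))"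
      "periodic2 (\<lambda>x. (- e) * (w t x * f x) - q t x * g x + (?k x * g x - u2 t x * ?v x))"
      using per(1)[OF t] per(2)[OF t] per(3)[OF t] per_w[OF t] f(2) g(2) by (auto simp: periodic2_def)
    show "continuous_on UNIV ?G" by (intro continuous_intros cu)
    fix x
    have r: "a22 t x = - a11 t x" "a21 t x = w t x + a12 t x" "g2 x = - f1 x"
      using div[OF t, of x] vort[OF t, of x] fg[of x] by simp_all
    show "s1 t x * f x + s2 t x * g x = ?G x +
      (e * (w1 t x * g x + w t x * g1 x) - (q1 t x * f x + q t x * f1 x) +
         (((1 / 2) * (a11 t x * u1 t x + u1 t x * a11 t x + (a21 t x * u2 t x + u2 t x * a21 t x)) * f x + ?k x * f1 x)
          - (a11 t x * ?v x + u1 t x * ((a11 t x * f x + u1 t x * f1 x) + (a21 t x * g x + u2 t x * g1 x)))) +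
       ((- e) * (w2 t x * f x + w t x * f2 x) - (q2 t x * g x + q t x * g2 x) +
         (((1 / 2) * (a12 t x * u1 t x + u1 t x * a12 t x + (a22 t x * u2 t x + u2 t x * a22 t x)) * g x + ?k x * g2 x)
          - (a22 t x * ?v x + u2 t x * ((a12 t x * f x + u1 t x * f2 x) + (a22 t x * g x + u2 t x * g2 x))))))"
      unfolding momentum[OF t] r by (simp add: field_simps)
  qed
  have "\<bar>integral Q0 ?G\<bar> \<le> integral Q0 (\<lambda>x. 2 * B * (u1 t x * u1 t x) + 2 * B * (u2 t x * u2 t x) + 2 * B * (e * \<bar>w t x\<bar>))"
  proof -
    have pw: "\<bar>?G x\<bar> \<le> 2 * B * (u1 t x * u1 t x) + 2 * B * (u2 t x * u2 t x) + 2 * B * (e * \<bar>w t x\<bar>)" for x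
    proof -
      have B0: "B \<ge> 0" using B(1)[of x] by linarith
      let ?c = "(u1 t x * u1 t x + u2 t x * u2 t x) / 2"
      have c1: "\<bar>u1 t x * u2 t x\<bar> \<le> ?c"
        using sum_squares_bound[of "\<bar>u1 t x\<bar>" "\<bar>u2 t x\<bar>"] by (auto simp: abs_mult power2_eq_square)
      then have c2: "\<bar>u2 t x * u1 t x\<bar> \<le> ?c" by (simp add: mult.commute)
      note c = c1 c2
      have "\<bar>u1 t x * u1 t x * f1 x\<bar> \<le> (u1 t x * u1 t x) * B" "\<bar>u2 t x * u2 t x * g2 x\<bar> \<le> (u2 t x * u2 t x) * B"
        unfolding abs_mult[of _ "f1 x"] abs_mult[of _ "g2 x"] by (auto intro!: mult_mono B)
      moreover have "\<bar>u1 t x * u2 t x * g1 x\<bar> \<le> ?c * B" "\<bar>u2 t x * u1 t x * f2 x\<bar> \<le> ?c * B"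
        unfolding abs_mult[of _ "g1 x"] abs_mult[of _ "f2 x"]
        by (intro conjI mult_mono c B; simp)+
      moreover have "\<bar>e * (w t x * (f2 x - g1 x))\<bar> \<le> e * (\<bar>w t x\<bar> * (2 * B))"
        unfolding abs_mult using e_pos B(2)[of x] B(3)[of x] by (intro mult_mono) auto
      ultimately have "\<bar>?G x\<bar> \<le> (u1 t x * u1 t x) * B + ?c * B + ?c * B + (u2 t x * u2 t x) * B + e * (\<bar>w t x\<bar> * (2 * B))"
        unfolding abs_le_iff by linarith
      then show ?thesis by (simp add: algebra_simps)
    qed
    have "norm (integral Q0 ?G) \<le> integral Q0 (\<lambda>x. 2 * B * (u1 t x * u1 t x) + 2 * B * (u2 t x * u2 t x) + 2 * B * (e * \<bar>w t x\<bar>))"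
      unfolding Q0_def using pw by (intro integral_norm_bound_integral cont_int continuous_intros cu) auto
    then show ?thesis by simp
  qed
  also have "\<dots> = 2 * B * energy t + 2 * B * (e * integral Q0 (\<lambda>x. \<bar>w t x\<bar>))"
  proof -
    have "integral Q0 (\<lambda>x. 2 * B * (u1 t x * u1 t x) + 2 * B * (u2 t x * u2 t x) + 2 * B * (e * \<bar>w t x\<bar>))
      = integral Q0 (\<lambda>x. 2 * B * (u1 t x * u1 t x) + 2 * B * (u2 t x * u2 t x)) + integral Q0 (\<lambda>x. 2 * B * (e * \<bar>w t x\<bar>))"
      unfolding Q0_def by (intro Henstock_Kurzweil_Integration.integral_add cont_int continuous_intros cu)
    moreover have "integral Q0 (\<lambda>x. 2 * B * (u1 t x * u1 t x) + 2 * B * (u2 t x * u2 t x))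
      = integral Q0 (\<lambda>x. 2 * B * (u1 t x * u1 t x)) + integral Q0 (\<lambda>x. 2 * B * (u2 t x * u2 t x))"
      unfolding Q0_def by (intro Henstock_Kurzweil_Integration.integral_add cont_int continuous_intros cu)
    ultimately show ?thesis
      by (simp only: Henstock_Kurzweil_Integration.integral_mult_right energy_def corr_00 distrib_left)
  qed
  finally show ?thesis unfolding FG .
qed

text \<open>Weighted form of 2ab <= a^2 + b^2. The weight sqrt t balances the constant term against
  \<open>enstrophy_decay\<close>, and the resulting singularity at 0 is integrable.\<close>

lemma vorticity_L1_bound:
  assumes E0: "\<And>t. t \<in> {0<..<T} \<Longrightarrow> energy t \<le> E0" and t: "t \<in> {0<..<T}" and e1: "e \<le> 1"
  shows "e * integral Q0 (\<lambda>x. \<bar>w t x\<bar>) \<le> (2 * pi\<^sup>2 + E0) / sqrt t"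
proof -
  note cw = has_partialsD(3)[OF w[OF t]]
  define z where "z = sqrt t"
  have z: "z > 0" "t = z * z" using t by (auto simp: z_def)
  have pw: "e * \<bar>w t x\<bar> \<le> (1 / z) / 2 + (e * (e * z) / 2) * (w t x * w t x)" for x
  proof -
    have "2 * (e * z * \<bar>w t x\<bar>) \<le> 1 + (e * z * \<bar>w t x\<bar>) * (e * z * \<bar>w t x\<bar>)"
      using sum_squares_bound[of 1 "e * z * \<bar>w t x\<bar>"] by (simp add: power2_eq_square)
    also have "(e * z * \<bar>w t x\<bar>) * (e * z * \<bar>w t x\<bar>) = e * e * z * z * (w t x * w t x)"
      by (simp add: mult_ac flip: abs_mult)
    finally have "z * (2 * (e * \<bar>w t x\<bar>)) \<le> z * (1 / z + e * e * z * (w t x * w t x))"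
      using z by (simp add: algebra_simps)
    then show ?thesis using z by simp
  qed
  have "integral Q0 (\<lambda>x. e * \<bar>w t x\<bar>) \<le> integral Q0 (\<lambda>x. (1 / z) / 2 + (e * (e * z) / 2) * (w t x * w t x))"
    unfolding Q0_def by (intro integral_le pw cont_int continuous_intros cw)
  also have "\<dots> = 4 * pi\<^sup>2 * ((1 / z) / 2) + (e * (e * z) / 2) * enstrophy t"
    unfolding enstrophy_def corr_00 integral_const_Q0[symmetric] Q0_def
    by (subst Henstock_Kurzweil_Integration.integral_add, (intro cont_int continuous_intros cw)+) simp
  also have "(e * (e * z) / 2) * enstrophy t \<le> E0 / z"
  proof -
    have e2: "2 * e * (z * z) * enstrophy t \<le> E0" using enstrophy_decay[OF E0 t] z by simp
    have en0: "e * (z * z) * enstrophy t \<ge> 0" using e_pos enstrophy_nonneg[OF t] by simp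
    have "e * (e * (z * z) * enstrophy t) \<le> 1 * (e * (z * z) * enstrophy t)"
      using e1 en0 by (intro mult_right_mono) auto
    then have "z * ((e * (e * z) / 2) * enstrophy t) \<le> E0" using e2 en0 by (simp add: algebra_simps)
    then show ?thesis using z by (simp add: field_simps)
  qed
  finally show ?thesis unfolding z_def[symmetric] by (simp add: add_divide_distrib)
qed

text \<open>Pairing the increment with its own mollification returns its squared norm up to the
  variation, while the gradient of that test field is bounded in terms of \<open>r\<close> and
  \<open>E0\<close>. The drift between the two times is then controlled by the dual
  estimate.\<close>

lemma time_equicontinuity:
  assumes E0: "\<And>t. t \<in> {0<..<T} \<Longrightarrow> energy t \<le> E0" and e1: "e \<le> 1" and r: "0 < r" "r \<le> pi"
    and V: "\<And>t. t \<in> {0<..<T} \<Longrightarrow> variation (u1 t) r + variation (u2 t) r \<le> V"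
    and st: "0 < s" "s < t" "t < T"
  shows "corr (\<lambda>x. u1 t x - u1 s x) (\<lambda>x. u1 t x - u1 s x) 0 + corr (\<lambda>x. u2 t x - u2 s x) (\<lambda>x. u2 t x - u2 s x) 0
    \<le> 2 * V / kmass + 2 * (24 / (kmass * r ^ 3) * (2 * pi\<^sup>2 + 2 * E0)) * (2 * pi\<^sup>2 + E0) * ((t - s) + 2 * sqrt (t - s))"
proof -
  have T: "t \<in> {0<..<T}" "s \<in> {0<..<T}" using st by auto
  define v1 where "v1 = (\<lambda>x. u1 t x - u1 s x)"
  define v2 where "v2 = (\<lambda>x. u2 t x - u2 s x)"
  define B where "B = 24 / (kmass * r ^ 3) * (2 * pi\<^sup>2 + 2 * E0)"
  define C where "C = 2 * B * (2 * pi\<^sup>2 + E0)"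
  have E0n: "E0 \<ge> 0" using E0[OF T(1)] energy_nonneg[OF T(1)] by linarith
  have B0: "B \<ge> 0" using kmass_pos r E0n by (simp add: B_def)
  have C0: "C \<ge> 0" using B0 E0n by (simp add: C_def)
  have p1: "has_partials v1 (\<lambda>x. a11 t x - a11 s x) (\<lambda>x. a12 t x - a12 s x)" "periodic2 v1"
    and p2: "has_partials v2 (\<lambda>x. a21 t x - a21 s x) (\<lambda>x. a22 t x - a22 s x)" "periodic2 v2"
    unfolding v1_def v2_def by (intro has_partials_diff periodic2_diff u1 u2 per T)+
  note cu = has_partialsD(3)[OF u1[OF T(1)]] has_partialsD(3)[OF u1[OF T(2)]] has_partialsD(3)[OF u2[OF T(1)]] has_partialsD(3)[OF u2[OF T(2)]]
  note cv = has_partialsD(3)[OF p1(1)] has_partialsD(3)[OF p2(1)]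
  have nn: "corr v1 v1 0 \<ge> 0" "corr v2 v2 0 \<ge> 0" "corr (u1 t) (u1 t) 0 \<ge> 0" "corr (u2 t) (u2 t) 0 \<ge> 0"
     "corr (u1 s) (u1 s) 0 \<ge> 0" "corr (u2 s) (u2 s) 0 \<ge> 0"
    by (intro corr_self_nonneg cv cu)+
  have v_le: "corr v1 v1 0 \<le> 4 * E0" "corr v2 v2 0 \<le> 4 * E0"
    using corr_diff_self_le[OF cu(1) cu(2)] corr_diff_self_le[OF cu(3) cu(4)] E0[OF T(1)] E0[OF T(2)] nn
    unfolding v1_def v2_def energy_def by linarith+
  have L1: "integral Q0 (\<lambda>x. \<bar>v1 x\<bar>) \<le> 2 * pi\<^sup>2 + 2 * E0" "integral Q0 (\<lambda>x. \<bar>v2 x\<bar>) \<le> 2 * pi\<^sup>2 + 2 * E0"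
    using integral_abs_le[OF cv(1)] integral_abs_le[OF cv(2)] v_le by linarith+
  have BB: "24 / (kmass * r ^ 3) * X \<le> B" if "X \<le> 2 * pi\<^sup>2 + 2 * E0" for X
    unfolding B_def using kmass_pos r that by (intro mult_left_mono) auto
  note b1 = mollify_partials_le[OF p1 r, THEN order_trans, OF BB[OF L1(1)]]
    and b2 = mollify_partials_le[OF p2 r, THEN order_trans, OF BB[OF L1(2)]]
  note m1 = has_partials_mollify[OF p1(1), of r] and m2 = has_partials_mollify[OF p2(1), of r]
  have divm: "mollify r (\<lambda>x. a11 t x - a11 s x) x + mollify r (\<lambda>x. a22 t x - a22 s x) x = 0" for x
  proof -
    define h where "h = (\<lambda>x. a11 t x - a11 s x)"
    have "(\<lambda>x. a22 t x - a22 s x) = (\<lambda>x. - h x)"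
      using div[OF T(1)] div[OF T(2)] unfolding h_def by (intro ext) (smt (verit))
    then show ?thesis unfolding h_def[symmetric] by (simp add: mollify_def)
  qed
  \<comment> \<open>The test field stays frozen while time runs from \<open>s\<close> to
    \<open>t\<close>. \<open>H\<close> is the primitive of the bound C (1 + 1 / sqrt t), finite at
    0.\<close>
  define G where "G = (\<lambda>t. integral Q0 (\<lambda>x. u1 t x * mollify r v1 x + u2 t x * mollify r v2 x))"
  define H where "H = (\<lambda>t. C * (t + 2 * sqrt t))"
  have G: "(G has_real_derivative integral Q0 (\<lambda>x. s1 \<tau> x * mollify r v1 x + s2 \<tau> x * mollify r v2 x)) (at \<tau>)"
    if "\<tau> \<in> {0<..<T}" for \<tau>
    unfolding G_def by (rule velocity_pairing_DERIV[OF that mollify_continuous[OF cv(1)] mollify_continuous[OF cv(2)]])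
  have G': "integral Q0 (\<lambda>x. s1 \<tau> x * mollify r v1 x + s2 \<tau> x * mollify r v2 x) \<le> C * (1 + 1 / sqrt \<tau>)"
    if \<tau>: "\<tau> \<in> {0<..<T}" for \<tau>
  proof -
    have "\<bar>integral Q0 (\<lambda>x. s1 \<tau> x * mollify r v1 x + s2 \<tau> x * mollify r v2 x)\<bar>
       \<le> 2 * B * energy \<tau> + 2 * B * (e * integral Q0 (\<lambda>x. \<bar>w \<tau> x\<bar>))"
      by (rule pairing_derivative_bound[OF \<tau> m1 periodic2_mollify[OF p1(2)] m2 periodic2_mollify[OF p2(2)] divm b1 b2])
    also have "\<dots> \<le> 2 * B * (2 * pi\<^sup>2 + E0) + 2 * B * ((2 * pi\<^sup>2 + E0) / sqrt \<tau>)"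
    proof (intro add_mono mult_left_mono)
      show "energy \<tau> \<le> 2 * pi\<^sup>2 + E0" using E0[OF \<tau>] zero_le_power2[of pi] by linarith
    qed (use B0 vorticity_L1_bound[OF E0 \<tau> e1] in auto)
    also have "\<dots> = C * (1 + 1 / sqrt \<tau>)" by (simp add: C_def algebra_simps add_divide_distrib)
    finally show ?thesis by simp
  qed
  have "G t - G s \<le> H t - H s"
  proof -
    have H: "(H has_real_derivative C * (1 + 1 / sqrt \<tau>)) (at \<tau>)" if "\<tau> \<in> {0<..<T}" for \<tau>
      unfolding H_def using that by (auto intro!: derivative_eq_intros simp: field_simps)
    then have "\<exists>y. ((\<lambda>\<tau>. H \<tau> - G \<tau>) has_real_derivative y) (at x) \<and> y \<ge> 0" if sx: "s \<le> x" "x \<le> t" for x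
    proof -
      have x: "x \<in> {0<..<T}" using sx st by auto
      show ?thesis using DERIV_diff[OF H[OF x] G[OF x]] G'[OF x] by (meson diff_ge_0_iff_ge)
    qed
    then have "H s - G s \<le> H t - G t"
      using DERIV_nonneg_imp_nondecreasing[of s t "\<lambda>\<tau>. H \<tau> - G \<tau>"] st by auto
    then show ?thesis by simp
  qed
  also have "H t - H s = C * ((t - s) + 2 * (sqrt t - sqrt s))" by (simp add: H_def algebra_simps)
  \<comment> \<open>Subadditivity of the square root makes the modulus depend on
    \<open>t - s\<close> alone, uniformly as \<open>s\<close> tends to 0.\<close>
  also have "\<dots> \<le> C * ((t - s) + 2 * sqrt (t - s))"
  proof -
    have "sqrt t \<le> sqrt s + sqrt (t - s)" using sqrt_add_le_add_sqrt[of s "t - s"] st by simp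
    then show ?thesis using C0 by (intro mult_left_mono) auto
  qed
  finally have GG: "G t - G s \<le> C * ((t - s) + 2 * sqrt (t - s))" .
  have "G t - G s = integral Q0 (\<lambda>x. v1 x * mollify r v1 x) + integral Q0 (\<lambda>x. v2 x * mollify r v2 x)"
  proof -
    have "G t - G s = integral Q0 (\<lambda>x. (u1 t x * mollify r v1 x + u2 t x * mollify r v2 x) - (u1 s x * mollify r v1 x + u2 s x * mollify r v2 x))"
      unfolding G_def Q0_def
      by (intro Henstock_Kurzweil_Integration.integral_diff[symmetric] cont_int continuous_intros cu mollify_continuous cv)
    also have "\<dots> = integral Q0 (\<lambda>x. v1 x * mollify r v1 x + v2 x * mollify r v2 x)"
      by (intro arg_cong[where f="integral Q0"] ext) (simp add: v1_def v2_def algebra_simps)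
    also have "\<dots> = integral Q0 (\<lambda>x. v1 x * mollify r v1 x) + integral Q0 (\<lambda>x. v2 x * mollify r v2 x)"
      unfolding Q0_def by (intro Henstock_Kurzweil_Integration.integral_add cont_int continuous_intros mollify_continuous cv)
    finally show ?thesis .
  qed
  then have K: "kmass * (G t - G s) = kavg (corr v1 v1) r + kavg (corr v2 v2) r"
    using integral_mult_mollify[OF cv(1) cv(1)] integral_mult_mollify[OF cv(2) cv(2)] by (simp add: distrib_left)
  \<comment> \<open>The factor 2 of \<open>variation_diff_le\<close> for each of the two times; half
    of the result enters below, as \<open>variation\<close> is twice the deficit.\<close>
  have "variation v1 r + variation v2 r \<le> 4 * V"
    using variation_diff_le[OF cu(1) per(1)[OF T(1)] cu(2) per(1)[OF T(2)], of r]
      variation_diff_le[OF cu(3) per(2)[OF T(1)] cu(4) per(2)[OF T(2)], of r] V[OF T(1)] V[OF T(2)]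
    unfolding v1_def v2_def by linarith
  then have "kmass * (corr v1 v1 0 + corr v2 v2 0) \<le> kmass * (G t - G s) + 2 * V"
    unfolding K variation_def by (simp add: distrib_left)
  also have "\<dots> \<le> kmass * (C * ((t - s) + 2 * sqrt (t - s))) + 2 * V"
    using GG kmass_pos by simp
  finally have "corr v1 v1 0 + corr v2 v2 0 \<le> 2 * V / kmass + C * ((t - s) + 2 * sqrt (t - s))"
    using kmass_pos by (simp add: field_simps)
  then show ?thesis unfolding v1_def v2_def C_def B_def .
qed

end

section \<open>Square-integrable fields\<close>

text \<open>\<open>L2_field\<close> without periodicity, since test fields include indicators of
  single squares.\<close>

definition sq_int :: "(pt \<Rightarrow> real \<times> real) \<Rightarrow> bool" where
  "sq_int v \<longleftrightarrow> v \<in> borel_measurable lborel \<and> set_integrable lborel Q0 (\<lambda>x. (norm (v x))\<^sup>2)"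

definition ip :: "(pt \<Rightarrow> real \<times> real) \<Rightarrow> (pt \<Rightarrow> real \<times> real) \<Rightarrow> real" where
  "ip v g = (LINT x:Q0|lborel. inner (v x) (g x))"

lemma Q0_sets [measurable]: "Q0 \<in> sets borel" by (simp add: Q0_def)

lemma set_integral_nonneg_all: "(\<And>x. 0 \<le> f x) \<Longrightarrow> 0 \<le> (LINT x:A|M. f x :: real)"
  unfolding set_lebesgue_integral_def by (rule integral_nonneg_AE) auto

lemma L2_field_sq_int: "L2_field v \<Longrightarrow> sq_int v"
  by (simp add: L2_field_def sq_int_def)

lemma set_integrable_Q0_bound:
  fixes f :: "pt \<Rightarrow> 'a::{banach, second_countable_topology}" and h :: "pt \<Rightarrow> real"
  assumes "set_integrable lborel Q0 h" "f \<in> borel_measurable lborel" "\<And>x. norm (f x) \<le> h x"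
  shows "set_integrable lborel Q0 f"
proof (rule set_integrable_bound[OF assms(1)])
  show "set_borel_measurable lborel Q0 f"
    unfolding set_borel_measurable_def using assms(2) by measurable
  show "AE x in lborel. x \<in> Q0 \<longrightarrow> norm (f x) \<le> norm (h x)"
    using assms(3) by (intro AE_I2 impI) (metis abs_ge_self order_trans real_norm_def)
qed

lemma sq_int_inner:
  assumes "sq_int v" "sq_int g" shows "set_integrable lborel Q0 (\<lambda>x. inner (v x) (g x))"
proof (rule set_integrable_Q0_bound[of "\<lambda>x. (norm (v x))\<^sup>2 + (norm (g x))\<^sup>2"])
  show "set_integrable lborel Q0 (\<lambda>x. (norm (v x))\<^sup>2 + (norm (g x))\<^sup>2)"
    using assms by (intro set_integral_add) (auto simp: sq_int_def)
  have [measurable]: "v \<in> borel_measurable lborel" "g \<in> borel_measurable lborel" using assms by (auto simp: sq_int_def)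
  show "(\<lambda>x. inner (v x) (g x)) \<in> borel_measurable lborel" by measurable
  fix x
  have "2 * (norm (v x) * norm (g x)) \<le> (norm (v x))\<^sup>2 + (norm (g x))\<^sup>2"
    using sum_squares_bound[of "norm (v x)" "norm (g x)"] by (simp add: mult.assoc)
  moreover have "0 \<le> norm (v x) * norm (g x)" by simp
  ultimately show "norm (inner (v x) (g x)) \<le> (norm (v x))\<^sup>2 + (norm (g x))\<^sup>2"
    using Cauchy_Schwarz_ineq2[of "v x" "g x"] by (simp only: real_norm_def)
qed

lemma sq_int_diff:
  assumes "sq_int v" "sq_int g" shows "sq_int (\<lambda>x. v x - g x)"
  unfolding sq_int_def
proof
  have [measurable]: "v \<in> borel_measurable lborel" "g \<in> borel_measurable lborel" using assms by (auto simp: sq_int_def)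
  show "(\<lambda>x. v x - g x) \<in> borel_measurable lborel" by measurable
  show "set_integrable lborel Q0 (\<lambda>x. (norm (v x - g x))\<^sup>2)"
  proof (rule set_integrable_Q0_bound[of "\<lambda>x. 2 * (norm (v x))\<^sup>2 + 2 * (norm (g x))\<^sup>2"])
    show "set_integrable lborel Q0 (\<lambda>x. 2 * (norm (v x))\<^sup>2 + 2 * (norm (g x))\<^sup>2)"
      using assms by (intro set_integral_add set_integrable_mult_right) (auto simp: sq_int_def)
    fix x
    have "(norm (v x - g x))\<^sup>2 \<le> (norm (v x) + norm (g x))\<^sup>2"
      by (intro power_mono norm_triangle_ineq4) auto
    also have "\<dots> \<le> 2 * (norm (v x))\<^sup>2 + 2 * (norm (g x))\<^sup>2"
      using sum_squares_bound[of "norm (v x)" "norm (g x)"] by (simp add: power2_sum)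
    finally show "norm ((norm (v x - g x))\<^sup>2) \<le> 2 * (norm (v x))\<^sup>2 + 2 * (norm (g x))\<^sup>2" by simp
  qed measurable
qed

lemma L2norm_sq: "(L2norm v)\<^sup>2 = ip v v"
proof -
  have "(LINT x:Q0|lborel. (norm (v x))\<^sup>2) \<ge> 0" by (rule set_integral_nonneg_all) auto
  then show ?thesis by (simp add: L2norm_def ip_def power2_norm_eq_inner)
qed

lemma L2norm_nonneg: "L2norm v \<ge> 0"
proof -
  have "(LINT x:Q0|lborel. (norm (v x))\<^sup>2) \<ge> 0" by (rule set_integral_nonneg_all) auto
  then show ?thesis by (simp add: L2norm_def)
qed

lemma ip_diff:
  assumes "sq_int v" "sq_int w" "sq_int g"
  shows "ip (\<lambda>x. v x - w x) g = ip v g - ip w g" "ip g (\<lambda>x. v x - w x) = ip g v - ip g w"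
  unfolding ip_def inner_diff_left inner_diff_right
  by (intro set_integral_diff sq_int_inner assms)+

text \<open>Cauchy-Schwarz from the nonnegative quadratic |a v - g|^2 in \<open>a\<close>. If
  \<open>ip v v = 0\<close>, the inequality is linear in \<open>a\<close> and forces
  \<open>ip v g = 0\<close>; the chosen \<open>a\<close> would violate it otherwise.\<close>

lemma ip_le:
  assumes "sq_int v" "sq_int g"
  shows "\<bar>ip v g\<bar> \<le> L2norm v * L2norm g"
proof -
  have quad: "2 * a * ip v g \<le> a\<^sup>2 * ip v v + ip g g" for a
  proof -
    have "0 \<le> (LINT x:Q0|lborel. a\<^sup>2 * inner (v x) (v x) + (inner (g x) (g x) - 2 * a * inner (v x) (g x)))"
    proof (rule set_integral_nonneg_all)
      fix x
      have "0 \<le> inner (a *\<^sub>R v x - g x) (a *\<^sub>R v x - g x)" by simp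
      also have "\<dots> = a\<^sup>2 * inner (v x) (v x) + (inner (g x) (g x) - 2 * a * inner (v x) (g x))"
        by (simp add: inner_diff_left inner_diff_right power2_eq_square inner_commute algebra_simps)
      finally show "0 \<le> \<dots>" .
    qed
    also have "\<dots> = a\<^sup>2 * ip v v + (ip g g - 2 * a * ip v g)"
    proof -
      note si = set_integrable_mult_right[OF sq_int_inner[OF assms(1) assms(1)], of "a\<^sup>2"]
        set_integrable_mult_right[OF sq_int_inner[OF assms], of "2 * a"] sq_int_inner[OF assms(2) assms(2)]
      show ?thesis
        using set_integral_add(2)[OF si(1) set_integral_diff(1)[OF si(3,2)]] set_integral_diff(2)[OF si(3,2)]
        by (simp add: ip_def)
    qed
    finally show ?thesis by simp
  qed
  have nn: "ip v v \<ge> 0" "ip g g \<ge> 0" by (simp_all flip: L2norm_sq)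
  have "(ip v g)\<^sup>2 \<le> ip v v * ip g g"
  proof (cases "ip v v = 0")
    case True
    have "ip v g = 0"
    proof (rule ccontr)
      assume ne: "ip v g \<noteq> 0"
      have "2 * ((ip g g + 1) / ip v g) * ip v g \<le> ip g g" using quad[of "(ip g g + 1) / ip v g"] True by simp
      then show False using ne nn by simp
    qed
    then show ?thesis using nn by simp
  next
    case False
    then have p: "ip v v > 0" using nn by simp
    have "2 * (ip v g / ip v v) * ip v g \<le> (ip v g / ip v v)\<^sup>2 * ip v v + ip g g" by (rule quad)
    then show ?thesis using p by (simp add: field_simps power2_eq_square)
  qed
  then have "(\<bar>ip v g\<bar>)\<^sup>2 \<le> (L2norm v * L2norm g)\<^sup>2"
    by (simp add: power_mult_distrib L2norm_sq)
  then show ?thesis by (rule power2_le_imp_le) (simp add: L2norm_nonneg)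
qed

lemma L2norm_triangle:
  assumes "sq_int v" "sq_int g"
  shows "L2norm v \<le> L2norm g + L2norm (\<lambda>x. v x - g x)"
proof -
  have "L2norm v * L2norm v = ip v g + ip v (\<lambda>x. v x - g x)"
    using ip_diff(2)[OF assms(1,2) assms(1)] by (simp flip: L2norm_sq power2_eq_square)
  also have "\<dots> \<le> L2norm v * L2norm g + L2norm v * L2norm (\<lambda>x. v x - g x)"
    using ip_le[OF assms] ip_le[OF assms(1) sq_int_diff[OF assms]] by linarith
  finally have le: "L2norm v * L2norm v \<le> L2norm v * (L2norm g + L2norm (\<lambda>x. v x - g x))" by (simp add: distrib_left)
  show ?thesis
  proof (cases "L2norm v = 0")
    case False
    then have "L2norm v > 0" using L2norm_nonneg[of v] by simp
    then show ?thesis using le by (simp only: mult_le_cancel_left_pos)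
  qed (use L2norm_nonneg in \<open>auto simp: add_nonneg_nonneg\<close>)
qed

lemma L2norm_minus_commute: "L2norm (\<lambda>x. v x - g x) = L2norm (\<lambda>x. g x - v x)"
  by (simp add: L2norm_def norm_minus_commute)

lemma L2norm_diff_triangle:
  assumes "sq_int v" "sq_int g" "sq_int h"
  shows "L2norm (\<lambda>x. v x - h x) \<le> L2norm (\<lambda>x. v x - g x) + L2norm (\<lambda>x. g x - h x)"
  using L2norm_triangle[OF sq_int_diff[OF assms(1,3)] sq_int_diff[OF assms(1,2)]] by simp

lemma L2norm_abs_diff:
  assumes "sq_int v" "sq_int g"
  shows "\<bar>L2norm v - L2norm g\<bar> \<le> L2norm (\<lambda>x. v x - g x)"
  using L2norm_triangle[OF assms] L2norm_triangle[OF assms(2,1)] L2norm_minus_commute[of v g] by linarith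

lemma L2norm_continuous_field:
  assumes "continuous_on UNIV f" "continuous_on UNIV g" "\<And>x. v x = (f x, g x)"
  shows "(L2norm v)\<^sup>2 = corr f f 0 + corr g g 0"
proof -
  have c: "continuous_on UNIV (\<lambda>x. f x * f x + g x * g x)" by (intro continuous_intros assms)
  have si: "set_integrable lborel Q0 (\<lambda>x. f x * f x + g x * g x)"
    unfolding Q0_def set_integrable_def
    by (rule borel_integrable_compact) (auto intro!: continuous_on_subset[OF c])
  have "(L2norm v)\<^sup>2 = (LINT x:Q0|lborel. f x * f x + g x * g x)"
    unfolding L2norm_sq ip_def assms(3) by simp
  also have "\<dots> = integral Q0 (\<lambda>x. f x * f x + g x * g x)"
    by (rule set_borel_integral_eq_integral(2)[OF si])
  also have "\<dots> = corr f f 0 + corr g g 0"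
    unfolding corr_00 Q0_def
    by (intro Henstock_Kurzweil_Integration.integral_add cont_int continuous_intros assms)
  finally show ?thesis .
qed

lemma CL2_sq_int: "CL2 T v \<Longrightarrow> t \<in> {0..T} \<Longrightarrow> sq_int (v t)"
  by (auto simp: CL2_def L2_field_sq_int)

lemma CL2_L2norm_tendsto:
  assumes "CL2 T v" "t \<in> {0..T}"
  shows "((\<lambda>s. L2norm (v s)) \<longlongrightarrow> L2norm (v t)) (at t within {0..T})"
proof -
  have lim: "((\<lambda>s. L2norm (\<lambda>x. v s x - v t x)) \<longlongrightarrow> 0) (at t within {0..T})"
    using assms by (auto simp: CL2_def)
  have "((\<lambda>s. L2norm (v s) - L2norm (v t)) \<longlongrightarrow> 0) (at t within {0..T})"
  proof (rule Lim_null_comparison[OF _ lim])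
    show "\<forall>\<^sub>F s in at t within {0..T}. norm (L2norm (v s) - L2norm (v t)) \<le> L2norm (\<lambda>x. v s x - v t x)"
      using L2norm_abs_diff CL2_sq_int[OF assms(1)] assms(2) by (auto simp: eventually_at_filter)
  qed
  then show ?thesis by (simp add: LIM_zero_iff)
qed

lemma CL2_ip_continuous:
  assumes "CL2 T v" "sq_int g"
  shows "continuous_on {0..T} (\<lambda>s. ip (v s) g)"
  unfolding continuous_on_def
proof
  fix t assume t: "t \<in> {0..T}"
  have lim: "((\<lambda>s. L2norm (\<lambda>x. v s x - v t x)) \<longlongrightarrow> 0) (at t within {0..T})"
    using assms t by (auto simp: CL2_def)
  have lim': "((\<lambda>s. L2norm (\<lambda>x. v s x - v t x) * L2norm g) \<longlongrightarrow> 0) (at t within {0..T})"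
    using tendsto_mult_left_zero[OF lim] .
  have "((\<lambda>s. ip (v s) g - ip (v t) g) \<longlongrightarrow> 0) (at t within {0..T})"
  proof (rule Lim_null_comparison[OF _ lim'])
    have "norm (ip (v s) g - ip (v t) g) \<le> L2norm (\<lambda>x. v s x - v t x) * L2norm g" if s: "s \<in> {0..T}" for s
      using ip_le[OF sq_int_diff[OF CL2_sq_int[OF assms(1) s] CL2_sq_int[OF assms(1) t]] assms(2)]
        ip_diff(1)[OF CL2_sq_int[OF assms(1) s] CL2_sq_int[OF assms(1) t] assms(2)] by simp
    then show "\<forall>\<^sub>F s in at t within {0..T}. norm (ip (v s) g - ip (v t) g) \<le> L2norm (\<lambda>x. v s x - v t x) * L2norm g"
      by (auto simp: eventually_at_filter)
  qed
  then show "((\<lambda>s. ip (v s) g) \<longlongrightarrow> ip (v t) g) (at t within {0..T})" by (simp add: LIM_zero_iff)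
qed

section \<open>Weak convergence at a fixed time\<close>

definition slab :: "real \<Rightarrow> real \<Rightarrow> (pt \<Rightarrow> real \<times> real) \<Rightarrow> real \<Rightarrow> pt \<Rightarrow> real \<times> real" where
  "slab a b g t x = indicator {a..b} t *\<^sub>R g x"

lemma pairing_slab:
  assumes "CL2 T v" "sq_int g" "0 \<le> a" "a \<le> b" "b \<le> T"
  shows "pairing T v (slab a b g) = integral {a..b} (\<lambda>s. ip (v s) g)"
proof -
  have ab: "{a..b} \<subseteq> {0..T}" using assms by auto
  have inner: "(LINT x:Q0|lborel. inner (v t x) (slab a b g t x)) = indicator {a..b} t *\<^sub>R ip (v t) g" for t
    unfolding slab_def ip_def by simp
  have si: "set_integrable lborel {a..b} (\<lambda>t. ip (v t) g)"
    unfolding set_integrable_def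
    by (rule borel_integrable_compact) (auto intro: continuous_on_subset[OF CL2_ip_continuous[OF assms(1,2)] ab])
  have "pairing T v (slab a b g) = (LINT t:{0..T}|lborel. indicator {a..b} t *\<^sub>R ip (v t) g)"
    by (simp only: pairing_def inner)
  also have "\<dots> = (LINT t:{a..b}|lborel. ip (v t) g)"
    unfolding set_lebesgue_integral_def
    by (intro Bochner_Integration.integral_cong refl) (use ab in \<open>auto split: split_indicator\<close>)
  also have "\<dots> = integral {a..b} (\<lambda>s. ip (v s) g)" by (rule set_borel_integral_eq_integral(2)[OF si])
  finally show ?thesis .
qed

lemma L2norm_slab: "L2norm (slab a b g t) = indicator {a..b} t * L2norm g"
  by (auto simp: slab_def L2norm_def split: split_indicator)

lemma L1L2_slab:
  assumes "sq_int g" shows "L1L2 T (slab a b g)"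
  unfolding L1L2_def
proof (intro conjI)
  have [measurable]: "g \<in> borel_measurable borel" using assms by (simp add: sq_int_def)
  show "(\<lambda>(t, x). slab a b g t x) \<in> borel_measurable lborel"
  proof -
    have f: "fst \<in> borel_measurable (borel :: (real \<times> pt) measure)" and s: "snd \<in> borel_measurable (borel :: (real \<times> pt) measure)"
      by (intro borel_measurable_continuous_onI continuous_intros)+
    have i: "(indicator {a..b} :: real \<Rightarrow> real) \<in> borel_measurable borel" by measurable
    have "(\<lambda>p :: real \<times> pt. indicat_real {a..b} (fst p) *\<^sub>R g (snd p)) \<in> borel_measurable borel"
      by (intro borel_measurable_scaleR measurable_compose[OF f i] measurable_compose[OF s \<open>g \<in> borel_measurable borel\<close>])
    then show ?thesis by (simp add: slab_def case_prod_beta)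
  qed
  show "AE t in lborel. t \<in> {0..T} \<longrightarrow> set_integrable lborel Q0 (\<lambda>x. (norm (slab a b g t x))\<^sup>2)"
  proof (intro AE_I2 impI)
    fix t
    have "set_integrable lborel Q0 (\<lambda>x. (indicator {a..b} t)\<^sup>2 * (norm (g x))\<^sup>2)"
      using assms by (intro set_integrable_mult_right) (auto simp: sq_int_def)
    then show "set_integrable lborel Q0 (\<lambda>x. (norm (slab a b g t x))\<^sup>2)"
      by (simp add: slab_def power_mult_distrib)
  qed
  have "set_integrable lborel {0..T} (\<lambda>t. L2norm g * indicator {a..b} t)"
  proof -
    have "emeasure lborel ({0..T} \<inter> {a..b}) < \<infinity>" by (simp add: emeasure_lborel_Icc_eq)
    then have "integrable lborel (\<lambda>t. L2norm g * indicat_real ({0..T} \<inter> {a..b}) t)"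
      by (intro integrable_mult_right integrable_real_indicator) auto
    moreover have "(\<lambda>t. L2norm g * indicat_real ({0..T} \<inter> {a..b}) t) = (\<lambda>t. indicator {0..T} t *\<^sub>R (L2norm g * indicator {a..b} t))"
      by (auto split: split_indicator)
    ultimately show ?thesis unfolding set_integrable_def by (simp only:)
  qed
  then show "set_integrable lborel {0..T} (\<lambda>t. L2norm (slab a b g t))"
    by (simp add: L2norm_slab mult.commute)
qed

lemma slab_average_close:
  assumes v: "CL2 T v" and g: "sq_int g" and a: "0 \<le> a" "0 < h" "a + h \<le> T"
    and close: "\<And>s. s \<in> {a..a + h} \<Longrightarrow> L2norm (\<lambda>x. v s x - v a x) \<le> \<eta>"
  shows "\<bar>integral {a..a + h} (\<lambda>s. ip (v s) g) - h * ip (v a) g\<bar> \<le> \<eta> * L2norm g * h"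
proof -
  have sub: "{a..a + h} \<subseteq> {0..T}" using a by auto
  have c: "continuous_on {a..a + h} (\<lambda>s. ip (v s) g)"
    by (rule continuous_on_subset[OF CL2_ip_continuous[OF v g] sub])
  have sq: "sq_int (v s)" if "s \<in> {a..a + h}" for s using CL2_sq_int[OF v] that sub by auto
  have "norm (integral {a..a + h} (\<lambda>s. ip (v s) g - ip (v a) g)) \<le> \<eta> * L2norm g * (a + h - a)"
  proof (rule integral_bound)
    show "continuous_on {a..a + h} (\<lambda>s. ip (v s) g - ip (v a) g)" by (intro continuous_intros c)
    fix s assume s: "s \<in> {a..a + h}"
    have aa: "a \<in> {a..a + h}" using a by auto
    have "norm (ip (v s) g - ip (v a) g) \<le> L2norm (\<lambda>x. v s x - v a x) * L2norm g"
      using ip_le[OF sq_int_diff[OF sq[OF s] sq[OF aa]] g] ip_diff(1)[OF sq[OF s] sq[OF aa] g] by simp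
    also have "\<dots> \<le> \<eta> * L2norm g" by (intro mult_right_mono close s L2norm_nonneg)
    finally show "norm (ip (v s) g - ip (v a) g) \<le> \<eta> * L2norm g" .
  qed (use a in auto)
  moreover have "integral {a..a + h} (\<lambda>s. ip (v s) g - ip (v a) g) = integral {a..a + h} (\<lambda>s. ip (v s) g) - h * ip (v a) g"
    using a by (subst Henstock_Kurzweil_Integration.integral_diff) (auto intro!: integrable_continuous_interval c)
  ultimately show ?thesis by simp
qed

text \<open>Weak-* convergence controls only time averages, here over a window [t, t + h] through
  the test field \<open>slab\<close>. Equicontinuity uniform in small \<open>eps\<close>, and
  continuity of the limit, replace both averages by the values at \<open>t\<close>. The window opens
  to the right so that \<open>t = 0\<close> is included.\<close>

lemma weak_convergence_at:
  assumes conv: "weak_star_conv T ue u" and u: "CL2 T u" and ue: "\<And>eps. eps > 0 \<Longrightarrow> CL2 T (ue eps)"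
    and t: "0 \<le> t" "t < T" and g: "sq_int g"
    and equi: "\<And>\<eta>. \<eta> > 0 \<Longrightarrow> \<exists>\<delta>>0. \<forall>\<^sub>F eps in at_right 0. \<forall>s. t \<le> s \<and> s < t + \<delta> \<and> s < T \<longrightarrow>
        L2norm (\<lambda>x. ue eps s x - ue eps t x) \<le> \<eta>"
  shows "((\<lambda>eps. ip (ue eps t) g) \<longlongrightarrow> ip (u t) g) (at_right 0)"
proof (rule tendstoI)
  fix \<kappa> :: real assume \<kappa>: "\<kappa> > 0"
  \<comment> \<open>One third of \<open>\<kappa>\<close> for each of the two replacements and one
    for the limit of the averages; the added 1 covers a test field of norm 0.\<close>
  define \<eta> where "\<eta> = \<kappa> / (3 * (L2norm g + 1))"
  have gp: "L2norm g + 1 > 0" using L2norm_nonneg[of g] by simp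
  have \<eta>: "\<eta> > 0" using \<kappa> gp by (simp add: \<eta>_def)
  have \<eta>g: "\<eta> * L2norm g \<le> \<kappa> / 3"
  proof -
    have "\<eta> * L2norm g \<le> \<eta> * (L2norm g + 1)" using \<eta> by simp
    also have "\<dots> = \<kappa> / 3"
    proof -
      have "\<kappa> / (3 * y) * y = \<kappa> / 3" if "y > 0" for y using that by simp
      from this[OF gp] show ?thesis unfolding \<eta>_def .
    qed
    finally show ?thesis .
  qed
  obtain \<delta>1 where \<delta>1: "\<delta>1 > 0" and ev1: "\<forall>\<^sub>F eps in at_right 0. \<forall>s. t \<le> s \<and> s < t + \<delta>1 \<and> s < T \<longrightarrow>
        L2norm (\<lambda>x. ue eps s x - ue eps t x) \<le> \<eta>"
    using equi[OF \<eta>] by blast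
  have "((\<lambda>s. L2norm (\<lambda>x. u s x - u t x)) \<longlongrightarrow> 0) (at t within {0..T})"
    using u t by (auto simp: CL2_def)
  from tendstoD[OF this \<eta>] obtain \<delta>2 where \<delta>2: "\<delta>2 > 0"
    and u2: "\<And>s. s \<in> {0..T} \<Longrightarrow> s \<noteq> t \<Longrightarrow> dist s t < \<delta>2 \<Longrightarrow> L2norm (\<lambda>x. u s x - u t x) < \<eta>"
    unfolding eventually_at by (auto simp: L2norm_nonneg)
  define h where "h = Min {\<delta>1 / 2, \<delta>2 / 2, (T - t) / 2}"
  have "h \<le> \<delta>1 / 2" "h \<le> \<delta>2 / 2" "h \<le> (T - t) / 2" unfolding h_def by (rule Min_le; simp)+
  moreover have "h > 0" using \<delta>1 \<delta>2 t by (auto simp: h_def)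
  ultimately have h: "h > 0" "h < \<delta>1" "h < \<delta>2" "t + h < T" using \<delta>1 \<delta>2 t by (simp_all add: field_simps)
  have L20: "L2norm (\<lambda>x. 0) = 0" by (simp add: L2norm_def)
  have uc: "L2norm (\<lambda>x. u s x - u t x) \<le> \<eta>" if "s \<in> {t..t + h}" for s
    using u2[of s] that h t \<eta> L20 by (cases "s = t") (auto simp: dist_real_def intro: less_imp_le)
  have ub: "\<bar>integral {t..t + h} (\<lambda>s. ip (u s) g) - h * ip (u t) g\<bar> \<le> \<kappa> / 3 * h"
  proof -
    have "\<bar>integral {t..t + h} (\<lambda>s. ip (u s) g) - h * ip (u t) g\<bar> \<le> \<eta> * L2norm g * h"
      by (rule slab_average_close[OF u g t(1) h(1) _ uc]) (use h in auto)
    also have "\<dots> \<le> \<kappa> / 3 * h" using \<eta>g h by (intro mult_right_mono) auto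
    finally show ?thesis .
  qed
  have "((\<lambda>eps. pairing T (ue eps) (slab t (t + h) g)) \<longlongrightarrow> pairing T u (slab t (t + h) g)) (at_right 0)"
    using conv L1L2_slab[OF g] unfolding weak_star_conv_def by blast
  from tendstoD[OF this, of "\<kappa> / 3 * h"] \<kappa> h
  have ev2: "\<forall>\<^sub>F eps in at_right 0. dist (pairing T (ue eps) (slab t (t + h) g)) (pairing T u (slab t (t + h) g)) < \<kappa> / 3 * h"
    by simp
  have ev3: "\<forall>\<^sub>F eps::real in at_right 0. eps > 0" by (simp add: eventually_at_right_less)
  from ev1 ev2 ev3 show "\<forall>\<^sub>F eps in at_right 0. dist (ip (ue eps t) g) (ip (u t) g) < \<kappa>"
  proof eventually_elim
    case (elim eps)
    have "\<bar>integral {t..t + h} (\<lambda>s. ip (ue eps s) g) - h * ip (ue eps t) g\<bar> \<le> \<eta> * L2norm g * h"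
      by (rule slab_average_close[OF ue[OF elim(3)] g t(1) h(1)]) (use elim(1) h in auto)
    also have "\<dots> \<le> \<kappa> / 3 * h" using \<eta>g h by (intro mult_right_mono) auto
    finally have eb: "\<bar>integral {t..t + h} (\<lambda>s. ip (ue eps s) g) - h * ip (ue eps t) g\<bar> \<le> \<kappa> / 3 * h" .
    have "\<bar>integral {t..t + h} (\<lambda>s. ip (ue eps s) g) - integral {t..t + h} (\<lambda>s. ip (u s) g)\<bar> < \<kappa> / 3 * h"
      using elim(2) pairing_slab[OF ue[OF elim(3)] g t(1), of "t + h"] pairing_slab[OF u g t(1), of "t + h"] h
      by (simp add: dist_real_def)
    then have "\<bar>h * ip (ue eps t) g - h * ip (u t) g\<bar> < \<kappa> / 3 * h + \<kappa> / 3 * h + \<kappa> / 3 * h"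
      using eb ub by linarith
    also have "\<dots> = h * \<kappa>" by simp
    finally have "h * \<bar>ip (ue eps t) g - ip (u t) g\<bar> < h * \<kappa>"
      using h by (simp add: abs_mult flip: right_diff_distrib)
    then show ?case using h by (simp add: dist_real_def)
  qed
qed

section \<open>Averages over dyadic squares\<close>

text \<open>The squared L^2 norm of the projection onto functions constant on the squares of level
  \<open>n\<close>. It depends on finitely many pairings, so unlike the norm it passes to weak
  limits.\<close>

definition avg_energy :: "(pt \<Rightarrow> real) \<Rightarrow> nat \<Rightarrow> real" where
  "avg_energy f n = (\<Sum>k1<2 ^ n. \<Sum>k2<2 ^ n. (integral (dyadic_square n k1 k2) f)\<^sup>2 / (2 * pi / 2 ^ n)\<^sup>2)"

lemma integral_dyadic_const: "integral (dyadic_square n k1 k2) (\<lambda>x. c :: real) = (2 * pi / 2 ^ n)\<^sup>2 * c"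
proof -
  have "integral (dyadic_square n k1 k2) (\<lambda>x. c) = measure lborel (dyadic_square n k1 k2) * c"
    unfolding dyadic_square_def by simp
  then show ?thesis by (simp add: dyadic_square_cell content_cell)
qed

lemma integral_square_expand:
  fixes f :: "pt \<Rightarrow> real"
  assumes "f integrable_on dyadic_square n k1 k2" "(\<lambda>x. f x * f x) integrable_on dyadic_square n k1 k2"
  shows "integral (dyadic_square n k1 k2) (\<lambda>x. (f x - c)\<^sup>2) =
     integral (dyadic_square n k1 k2) (\<lambda>x. f x * f x) - 2 * c * integral (dyadic_square n k1 k2) f + (2 * pi / 2 ^ n)\<^sup>2 * c\<^sup>2"
    and "(\<lambda>x. (f x - c)\<^sup>2) integrable_on dyadic_square n k1 k2"
proof -
  have eq: "(\<lambda>x. (f x - c)\<^sup>2) = (\<lambda>x. (f x * f x - 2 * c * f x) + c\<^sup>2)"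
    by (auto simp: power2_eq_square algebra_simps)
  have ci: "(\<lambda>x. c\<^sup>2) integrable_on dyadic_square n k1 k2"
    unfolding dyadic_square_def by (intro integrable_const)
  have fi: "(\<lambda>x. 2 * c * f x) integrable_on dyadic_square n k1 k2"
    using assms(1) by (rule integrable_on_mult_right)
  show "(\<lambda>x. (f x - c)\<^sup>2) integrable_on dyadic_square n k1 k2"
    unfolding eq by (intro integrable_add integrable_diff assms ci fi)
  show "integral (dyadic_square n k1 k2) (\<lambda>x. (f x - c)\<^sup>2) =
     integral (dyadic_square n k1 k2) (\<lambda>x. f x * f x) - 2 * c * integral (dyadic_square n k1 k2) f + (2 * pi / 2 ^ n)\<^sup>2 * c\<^sup>2"
    unfolding eq
    by (subst Henstock_Kurzweil_Integration.integral_add Henstock_Kurzweil_Integration.integral_diff,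
        (intro integrable_add integrable_diff assms ci fi)+)+ (simp add: integral_dyadic_const)
qed

lemma dyadic_square_subset_Q0:
  assumes "k1 < 2 ^ n" "k2 < 2 ^ n" shows "dyadic_square n k1 k2 \<subseteq> Q0"
proof -
  have *: "2 * pi * (real k + 1) / 2 ^ n \<le> 2 * pi" if "k < 2 ^ n" for k
  proof -
    have "real k + 1 \<le> 2 ^ n" using that by (metis Suc_leI of_nat_Suc of_nat_le_iff of_nat_numeral of_nat_power add.commute)
    then have "2 * pi * (real k + 1) \<le> 2 * pi * 2 ^ n" by (intro mult_left_mono) auto
    then show ?thesis by (simp add: divide_le_eq)
  qed
  show ?thesis
    using *[OF assms(1)] *[OF assms(2)] unfolding dyadic_square_def Q0_def cbox_Pair_eq
    by (intro Sigma_mono) (auto simp: field_simps intro: order_trans)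
qed

lemma integrable_dyadic:
  fixes f :: "pt \<Rightarrow> real"
  assumes "f integrable_on Q0" "k1 < 2 ^ n" "k2 < 2 ^ n"
  shows "f integrable_on dyadic_square n k1 k2"
  unfolding dyadic_square_def
  by (rule integrable_on_subcbox[OF assms(1)[unfolded Q0_def]])
    (rule dyadic_square_subset_Q0[OF assms(2,3), unfolded dyadic_square_def Q0_def])

lemma avg_energy_le:
  fixes f :: "pt \<Rightarrow> real"
  assumes "f integrable_on Q0" "(\<lambda>x. f x * f x) integrable_on Q0"
  shows "avg_energy f n \<le> integral Q0 (\<lambda>x. f x * f x)"
  unfolding avg_energy_def integral_Q0_dyadic[OF assms(2), of n]
proof (intro sum_mono)
  fix k1 k2 :: nat assume k: "k1 \<in> {..<2 ^ n}" "k2 \<in> {..<2 ^ n}"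
  define A where "A = (2 * pi / 2 ^ n)\<^sup>2"
  have A: "A > 0" by (simp add: A_def)
  define m where "m = integral (dyadic_square n k1 k2) f"
  have i: "f integrable_on dyadic_square n k1 k2" "(\<lambda>x. f x * f x) integrable_on dyadic_square n k1 k2"
    using assms k by (auto intro: integrable_dyadic)
  have "0 \<le> integral (dyadic_square n k1 k2) (\<lambda>x. (f x - m / A)\<^sup>2)"
    by (intro integral_nonneg integral_square_expand(2) i) auto
  also have "\<dots> = integral (dyadic_square n k1 k2) (\<lambda>x. f x * f x) - 2 * (m / A) * m + A * (m / A)\<^sup>2"
    unfolding integral_square_expand(1)[OF i] A_def m_def ..
  also have "\<dots> = integral (dyadic_square n k1 k2) (\<lambda>x. f x * f x) - m\<^sup>2 / A"
    using A by (simp add: field_simps power2_eq_square)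
  finally show "(integral (dyadic_square n k1 k2) f)\<^sup>2 / (2 * pi / 2 ^ n)\<^sup>2 \<le> integral (dyadic_square n k1 k2) (\<lambda>x. f x * f x)"
    unfolding m_def A_def by simp
qed

lemma lipschitz_of_partials:
  assumes f: "has_partials f f1 f2" and B: "\<And>x. \<bar>f1 x\<bar> \<le> B" "\<And>x. \<bar>f2 x\<bar> \<le> B"
  shows "\<bar>f (a, b) - f (c, d)\<bar> \<le> B * \<bar>a - c\<bar> + B * \<bar>b - d\<bar>"
proof -
  have one: "\<bar>h x - h y\<bar> \<le> B * \<bar>x - y\<bar>"
    if d: "\<And>s. (h has_real_derivative h' s) (at s)" and b: "\<And>s. \<bar>h' s\<bar> \<le> B" for h h' :: "real \<Rightarrow> real" and x y
  proof -
    have "norm (h x - h y) \<le> B * norm (x - y)"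
      by (rule field_differentiable_bound[of UNIV h h']) (use d b in auto)
    then show ?thesis by simp
  qed
  have "\<bar>f (a, b) - f (c, b)\<bar> \<le> B * \<bar>a - c\<bar>"
    by (rule one[of "\<lambda>s. f (s, b)" "\<lambda>s. f1 (s, b)"]) (auto intro: has_partialsD(1)[OF f] B)
  moreover have "\<bar>f (c, b) - f (c, d)\<bar> \<le> B * \<bar>b - d\<bar>"
    by (rule one[of "\<lambda>s. f (c, s)" "\<lambda>s. f2 (c, s)"]) (auto intro: has_partialsD(2)[OF f] B)
  ultimately show ?thesis by linarith
qed

text \<open>On a square no constant beats the mean, in particular not the mollified value at the
  corner. What remains is the mollification error and the oscillation of \<open>mollify r f\<close>
  over one square. For fixed \<open>r\<close> the latter tends to 0 as \<open>n\<close> grows,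
  uniformly over functions with \<open>corr f f 0 \<le> E\<close>.\<close>

lemma cell_average_error:
  assumes f: "has_partials f f1 f2" "periodic2 f" and r: "0 < r" "r \<le> pi" and E: "corr f f 0 \<le> E"
  shows "corr f f 0 - avg_energy f n \<le>
    2 * variation f r / kmass + 8 * pi\<^sup>2 * (2 * (24 / (kmass * r ^ 3) * (2 * pi\<^sup>2 + E / 2)) * (2 * pi / 2 ^ n))\<^sup>2"
proof -
  define B where "B = 24 / (kmass * r ^ 3) * (2 * pi\<^sup>2 + E / 2)"
  define J where "J = mollify r f"
  define l where "l = 2 * pi / 2 ^ n"
  have l: "l > 0" by (simp add: l_def)
  note c = has_partialsD(3-5)[OF f(1)]
  have Jc: "continuous_on UNIV J" unfolding J_def by (rule mollify_continuous[OF c(1)])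
  have L1: "integral Q0 (\<lambda>x. \<bar>f x\<bar>) \<le> 2 * pi\<^sup>2 + E / 2"
    using integral_abs_le[OF c(1)] E by linarith
  have BB: "24 / (kmass * r ^ 3) * integral Q0 (\<lambda>x. \<bar>f x\<bar>) \<le> B"
    unfolding B_def using kmass_pos r L1 by (intro mult_left_mono) auto
  note b = mollify_partials_le[OF f r, THEN order_trans, OF BB]
  have B0: "B \<ge> 0" using b(1)[of "(0, 0)"] by linarith
  have cell: "integral (dyadic_square n k1 k2) (\<lambda>x. f x * f x) - (integral (dyadic_square n k1 k2) f)\<^sup>2 / l\<^sup>2
     \<le> integral (dyadic_square n k1 k2) (\<lambda>x. 2 * (f x - J x)\<^sup>2 + 2 * (2 * B * l)\<^sup>2)" for k1 k2
  proof -
    define z where "z = (2 * pi * real k1 / 2 ^ n, 2 * pi * real k2 / 2 ^ n)"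
    have i: "f integrable_on dyadic_square n k1 k2" "(\<lambda>x. f x * f x) integrable_on dyadic_square n k1 k2"
      unfolding dyadic_square_def by (intro cont_int continuous_intros c)+
    define m where "m = integral (dyadic_square n k1 k2) f"
    have "integral (dyadic_square n k1 k2) (\<lambda>x. (f x - J z)\<^sup>2)
      = integral (dyadic_square n k1 k2) (\<lambda>x. f x * f x) - 2 * J z * m + l\<^sup>2 * (J z)\<^sup>2"
      unfolding integral_square_expand(1)[OF i] l_def m_def ..
    \<comment> \<open>Completing the square in the value \<open>J z\<close>; the last term measures
      its distance from the mean and may be dropped.\<close>
    also have "\<dots> = integral (dyadic_square n k1 k2) (\<lambda>x. f x * f x) - m\<^sup>2 / l\<^sup>2 + (m / l - l * J z)\<^sup>2"
      using l by (simp add: power2_eq_square field_simps)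
    finally have "integral (dyadic_square n k1 k2) (\<lambda>x. f x * f x) - m\<^sup>2 / l\<^sup>2 \<le> integral (dyadic_square n k1 k2) (\<lambda>x. (f x - J z)\<^sup>2)"
      by simp
    also have "\<dots> \<le> integral (dyadic_square n k1 k2) (\<lambda>x. 2 * (f x - J x)\<^sup>2 + 2 * (2 * B * l)\<^sup>2)"
    proof (rule integral_le)
      show "(\<lambda>x. (f x - J z)\<^sup>2) integrable_on dyadic_square n k1 k2" by (rule integral_square_expand(2)[OF i])
      show "(\<lambda>x. 2 * (f x - J x)\<^sup>2 + 2 * (2 * B * l)\<^sup>2) integrable_on dyadic_square n k1 k2"
        unfolding dyadic_square_def by (intro cont_int continuous_intros c Jc)
      fix x assume x: "x \<in> dyadic_square n k1 k2"
      obtain x1 x2 where xx: "x = (x1, x2)" by fastforce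
      have "\<bar>x1 - 2 * pi * real k1 / 2 ^ n\<bar> \<le> l" "\<bar>x2 - 2 * pi * real k2 / 2 ^ n\<bar> \<le> l"
      proof -
        have e: "2 * pi * (real k + 1) / 2 ^ n = 2 * pi * real k / 2 ^ n + l" for k
          by (simp add: l_def distrib_left add_divide_distrib)
        show "\<bar>x1 - 2 * pi * real k1 / 2 ^ n\<bar> \<le> l" "\<bar>x2 - 2 * pi * real k2 / 2 ^ n\<bar> \<le> l"
          using x l unfolding xx dyadic_square_def cbox_Pair_eq e by (auto simp: abs_le_iff)
      qed
      then have le: "B * \<bar>x1 - 2 * pi * real k1 / 2 ^ n\<bar> \<le> B * l" "B * \<bar>x2 - 2 * pi * real k2 / 2 ^ n\<bar> \<le> B * l"
        using B0 by (auto intro: mult_left_mono)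
      have "\<bar>J x - J z\<bar> \<le> B * \<bar>x1 - 2 * pi * real k1 / 2 ^ n\<bar> + B * \<bar>x2 - 2 * pi * real k2 / 2 ^ n\<bar>"
        unfolding J_def xx z_def by (rule lipschitz_of_partials[OF has_partials_mollify[OF f(1)] b])
      then have "\<bar>J x - J z\<bar> \<le> 2 * B * l" using le by linarith
      then have "(J x - J z)\<^sup>2 \<le> (2 * B * l)\<^sup>2" by (rule abs_le_square_iff[THEN iffD1, OF order_trans]) simp
      moreover have "(f x - J z)\<^sup>2 \<le> 2 * (f x - J x)\<^sup>2 + 2 * (J x - J z)\<^sup>2"
      proof -
        have "(p + q)\<^sup>2 \<le> 2 * p\<^sup>2 + 2 * q\<^sup>2" for p q :: real
          using zero_le_power2[of "p - q"] by (simp add: power2_eq_square algebra_simps)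
        from this[of "f x - J x" "J x - J z"] show ?thesis by simp
      qed
      ultimately show "(f x - J z)\<^sup>2 \<le> 2 * (f x - J x)\<^sup>2 + 2 * (2 * B * l)\<^sup>2" by linarith
    qed
    finally show ?thesis unfolding m_def .
  qed
  have ff: "(\<lambda>x. f x * f x) integrable_on Q0" unfolding Q0_def by (intro cont_int continuous_intros c)
  have gg: "(\<lambda>x. 2 * (f x - J x)\<^sup>2 + 2 * (2 * B * l)\<^sup>2) integrable_on Q0"
    unfolding Q0_def by (intro cont_int continuous_intros c Jc)
  have "corr f f 0 - avg_energy f n \<le> integral Q0 (\<lambda>x. 2 * (f x - J x)\<^sup>2 + 2 * (2 * B * l)\<^sup>2)"
    unfolding corr_00 avg_energy_def integral_Q0_dyadic[OF ff, of n] integral_Q0_dyadic[OF gg, of n]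
      sum_subtractf[symmetric] l_def[symmetric]
    by (intro sum_mono cell)
  also have "\<dots> = 2 * integral Q0 (\<lambda>x. (f x - J x)\<^sup>2) + 4 * pi\<^sup>2 * (2 * (2 * B * l)\<^sup>2)"
    unfolding integral_const_Q0[symmetric] Q0_def
    by (subst Henstock_Kurzweil_Integration.integral_add, (intro cont_int continuous_intros c Jc)+) simp
  also have "integral Q0 (\<lambda>x. (f x - J x)\<^sup>2) \<le> variation f r / kmass"
    using mollify_error[OF c(1) f(2), of r] kmass_pos by (simp add: J_def field_simps)
  finally show ?thesis by (simp add: B_def l_def)
qed

lemma sq_int_fst_snd:
  assumes "sq_int v"
  shows "set_integrable lborel Q0 (\<lambda>x. fst (v x))" "set_integrable lborel Q0 (\<lambda>x. snd (v x))"
    "set_integrable lborel Q0 (\<lambda>x. fst (v x) * fst (v x))" "set_integrable lborel Q0 (\<lambda>x. snd (v x) * snd (v x))"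
proof -
  have v: "v \<in> borel_measurable borel" using assms by (simp add: sq_int_def)
  have [measurable]: "(\<lambda>x. fst (v x)) \<in> borel_measurable borel" "(\<lambda>x. snd (v x)) \<in> borel_measurable borel"
    by (intro measurable_compose[OF v] borel_measurable_continuous_onI continuous_intros)+
  have sq: "set_integrable lborel Q0 (\<lambda>x. (norm (v x))\<^sup>2)" using assms by (simp add: sq_int_def)
  have one: "set_integrable lborel Q0 (\<lambda>x. 1 :: real)"
    unfolding set_integrable_def Q0_def by (rule borel_integrable_compact) auto
  have sq1: "set_integrable lborel Q0 (\<lambda>x. 1 + (norm (v x))\<^sup>2)" by (intro set_integral_add one sq)
  have n: "(norm (v x))\<^sup>2 = fst (v x) * fst (v x) + snd (v x) * snd (v x)" for x
    by (simp add: norm_prod_def power2_eq_square)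
  have le: "\<bar>a\<bar> \<le> 1 + a * a" for a :: real
    using sum_squares_bound[of 1 "\<bar>a\<bar>"] by (simp add: power2_eq_square)
  show "set_integrable lborel Q0 (\<lambda>x. fst (v x))"
  proof (rule set_integrable_Q0_bound[OF sq1])
    show "(\<lambda>x. fst (v x)) \<in> borel_measurable lborel" by simp
    show "norm (fst (v x)) \<le> 1 + (norm (v x))\<^sup>2" for x
      unfolding n real_norm_def using le[of "fst (v x)"] zero_le_square[of "snd (v x)"] by linarith
  qed
  show "set_integrable lborel Q0 (\<lambda>x. snd (v x))"
  proof (rule set_integrable_Q0_bound[OF sq1])
    show "(\<lambda>x. snd (v x)) \<in> borel_measurable lborel" by simp
    show "norm (snd (v x)) \<le> 1 + (norm (v x))\<^sup>2" for x
      unfolding n real_norm_def using le[of "snd (v x)"] zero_le_square[of "fst (v x)"] by linarith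
  qed
  show "set_integrable lborel Q0 (\<lambda>x. fst (v x) * fst (v x))" "set_integrable lborel Q0 (\<lambda>x. snd (v x) * snd (v x))"
    by (rule set_integrable_Q0_bound[OF sq]; simp add: n)+
qed

lemma avg_energy_field_le:
  assumes "sq_int v"
  shows "avg_energy (\<lambda>x. fst (v x)) n + avg_energy (\<lambda>x. snd (v x)) n \<le> (L2norm v)\<^sup>2"
proof -
  note s = sq_int_fst_snd[OF assms]
  note h = s[THEN set_borel_integral_eq_integral(1)]
  have "(L2norm v)\<^sup>2 = (LINT x:Q0|lborel. fst (v x) * fst (v x) + snd (v x) * snd (v x))"
    unfolding L2norm_sq ip_def inner_prod_def by simp
  also have "\<dots> = integral Q0 (\<lambda>x. fst (v x) * fst (v x)) + integral Q0 (\<lambda>x. snd (v x) * snd (v x))"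
    using s by (simp add: set_integral_add(2) set_borel_integral_eq_integral(2))
  finally show ?thesis using avg_energy_le[OF h(1,3), of n] avg_energy_le[OF h(2,4), of n] by simp
qed

lemma ip_indicator:
  assumes v: "sq_int v" and k: "k1 < 2 ^ n" "k2 < 2 ^ n"
  defines "Q \<equiv> dyadic_square n k1 k2"
  shows "sq_int (\<lambda>x. (indicator Q x, 0))" "sq_int (\<lambda>x. (0, indicator Q x))"
    "ip v (\<lambda>x. (indicator Q x, 0)) = integral Q (\<lambda>x. fst (v x))"
    "ip v (\<lambda>x. (0, indicator Q x)) = integral Q (\<lambda>x. snd (v x))"
proof -
  have Q: "Q \<subseteq> Q0" unfolding Q_def by (rule dyadic_square_subset_Q0[OF k])
  have Qm [measurable]: "Q \<in> sets borel" by (simp add: Q_def dyadic_square_def)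
  have one: "set_integrable lborel Q0 (\<lambda>x. 1 :: real)"
    unfolding set_integrable_def Q0_def by (rule borel_integrable_compact) auto
  show "sq_int (\<lambda>x. (indicator Q x, 0))" "sq_int (\<lambda>x. (0, indicator Q x))"
  proof -
    have m: "(\<lambda>x. (indicat_real Q x, 0 :: real)) \<in> borel_measurable lborel" "(\<lambda>x. (0 :: real, indicat_real Q x)) \<in> borel_measurable lborel"
      by (intro borel_measurable_Pair; simp)+
    then have m2: "(\<lambda>x. (norm (indicat_real Q x, 0 :: real))\<^sup>2) \<in> borel_measurable lborel" "(\<lambda>x. (norm (0 :: real, indicat_real Q x))\<^sup>2) \<in> borel_measurable lborel"
      by measurable
    show "sq_int (\<lambda>x. (indicator Q x, 0))" "sq_int (\<lambda>x. (0, indicator Q x))"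
      unfolding sq_int_def using m
      by (auto intro!: set_integrable_Q0_bound[OF one] m2 simp: norm_Pair split: split_indicator)
  qed
  have eq: "(LINT x:Q0|lborel. f x * indicator Q x) = integral Q f" if "set_integrable lborel Q0 f" for f :: "pt \<Rightarrow> real"
  proof -
    have "(LINT x:Q0|lborel. f x * indicator Q x) = (LINT x:Q|lborel. f x)"
      unfolding set_lebesgue_integral_def
      by (intro Bochner_Integration.integral_cong refl) (use Q in \<open>auto split: split_indicator\<close>)
    also have "\<dots> = integral Q f"
      by (rule set_borel_integral_eq_integral(2)[OF set_integrable_subset[OF that]]) (use Q in auto)
    finally show ?thesis .
  qed
  show "ip v (\<lambda>x. (indicator Q x, 0)) = integral Q (\<lambda>x. fst (v x))"
    "ip v (\<lambda>x. (0, indicator Q x)) = integral Q (\<lambda>x. snd (v x))"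
    unfolding ip_def inner_prod_def by (simp_all add: eq sq_int_fst_snd[OF v])
qed

text \<open>Each average is a pairing with the indicator of a square in one component, and only
  finitely many squares occur.\<close>

lemma avg_energy_tendsto:
  fixes v :: "real \<Rightarrow> pt \<Rightarrow> real \<times> real"
  assumes v: "\<And>eps. eps > 0 \<Longrightarrow> sq_int (v eps)" and u: "sq_int u"
    and conv: "\<And>g. sq_int g \<Longrightarrow> ((\<lambda>eps. ip (v eps) g) \<longlongrightarrow> ip u g) (at_right 0)"
  shows "((\<lambda>eps. avg_energy (\<lambda>x. fst (v eps x)) n + avg_energy (\<lambda>x. snd (v eps x)) n) \<longlongrightarrow>
     avg_energy (\<lambda>x. fst (u x)) n + avg_energy (\<lambda>x. snd (u x)) n) (at_right 0)"
proof -
  have pos: "\<forall>\<^sub>F eps::real in at_right 0. eps > 0" by (simp add: eventually_at_right_less)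
  have 1: "((\<lambda>eps. integral (dyadic_square n k1 k2) (\<lambda>x. fst (v eps x))) \<longlongrightarrow> integral (dyadic_square n k1 k2) (\<lambda>x. fst (u x))) (at_right 0)"
    and 2: "((\<lambda>eps. integral (dyadic_square n k1 k2) (\<lambda>x. snd (v eps x))) \<longlongrightarrow> integral (dyadic_square n k1 k2) (\<lambda>x. snd (u x))) (at_right 0)"
    if k: "k1 < 2 ^ n" "k2 < 2 ^ n" for k1 k2
  proof -
    have ev3: "\<forall>\<^sub>F eps in at_right 0. ip (v eps) (\<lambda>x. (indicator (dyadic_square n k1 k2) x, 0)) = integral (dyadic_square n k1 k2) (\<lambda>x. fst (v eps x))"
      and ev4: "\<forall>\<^sub>F eps in at_right 0. ip (v eps) (\<lambda>x. (0, indicator (dyadic_square n k1 k2) x)) = integral (dyadic_square n k1 k2) (\<lambda>x. snd (v eps x))"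
      using ip_indicator(3,4)[OF v k] eventually_mono[OF pos] by simp_all
    show "((\<lambda>eps. integral (dyadic_square n k1 k2) (\<lambda>x. fst (v eps x))) \<longlongrightarrow> integral (dyadic_square n k1 k2) (\<lambda>x. fst (u x))) (at_right 0)"
      unfolding ip_indicator(3)[OF u k, symmetric]
      by (rule Lim_transform_eventually[OF conv[OF ip_indicator(1)[OF u k]]])
        (rule ev3)
    show "((\<lambda>eps. integral (dyadic_square n k1 k2) (\<lambda>x. snd (v eps x))) \<longlongrightarrow> integral (dyadic_square n k1 k2) (\<lambda>x. snd (u x))) (at_right 0)"
      unfolding ip_indicator(4)[OF u k, symmetric]
      by (rule Lim_transform_eventually[OF conv[OF ip_indicator(2)[OF u k]]])
        (rule ev4)
  qed
  show ?thesis
    unfolding avg_energy_def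
    by (intro tendsto_add tendsto_sum tendsto_divide tendsto_power tendsto_const 1 2) auto
qed

section \<open>Physical realizations\<close>

lemma spatialC1_joint:
  assumes "spatialC1 S f"
  shows "continuous_on S (\<lambda>p. f (fst p) (snd p))"
  using assms by (simp add: spatialC1_def case_prod_beta)

lemma spatialC1_has_partials:
  assumes f: "spatialC1 ({0<..<T} \<times> UNIV) f" and t: "t \<in> {0<..<T}"
  shows "has_partials (f t) (d1 f t) (d2 f t)"
proof -
  have slice: "continuous_on UNIV (g t)" if "continuous_on ({0<..<T} \<times> UNIV) (\<lambda>(t, x). g t x)" for g :: "real \<Rightarrow> pt \<Rightarrow> real"
  proof -
    have "continuous_on UNIV (\<lambda>x. (\<lambda>(t, x). g t x) (t, x))"
      by (rule continuous_on_compose2[OF that]) (use t in \<open>auto intro!: continuous_intros\<close>)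
    then show ?thesis by simp
  qed
  have diff: "(\<lambda>s. f t (s, b)) differentiable (at a)" "(\<lambda>s. f t (a, s)) differentiable (at b)" for a b
    using f t unfolding spatialC1_def by fastforce+
  show ?thesis
    unfolding has_partials_def
  proof (intro conjI allI)
    fix a b
    show "((\<lambda>s. f t (s, b)) has_real_derivative d1 f t (a, b)) (at a)"
      using diff(1)[of b a] by (simp add: d1_def DERIV_deriv_iff_real_differentiable)
    show "((\<lambda>s. f t (a, s)) has_real_derivative d2 f t (a, b)) (at b)"
      using diff(2)[of a b] by (simp add: d2_def DERIV_deriv_iff_real_differentiable)
  qed (use f in \<open>auto simp: spatialC1_def intro!: slice\<close>)
qed

definition comp1 :: "(real \<Rightarrow> pt \<Rightarrow> real \<times> real) \<Rightarrow> real \<Rightarrow> pt \<Rightarrow> real" where "comp1 v t x = fst (v t x)"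
definition comp2 :: "(real \<Rightarrow> pt \<Rightarrow> real \<times> real) \<Rightarrow> real \<Rightarrow> pt \<Rightarrow> real" where "comp2 v t x = snd (v t x)"

lemma vorticity_comp: "vorticity v t x = d1 (comp2 v) t x - d2 (comp1 v) t x"
  by (simp add: vorticity_def comp1_def[abs_def] comp2_def[abs_def])

definition vort1 :: "(real \<Rightarrow> pt \<Rightarrow> real \<times> real) \<Rightarrow> real \<Rightarrow> pt \<Rightarrow> real" where
  "vort1 v t x = d1 (d1 (comp2 v)) t x - d1 (d2 (comp1 v)) t x"
definition vort2 :: "(real \<Rightarrow> pt \<Rightarrow> real \<times> real) \<Rightarrow> real \<Rightarrow> pt \<Rightarrow> real" where
  "vort2 v t x = d2 (d1 (comp2 v)) t x - d2 (d2 (comp1 v)) t x"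
definition bernoulli :: "(real \<Rightarrow> pt \<Rightarrow> real \<times> real) \<Rightarrow> (real \<Rightarrow> pt \<Rightarrow> real) \<Rightarrow> real \<Rightarrow> pt \<Rightarrow> real" where
  "bernoulli v p t x = p t x + (1 / 2) * (comp1 v t x * comp1 v t x + comp2 v t x * comp2 v t x)"
definition bernoulli1 :: "(real \<Rightarrow> pt \<Rightarrow> real \<times> real) \<Rightarrow> (real \<Rightarrow> pt \<Rightarrow> real) \<Rightarrow> real \<Rightarrow> pt \<Rightarrow> real" where
  "bernoulli1 v p t x = d1 p t x + (1 / 2) * (d1 (comp1 v) t x * comp1 v t x + comp1 v t x * d1 (comp1 v) t x
     + (d1 (comp2 v) t x * comp2 v t x + comp2 v t x * d1 (comp2 v) t x))"
definition bernoulli2 :: "(real \<Rightarrow> pt \<Rightarrow> real \<times> real) \<Rightarrow> (real \<Rightarrow> pt \<Rightarrow> real) \<Rightarrow> real \<Rightarrow> pt \<Rightarrow> real" where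
  "bernoulli2 v p t x = d2 p t x + (1 / 2) * (d2 (comp1 v) t x * comp1 v t x + comp1 v t x * d2 (comp1 v) t x
     + (d2 (comp2 v) t x * comp2 v t x + comp2 v t x * d2 (comp2 v) t x))"

text \<open>With the Bernoulli pressure \<open>p + |v|\<^sup>2 / 2\<close> the nonlinearity becomes \<open>\<omega> v\<^sup>\<bottom>\<close>, and
  for divergence-free \<open>v\<close> the Laplacian is a rotated vorticity gradient.\<close>
lemma NS_ns_flow:
  assumes ns: "NS_solution eps T v p" and eps: "eps > 0"
  shows "ns_flow T eps (comp1 v) (comp2 v) (dt (comp1 v)) (dt (comp2 v)) (vorticity v) (vort1 v) (vort2 v)
    (bernoulli v p) (bernoulli1 v p) (bernoulli2 v p) (d1 (comp1 v)) (d2 (comp1 v)) (d1 (comp2 v)) (d2 (comp2 v))"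
proof -
  let ?S = "{0<..<T} \<times> (UNIV :: pt set)"
  have e: "(\<lambda>t x. fst (v t x)) = comp1 v" "(\<lambda>t x. snd (v t x)) = comp2 v"
    by (simp_all add: fun_eq_iff comp1_def comp2_def)
  have C12: "C12 ?S (comp1 v)" "C12 ?S (comp2 v)" and pC: "spatialC1 ?S p" and L2: "CL2 T v"
    and pper: "\<And>t. t \<in> {0<..<T} \<Longrightarrow> periodic2 (p t)"
    and eqs: "\<And>t x. t \<in> {0<..<T} \<Longrightarrow> dt (comp1 v) t x + comp1 v t x * d1 (comp1 v) t x + comp2 v t x * d2 (comp1 v) t x + d1 p t x
            = eps * (d1 (d1 (comp1 v)) t x + d2 (d2 (comp1 v)) t x)"
      "\<And>t x. t \<in> {0<..<T} \<Longrightarrow> dt (comp2 v) t x + comp1 v t x * d1 (comp2 v) t x + comp2 v t x * d2 (comp2 v) t x + d2 p t x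
            = eps * (d1 (d1 (comp2 v)) t x + d2 (d2 (comp2 v)) t x)"
      "\<And>t x. t \<in> {0<..<T} \<Longrightarrow> d1 (comp1 v) t x + d2 (comp2 v) t x = 0"
    using ns unfolding NS_solution_def Let_def e by auto
  have sC: "spatialC1 ?S (comp1 v)" "spatialC1 ?S (comp2 v)" "spatialC1 ?S (d1 (comp1 v))" "spatialC1 ?S (d2 (comp1 v))"
    "spatialC1 ?S (d1 (comp2 v))" "spatialC1 ?S (d2 (comp2 v))" and tC: "timeC1 ?S (comp1 v)" "timeC1 ?S (comp2 v)"
    using C12 by (auto simp: C12_def)
  note P = sC[THEN spatialC1_has_partials]
  have second: "continuous_on ?S (\<lambda>p. d1 f (fst p) (snd p))" "continuous_on ?S (\<lambda>p. d2 f (fst p) (snd p))"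
    if "spatialC1 ?S f" for f
    using that by (auto simp: spatialC1_def case_prod_beta)
  \<comment> \<open>Differentiating the divergence constraint and exchanging mixed partials: the
    Laplacian of the velocity becomes (\<open>- vort2\<close>, \<open>vort1\<close>).\<close>
  have lap: "d2 (d1 (comp2 v)) t x = - d1 (d1 (comp1 v)) t x" "d1 (d2 (comp1 v)) t x = - d2 (d2 (comp2 v)) t x"
    if t: "t \<in> {0<..<T}" for t x
  proof -
    have neg: "d2 (comp2 v) t = (\<lambda>x. (- 1) * d1 (comp1 v) t x)" "d1 (comp1 v) t = (\<lambda>x. (- 1) * d2 (comp2 v) t x)"
      using eqs(3)[OF t] by (auto simp: fun_eq_iff add_eq_0_iff)
    have D: "d1 (d2 (comp2 v)) t x = - d1 (d1 (comp1 v)) t x" "d2 (d1 (comp1 v)) t x = - d2 (d2 (comp2 v)) t x" for x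
    proof -
      have n1: "has_partials (d2 (comp2 v) t) (\<lambda>x. (- 1) * d1 (d1 (comp1 v)) t x) (\<lambda>x. (- 1) * d2 (d1 (comp1 v)) t x)"
        by (subst neg(1)) (rule has_partials_cmult[OF P(3)[OF t]])
      have n2: "has_partials (d1 (comp1 v) t) (\<lambda>x. (- 1) * d1 (d2 (comp2 v)) t x) (\<lambda>x. (- 1) * d2 (d2 (comp2 v)) t x)"
        by (subst neg(2)) (rule has_partials_cmult[OF P(6)[OF t]])
      show "d1 (d2 (comp2 v)) t x = - d1 (d1 (comp1 v)) t x" "d2 (d1 (comp1 v)) t x = - d2 (d2 (comp2 v)) t x"
        using DERIV_unique[OF has_partialsD(1)[OF P(6)[OF t], of "snd x" "fst x"] has_partialsD(1)[OF n1]]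
          DERIV_unique[OF has_partialsD(2)[OF P(3)[OF t], of "fst x" "snd x"] has_partialsD(2)[OF n2]]
        by simp_all
    qed
    have "d2 (d1 (comp2 v)) t = d1 (d2 (comp2 v)) t" "d2 (d1 (comp1 v)) t = d1 (d2 (comp1 v)) t"
      by (rule mixed_partials_eq[OF P(2)[OF t] P(5)[OF t] P(6)[OF t]], rule mixed_partials_eq[OF P(1)[OF t] P(3)[OF t] P(4)[OF t]])
    then show "d2 (d1 (comp2 v)) t x = - d1 (d1 (comp1 v)) t x" "d1 (d2 (comp1 v)) t x = - d2 (d2 (comp2 v)) t x"
      using D[of x] by simp_all
  qed
  have dtC: "((\<lambda>s. f s x) has_real_derivative dt f t x) (at t)" if "timeC1 ?S f" "t \<in> {0<..<T}" for f t x
    using that unfolding timeC1_def dt_def by (cases x) (auto simp: DERIV_deriv_iff_real_differentiable)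
  have dtcont: "continuous_on ?S (\<lambda>p. dt f (fst p) (snd p))" if "timeC1 ?S f" for f
    using that by (simp add: timeC1_def case_prod_beta)
  have per: "periodic2 (v t)" if "t \<in> {0<..<T}" for t
    using L2 that by (auto simp: CL2_def L2_field_def)
  show ?thesis
  proof
    show "has_partials (vorticity v t) (vort1 v t) (vort2 v t)" if t: "t \<in> {0<..<T}" for t
      using has_partials_diff[OF P(5)[OF t] P(4)[OF t]]
      by (simp add: vorticity_comp[abs_def] vort1_def[abs_def] vort2_def[abs_def])
    show "has_partials (bernoulli v p t) (bernoulli1 v p t) (bernoulli2 v p t)" if t: "t \<in> {0<..<T}" for t
      unfolding bernoulli_def[abs_def] bernoulli1_def[abs_def] bernoulli2_def[abs_def]
      by (intro has_partials_add has_partials_cmult has_partials_mult P t spatialC1_has_partials[OF pC])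
    show "periodic2 (comp1 v t)" "periodic2 (comp2 v t)" "periodic2 (bernoulli v p t)" if t: "t \<in> {0<..<T}" for t
      using per[OF t] pper[OF t] by (auto simp: periodic2_def comp1_def comp2_def bernoulli_def)
    show "continuous_on ?S (\<lambda>p. vort1 v (fst p) (snd p))" "continuous_on ?S (\<lambda>p. vort2 v (fst p) (snd p))"
      unfolding vort1_def vort2_def by (intro continuous_intros second sC)+
    show "dt (comp1 v) t x = - bernoulli1 v p t x + vorticity v t x * comp2 v t x - eps * vort2 v t x"
      if t: "t \<in> {0<..<T}" for t x
      using eqs(1)[OF t, of x] unfolding vort2_def lap(1)[OF t] bernoulli1_def vorticity_comp by (simp add: algebra_simps)
    show "dt (comp2 v) t x = - bernoulli2 v p t x - vorticity v t x * comp1 v t x + eps * vort1 v t x"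
      if t: "t \<in> {0<..<T}" for t x
      using eqs(2)[OF t, of x] unfolding vort1_def lap(2)[OF t] bernoulli2_def vorticity_comp by (simp add: algebra_simps)
    show "((\<lambda>s. comp1 v s x) has_real_derivative dt (comp1 v) t x) (at t)"
      "((\<lambda>s. comp2 v s x) has_real_derivative dt (comp2 v) t x) (at t)" if t: "t \<in> {0<..<T}" for t x
      by (rule dtC[OF tC(1) t], rule dtC[OF tC(2) t])
    show "vorticity v t x = d1 (comp2 v) t x - d2 (comp1 v) t x" for t x by (rule vorticity_comp)
  qed (fact eps P(1) P(2) eqs(3) spatialC1_joint[OF sC(1)] spatialC1_joint[OF sC(2)] dtcont[OF tC(1)] dtcont[OF tC(2)])+
qed

definition grid_scale :: "nat \<Rightarrow> real" where "grid_scale N = 2 * pi / 2 ^ N"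

lemma grid_scale_pos: "grid_scale N > 0" by (simp add: grid_scale_def)

lemma grid_scale_le_pi: "N \<ge> 1 \<Longrightarrow> grid_scale N \<le> pi"
proof -
  assume "N \<ge> 1"
  then have "(2::real) ^ 1 \<le> 2 ^ N" by (intro power_increasing) auto
  then show ?thesis by (simp add: grid_scale_def divide_le_eq)
qed

lemma grid_scale_antimono: "m \<le> n \<Longrightarrow> grid_scale n \<le> grid_scale m"
  unfolding grid_scale_def by (intro divide_left_mono power_increasing) auto

lemma grid_scale_tendsto: "grid_scale \<longlonglongrightarrow> 0"
proof -
  have "(\<lambda>n. 2 * pi * (1 / 2) ^ n) \<longlonglongrightarrow> 2 * pi * 0"
    by (intro tendsto_mult tendsto_const LIMSEQ_power_zero) auto
  then show ?thesis by (simp add: grid_scale_def[abs_def] power_divide)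
qed

text \<open>Squared scales drop by factors of 4, so one of them lies in [x/4, x]; the first index
  reaching x is beyond \<open>N0\<close>, where the scale is still too large.\<close>

lemma exists_grid_scale:
  assumes x: "0 < x" "x < (grid_scale N0)\<^sup>2"
  obtains N where "N \<ge> N0" "x / 4 \<le> (grid_scale N)\<^sup>2" "(grid_scale N)\<^sup>2 \<le> x"
proof -
  have "(\<lambda>n. (grid_scale n)\<^sup>2) \<longlonglongrightarrow> 0\<^sup>2" by (intro tendsto_power grid_scale_tendsto)
  then have "\<forall>\<^sub>F n in sequentially. (grid_scale n)\<^sup>2 < x" by (rule order_tendstoD(2)) (use x in simp)
  then have ex: "\<exists>n. (grid_scale n)\<^sup>2 \<le> x" by (auto simp: eventually_sequentially intro: less_imp_le)
  define N where "N = (LEAST n. (grid_scale n)\<^sup>2 \<le> x)"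
  have N: "(grid_scale N)\<^sup>2 \<le> x" unfolding N_def using ex by (rule LeastI_ex)
  have gt: "N > N0"
  proof (rule ccontr)
    assume "\<not> N > N0"
    then have "(grid_scale N0)\<^sup>2 \<le> (grid_scale N)\<^sup>2"
      by (intro power_mono grid_scale_antimono) (use grid_scale_pos[of N0] in auto)
    then show False using N x by simp
  qed
  then obtain m where m: "N = Suc m" by (cases N) auto
  have "\<not> (grid_scale m)\<^sup>2 \<le> x" using not_less_Least[of m "\<lambda>n. (grid_scale n)\<^sup>2 \<le> x"] m unfolding N_def by simp
  moreover have "(grid_scale m)\<^sup>2 = 4 * (grid_scale N)\<^sup>2" by (simp add: grid_scale_def m power_divide power_mult_distrib)
  ultimately show ?thesis using that[of N] gt N by simp
qed

text \<open>The form in which sparse stability enters: \<open>b N\<close> bounds the dyadic energies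
  of all levels from \<open>N\<close> on, uniformly in time and viscosity, and tends to 0. Bounds on
  the partial sums up to \<open>L\<close> avoid infinite series.\<close>

locale realization =
  fixes T :: real and u :: "real \<Rightarrow> pt \<Rightarrow> real \<times> real" and u0 :: "pt \<Rightarrow> real \<times> real"
    and ue :: "real \<Rightarrow> real \<Rightarrow> pt \<Rightarrow> real \<times> real" and pe :: "real \<Rightarrow> real \<Rightarrow> pt \<Rightarrow> real" and b :: "nat \<Rightarrow> real"
  assumes T: "T > 0" and u: "CL2 T u" and u0: "L2_field u0"
    and ns: "eps > 0 \<Longrightarrow> NS_solution eps T (ue eps) (pe eps)"
    and conv: "weak_star_conv T ue u"
    and init: "((\<lambda>eps. L2norm (\<lambda>x. ue eps 0 x - u0 x)) \<longlongrightarrow> 0) (at_right 0)"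
    and b_lim: "b \<longlonglongrightarrow> 0"
    and b_bound: "eps > 0 \<Longrightarrow> t \<in> {0<..<T} \<Longrightarrow> (\<Sum>i\<le>L. dyadic_energy (vorticity (ue eps) t) (N + i)) \<le> b N"
begin

lemma ue_CL2: "eps > 0 \<Longrightarrow> CL2 T (ue eps)"
  using ns by (auto simp: NS_solution_def Let_def)

lemma ue_sq_int: "eps > 0 \<Longrightarrow> t \<in> {0..T} \<Longrightarrow> sq_int (ue eps t)"
  by (rule CL2_sq_int[OF ue_CL2])

lemmas flow = NS_ns_flow[OF ns]

lemma energy_eq:
  assumes "eps > 0" "t \<in> {0<..<T}"
  shows "ns_flow.energy (comp1 (ue eps)) (comp2 (ue eps)) t = (L2norm (ue eps t))\<^sup>2"
proof -
  interpret ns_flow T eps "comp1 (ue eps)" "comp2 (ue eps)" "dt (comp1 (ue eps))" "dt (comp2 (ue eps))" "vorticity (ue eps)"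
    "vort1 (ue eps)" "vort2 (ue eps)" "bernoulli (ue eps) (pe eps)" "bernoulli1 (ue eps) (pe eps)" "bernoulli2 (ue eps) (pe eps)"
    "d1 (comp1 (ue eps))" "d2 (comp1 (ue eps))" "d1 (comp2 (ue eps))" "d2 (comp2 (ue eps))"
    by (rule flow[OF assms(1) assms(1)])
  show ?thesis
    using L2norm_continuous_field[OF has_partialsD(3)[OF u1[OF assms(2)]] has_partialsD(3)[OF u2[OF assms(2)]], of "ue eps t"]
    by (simp add: energy_def comp1_def comp2_def)
qed

text \<open>The balance law holds only inside (0, T); time 0 is reached through continuity in
  L^2.\<close>

lemma energy_le_initial:
  assumes eps: "eps > 0" and t: "t \<in> {0<..<T}"
  shows "(L2norm (ue eps t))\<^sup>2 \<le> (L2norm (ue eps 0))\<^sup>2"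
proof -
  interpret ns_flow T eps "comp1 (ue eps)" "comp2 (ue eps)" "dt (comp1 (ue eps))" "dt (comp2 (ue eps))" "vorticity (ue eps)"
    "vort1 (ue eps)" "vort2 (ue eps)" "bernoulli (ue eps) (pe eps)" "bernoulli1 (ue eps) (pe eps)" "bernoulli2 (ue eps) (pe eps)"
    "d1 (comp1 (ue eps))" "d2 (comp1 (ue eps))" "d1 (comp2 (ue eps))" "d2 (comp2 (ue eps))"
    by (rule flow[OF eps eps])
  have "((\<lambda>s. (L2norm (ue eps s))\<^sup>2) \<longlongrightarrow> (L2norm (ue eps 0))\<^sup>2) (at 0 within {0..T})"
    using T by (intro tendsto_power CL2_L2norm_tendsto[OF ue_CL2[OF eps]]) auto
  then have lim: "((\<lambda>s. (L2norm (ue eps s))\<^sup>2) \<longlongrightarrow> (L2norm (ue eps 0))\<^sup>2) (at_right 0)"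
    using at_within_Icc_at_right[OF T] by simp
  have "\<forall>\<^sub>F s in at_right 0. (L2norm (ue eps t))\<^sup>2 \<le> (L2norm (ue eps s))\<^sup>2"
    unfolding eventually_at_right[OF T]
  proof (intro exI conjI allI impI)
    fix s assume "0 < s" "s < t"
    then show "(L2norm (ue eps t))\<^sup>2 \<le> (L2norm (ue eps s))\<^sup>2"
      using energy_antimono[of s t] energy_eq[OF eps t] energy_eq[OF eps, of s] t by auto
  qed (use t in auto)
  then show ?thesis by (rule tendsto_lowerbound[OF lim]) simp
qed

text \<open>The slack 1 turns convergence of the initial norms into one bound valid for all small
  \<open>eps\<close>.\<close>

definition R0 :: real where "R0 = L2norm u0 + 1"

lemma R0_pos: "R0 > 0" using L2norm_nonneg[of u0] by (simp add: R0_def)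

definition good :: "real \<Rightarrow> bool" where "good eps \<longleftrightarrow> 0 < eps \<and> eps \<le> 1 \<and> L2norm (ue eps 0) \<le> R0"

lemma initial_tendsto: "((\<lambda>eps. L2norm (ue eps 0)) \<longlongrightarrow> L2norm u0) (at_right 0)"
proof -
  have "((\<lambda>eps. L2norm (ue eps 0) - L2norm u0) \<longlongrightarrow> 0) (at_right 0)"
  proof (rule Lim_null_comparison[OF _ init])
    have "\<forall>\<^sub>F eps::real in at_right 0. eps > 0" by (simp add: eventually_at_right_less)
    then show "\<forall>\<^sub>F eps in at_right 0. norm (L2norm (ue eps 0) - L2norm u0) \<le> L2norm (\<lambda>x. ue eps 0 x - u0 x)"
      by eventually_elim (use T L2norm_abs_diff[OF ue_sq_int L2_field_sq_int[OF u0]] in auto)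
  qed
  then show ?thesis by (simp add: LIM_zero_iff)
qed

lemma eventually_good: "\<forall>\<^sub>F eps in at_right 0. good eps"
proof -
  have 1: "\<forall>\<^sub>F eps in at_right 0. L2norm (ue eps 0) < R0"
    by (rule order_tendstoD(2)[OF initial_tendsto]) (simp add: R0_def)
  have 2: "\<forall>\<^sub>F eps::real in at_right 0. eps > 0" by (simp add: eventually_at_right_less)
  have 3: "\<forall>\<^sub>F eps::real in at_right 0. eps < 1" using eventually_at_right_real[of 0 1] by (auto elim: eventually_mono)
  from 1 2 3 show ?thesis by eventually_elim (simp add: good_def)
qed

lemma energy_le:
  assumes "good eps" "t \<in> {0<..<T}"
  shows "(L2norm (ue eps t))\<^sup>2 \<le> R0\<^sup>2" "ns_flow.energy (comp1 (ue eps)) (comp2 (ue eps)) t \<le> R0\<^sup>2"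
proof -
  have eps: "eps > 0" using assms by (simp add: good_def)
  have "(L2norm (ue eps 0))\<^sup>2 \<le> R0\<^sup>2" using assms by (intro power_mono) (auto simp: good_def L2norm_nonneg)
  then show "(L2norm (ue eps t))\<^sup>2 \<le> R0\<^sup>2" using energy_le_initial[OF eps assms(2)] by linarith
  then show "ns_flow.energy (comp1 (ue eps)) (comp2 (ue eps)) t \<le> R0\<^sup>2" by (simp add: energy_eq[OF eps assms(2)])
qed

text \<open>18 is the 9 of \<open>energy_minus_kavg_le\<close> times the factor 2 in
  \<open>variation\<close>.\<close>

lemma variation_le:
  assumes eps: "eps > 0" and t: "t \<in> {0<..<T}"
  shows "variation (comp1 (ue eps) t) (grid_scale N) + variation (comp2 (ue eps) t) (grid_scale N) \<le> 18 * b N"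
proof -
  interpret ns_flow T eps "comp1 (ue eps)" "comp2 (ue eps)" "dt (comp1 (ue eps))" "dt (comp2 (ue eps))" "vorticity (ue eps)"
    "vort1 (ue eps)" "vort2 (ue eps)" "bernoulli (ue eps) (pe eps)" "bernoulli1 (ue eps) (pe eps)" "bernoulli2 (ue eps) (pe eps)"
    "d1 (comp1 (ue eps))" "d2 (comp1 (ue eps))" "d1 (comp2 (ue eps))" "d2 (comp2 (ue eps))"
    by (rule flow[OF eps eps])
  have w: "(\<lambda>x. d1 (comp2 (ue eps)) t x - d2 (comp1 (ue eps)) t x) = vorticity (ue eps) t"
    by (auto simp: vorticity_comp)
  show ?thesis
    using energy_minus_kavg_le[OF u1[OF t] u2[OF t] per(1)[OF t] per(2)[OF t] div[OF t], of N "b N", unfolded w, OF b_bound[OF eps t]]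
    by (simp add: variation_def grid_scale_def algebra_simps)
qed

definition eq_const :: "nat \<Rightarrow> real" where
  "eq_const N = 2 * (24 / (kmass * (grid_scale N) ^ 3) * (2 * pi\<^sup>2 + 2 * R0\<^sup>2)) * (2 * pi\<^sup>2 + R0\<^sup>2)"

lemma time_modulus:
  assumes g: "good eps" and N: "N \<ge> 1" and st: "0 < s" "s < t" "t < T"
  shows "(L2norm (\<lambda>x. ue eps t x - ue eps s x))\<^sup>2 \<le> 36 * b N / kmass + eq_const N * ((t - s) + 2 * sqrt (t - s))"
proof -
  have eps: "eps > 0" "eps \<le> 1" using g by (auto simp: good_def)
  interpret ns_flow T eps "comp1 (ue eps)" "comp2 (ue eps)" "dt (comp1 (ue eps))" "dt (comp2 (ue eps))" "vorticity (ue eps)"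
    "vort1 (ue eps)" "vort2 (ue eps)" "bernoulli (ue eps) (pe eps)" "bernoulli1 (ue eps) (pe eps)" "bernoulli2 (ue eps) (pe eps)"
    "d1 (comp1 (ue eps))" "d2 (comp1 (ue eps))" "d1 (comp2 (ue eps))" "d2 (comp2 (ue eps))"
    by (rule flow[OF eps(1) eps(1)])
  have tT: "t \<in> {0<..<T}" "s \<in> {0<..<T}" using st by auto
  have "(L2norm (\<lambda>x. ue eps t x - ue eps s x))\<^sup>2 =
    corr (\<lambda>x. comp1 (ue eps) t x - comp1 (ue eps) s x) (\<lambda>x. comp1 (ue eps) t x - comp1 (ue eps) s x) 0 +
    corr (\<lambda>x. comp2 (ue eps) t x - comp2 (ue eps) s x) (\<lambda>x. comp2 (ue eps) t x - comp2 (ue eps) s x) 0"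
  proof (rule L2norm_continuous_field)
    show "ue eps t x - ue eps s x = (comp1 (ue eps) t x - comp1 (ue eps) s x, comp2 (ue eps) t x - comp2 (ue eps) s x)" for x
      by (simp add: comp1_def comp2_def prod_eq_iff)
  qed (intro continuous_intros has_partialsD(3)[OF u1[OF tT(1)]] has_partialsD(3)[OF u1[OF tT(2)]]
        has_partialsD(3)[OF u2[OF tT(1)]] has_partialsD(3)[OF u2[OF tT(2)]])+
  also have "\<dots> \<le> 2 * (18 * b N) / kmass + eq_const N * ((t - s) + 2 * sqrt (t - s))"
    unfolding eq_const_def
    by (rule time_equicontinuity[OF energy_le(2)[OF g] eps(2) grid_scale_pos grid_scale_le_pi[OF N] variation_le[OF eps(1)] st])
  finally show ?thesis by simp
qed

lemma eventually_b_small: "c > 0 \<Longrightarrow> \<exists>N\<ge>1. b N \<le> c"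
  using order_tendstoD(2)[OF b_lim, of c] unfolding eventually_sequentially
  by (metis le_add1 le_add2 less_imp_le)

text \<open>The spatial scale comes first: \<open>N\<close> makes the variation term at most half of
  the squared tolerance. Only then is \<open>\<delta>\<close> chosen, against the constant
  \<open>eq_const N\<close>, which may be large.\<close>

lemma equicontinuous:
  assumes \<eta>: "\<eta> > 0"
  obtains \<delta> where "\<delta> > 0" "\<And>eps s t. good eps \<Longrightarrow> 0 \<le> s \<Longrightarrow> s \<le> t \<Longrightarrow> t < s + \<delta> \<Longrightarrow> t < T \<Longrightarrow>
      L2norm (\<lambda>x. ue eps t x - ue eps s x) \<le> \<eta>"
proof -
  obtain N where N: "N \<ge> 1" "b N \<le> \<eta>\<^sup>2 / 2 * kmass / 36"
    using eventually_b_small[of "\<eta>\<^sup>2 / 2 * kmass / 36"] \<eta> kmass_pos by auto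
  have "((\<lambda>d. eq_const N * (d + 2 * sqrt d)) \<longlongrightarrow> eq_const N * (0 + 2 * sqrt 0)) (at_right 0)"
    by (intro tendsto_intros)
  then have "\<forall>\<^sub>F d in at_right 0. eq_const N * (d + 2 * sqrt d) < \<eta>\<^sup>2 / 2"
    by (rule order_tendstoD(2)) (use \<eta> in simp)
  then obtain \<delta> where \<delta>: "\<delta> > 0" "\<And>d. 0 < d \<Longrightarrow> d < \<delta> \<Longrightarrow> eq_const N * (d + 2 * sqrt d) < \<eta>\<^sup>2 / 2"
    unfolding eventually_at_right[OF zero_less_one[where 'a=real]] by blast
  have pos: "L2norm (\<lambda>x. ue eps t x - ue eps s x) \<le> \<eta>" if g: "good eps" and st: "0 < s" "s < t" "t < s + \<delta>" "t < T" for eps s t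
  proof -
    have "36 * b N / kmass \<le> \<eta>\<^sup>2 / 2" using N kmass_pos by (simp add: field_simps)
    moreover have "eq_const N * ((t - s) + 2 * sqrt (t - s)) \<le> \<eta>\<^sup>2 / 2"
      by (rule less_imp_le, rule \<delta>(2)) (use st in auto)
    ultimately have "36 * b N / kmass + eq_const N * ((t - s) + 2 * sqrt (t - s)) \<le> \<eta>\<^sup>2 / 2 + \<eta>\<^sup>2 / 2"
      by (rule add_mono)
    then have "(L2norm (\<lambda>x. ue eps t x - ue eps s x))\<^sup>2 \<le> \<eta>\<^sup>2 / 2 + \<eta>\<^sup>2 / 2"
      by (rule order_trans[OF time_modulus[OF g N(1) st(1,2,4)]])
    then have "(L2norm (\<lambda>x. ue eps t x - ue eps s x))\<^sup>2 \<le> \<eta>\<^sup>2" by simp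
    then show ?thesis by (rule power2_le_imp_le) (use \<eta> in simp)
  qed
  have "L2norm (\<lambda>x. ue eps t x - ue eps s x) \<le> \<eta>" if g: "good eps" and st: "0 \<le> s" "s \<le> t" "t < s + \<delta>" "t < T" for eps s t
  proof -
    have eps: "eps > 0" using g by (simp add: good_def)
    consider "s = t" | "0 < s" "s < t" | "s = 0" "0 < t" using st by linarith
    then show ?thesis
    proof cases
      case 1
      then show ?thesis using \<eta> by (simp add: L2norm_def)
    next
      case 2
      then show ?thesis using pos[OF g] st by blast
    next
      case 3
      \<comment> \<open>For the initial time the bound at positive times \<open>s\<close> is carried
        to the limit; the added term vanishes by L^2 continuity of the single solution.\<close>
      have "((\<lambda>s. \<eta> + L2norm (\<lambda>x. ue eps s x - ue eps 0 x)) \<longlongrightarrow> \<eta> + 0) (at 0 within {0..T})"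
        using ue_CL2[OF eps] T by (intro tendsto_add tendsto_const) (auto simp: CL2_def)
      then have lim: "((\<lambda>s. \<eta> + L2norm (\<lambda>x. ue eps s x - ue eps 0 x)) \<longlongrightarrow> \<eta> + 0) (at_right 0)"
        using at_within_Icc_at_right[OF T] by simp
      have "\<forall>\<^sub>F s in at_right 0. L2norm (\<lambda>x. ue eps t x - ue eps 0 x) \<le> \<eta> + L2norm (\<lambda>x. ue eps s x - ue eps 0 x)"
        unfolding eventually_at_right[OF T]
      proof (intro exI conjI allI impI)
        fix s' assume s': "0 < s'" "s' < t"
        have "L2norm (\<lambda>x. ue eps t x - ue eps 0 x) \<le> L2norm (\<lambda>x. ue eps t x - ue eps s' x) + L2norm (\<lambda>x. ue eps s' x - ue eps 0 x)"
          using s' st T by (intro L2norm_diff_triangle ue_sq_int eps) auto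
        also have "L2norm (\<lambda>x. ue eps t x - ue eps s' x) \<le> \<eta>" using pos[OF g, of s' t] s' st 3 by auto
        finally show "L2norm (\<lambda>x. ue eps t x - ue eps 0 x) \<le> \<eta> + L2norm (\<lambda>x. ue eps s' x - ue eps 0 x)" by simp
      qed (use 3 in auto)
      then have "L2norm (\<lambda>x. ue eps t x - ue eps 0 x) \<le> \<eta> + 0"
        by (rule tendsto_lowerbound[OF lim]) simp
      then show ?thesis using 3 by simp
    qed
  qed
  then show ?thesis using that \<delta>(1) by blast
qed

lemma weak_limit:
  assumes t: "0 \<le> t" "t < T" and g: "sq_int g"
  shows "((\<lambda>eps. ip (ue eps t) g) \<longlongrightarrow> ip (u t) g) (at_right 0)"
proof (rule weak_convergence_at[OF conv u ue_CL2 t g])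
  fix \<eta> :: real assume "\<eta> > 0"
  then obtain \<delta> where \<delta>: "\<delta> > 0" "\<And>eps s t. good eps \<Longrightarrow> 0 \<le> s \<Longrightarrow> s \<le> t \<Longrightarrow> t < s + \<delta> \<Longrightarrow> t < T \<Longrightarrow>
      L2norm (\<lambda>x. ue eps t x - ue eps s x) \<le> \<eta>"
    using equicontinuous by blast
  show "\<exists>\<delta>>0. \<forall>\<^sub>F eps in at_right 0. \<forall>s. t \<le> s \<and> s < t + \<delta> \<and> s < T \<longrightarrow> L2norm (\<lambda>x. ue eps s x - ue eps t x) \<le> \<eta>"
  proof (intro exI[of _ \<delta>] conjI \<delta>(1))
    show "\<forall>\<^sub>F eps in at_right 0. \<forall>s. t \<le> s \<and> s < t + \<delta> \<and> s < T \<longrightarrow> L2norm (\<lambda>x. ue eps s x - ue eps t x) \<le> \<eta>"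
      using eventually_good by eventually_elim (use \<delta>(2) t in blast)
  qed
qed

text \<open>Scales with r^2 comparable to \<open>eps\<close> balance the two terms of
  \<open>enstrophy_interpolation\<close>: the gradient term is absorbed by viscous decay, and b N /
  r^2 is small compared with 1 / eps because the scales shrink with \<open>eps\<close> and
  \<open>b\<close> tends to 0.\<close>

lemma dissipation_rate_vanishes:
  assumes d: "d \<in> {0<..<T}" and l: "l > 0"
  shows "\<forall>\<^sub>F eps in at_right 0. eps * ns_flow.enstrophy (vorticity (ue eps)) d \<le> l"
proof -
  \<comment> \<open>With r^2 between \<open>\<theta>\<close> eps / 4 and \<open>\<theta>\<close>
    eps, the upper end makes 4 R0^2 r^2 at most half of eps l d^2. The lower end reduces the tail
    condition 9/4 b N (2 eps) <= l r^2 to b N <= l \<open>\<theta>\<close> / 18.\<close>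
  define \<theta> where "\<theta> = l * d\<^sup>2 / (8 * R0\<^sup>2)"
  have \<theta>: "\<theta> > 0" using l d R0_pos by (simp add: \<theta>_def)
  have "\<forall>\<^sub>F N in sequentially. b N < l * \<theta> / 18" using order_tendstoD(2)[OF b_lim, of "l * \<theta> / 18"] l \<theta> by simp
  then obtain N0 where N0: "\<And>N. N \<ge> N0 \<Longrightarrow> b N < l * \<theta> / 18" by (auto simp: eventually_sequentially)
  have "\<forall>\<^sub>F eps in at_right 0. \<theta> * eps < (grid_scale N0)\<^sup>2"
  proof -
    have "((\<lambda>eps. \<theta> * eps) \<longlongrightarrow> \<theta> * 0) (at_right 0)" by (intro tendsto_intros)
    then show ?thesis using grid_scale_pos[of N0] by (intro order_tendstoD(2)[of _ "\<theta> * 0"]) auto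
  qed
  then show ?thesis using eventually_good
  proof eventually_elim
    case (elim eps)
    have eps: "eps > 0" using elim by (simp add: good_def)
    interpret ns_flow T eps "comp1 (ue eps)" "comp2 (ue eps)" "dt (comp1 (ue eps))" "dt (comp2 (ue eps))" "vorticity (ue eps)"
      "vort1 (ue eps)" "vort2 (ue eps)" "bernoulli (ue eps) (pe eps)" "bernoulli1 (ue eps) (pe eps)" "bernoulli2 (ue eps) (pe eps)"
      "d1 (comp1 (ue eps))" "d2 (comp1 (ue eps))" "d1 (comp2 (ue eps))" "d2 (comp2 (ue eps))"
      by (rule flow[OF eps eps])
    obtain N where N: "N \<ge> N0" "\<theta> * eps / 4 \<le> (grid_scale N)\<^sup>2" "(grid_scale N)\<^sup>2 \<le> \<theta> * eps"
      using exists_grid_scale[of "\<theta> * eps" N0] elim \<theta> eps by auto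
    define r2 where "r2 = (grid_scale N)\<^sup>2"
    have r2: "r2 > 0" using grid_scale_pos[of N] by (simp add: r2_def)
    show ?case
    proof (rule enstrophy_vanish[OF energy_le(2)[OF elim(2)] d l grid_scale_pos])
      fix t assume t: "t \<in> {0<..<T}"
      have "dyadic_energy (vorticity (ue eps) t) N \<le> b N" using b_bound[OF eps t, where L = 0 and N = N] by simp
      then have "9 / 4 * dyadic_energy (vorticity (ue eps) t) N / (grid_scale N)\<^sup>2 \<le> 9 / 4 * b N / (grid_scale N)\<^sup>2"
        by (intro divide_right_mono mult_left_mono) auto
      then show "enstrophy t \<le> 2 * (grid_scale N)\<^sup>2 * palinstrophy t + 9 / 4 * b N / (grid_scale N)\<^sup>2"
        using enstrophy_interpolation[OF w[OF t] per_w[OF t], of "grid_scale N" N]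
        unfolding enstrophy_def palinstrophy_def grid_scale_def by linarith
    next
      have "9 / 4 * b N * (2 * eps) \<le> 9 / 4 * (l * \<theta> / 18) * (2 * eps)"
        using less_imp_le[OF N0[OF N(1)]] eps by (intro mult_right_mono mult_left_mono) auto
      also have "\<dots> = l * (\<theta> * eps / 4)" by simp
      also have "\<dots> \<le> l * r2" unfolding r2_def using N(2) l by (intro mult_left_mono) auto
      finally show "9 / 4 * b N / (grid_scale N)\<^sup>2 \<le> l / (2 * eps)"
        unfolding r2_def[symmetric] using r2 eps by (simp add: field_simps)
    next
      have "4 * R0\<^sup>2 * (grid_scale N)\<^sup>2 \<le> 4 * R0\<^sup>2 * (\<theta> * eps)" using N(3) by (intro mult_left_mono) auto
      also have "\<dots> = eps * l * d\<^sup>2 / 2" using R0_pos by (simp add: \<theta>_def)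
      also have "\<dots> < eps * l * d\<^sup>2" using eps l d by simp
      finally show "4 * R0\<^sup>2 * (grid_scale N)\<^sup>2 < eps * l * d\<^sup>2" .
    qed
  qed
qed

text \<open>The enstrophy has no bound near time 0, so time is split at a small \<open>d\<close>. Up
  to \<open>d\<close> the loss is controlled by equicontinuity; afterwards it is at most 2 (t - d)
  times the dissipation rate at \<open>d\<close>, by monotonicity of the enstrophy.\<close>

lemma energy_lower:
  assumes t: "t \<in> {0<..<T}" and \<kappa>: "\<kappa> > 0"
  shows "\<forall>\<^sub>F eps in at_right 0. (L2norm u0)\<^sup>2 - \<kappa> \<le> (L2norm (ue eps t))\<^sup>2"
proof -
  \<comment> \<open>The tolerance \<open>\<eta>\<close> gets multiplied by a sum of two norms, at
    most 2 R0, and \<open>l\<close> by at most 2 T. Each of these losses is then at most a quarter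
    of \<open>\<kappa>\<close>, as is that of the initial data.\<close>
  define \<eta> where "\<eta> = \<kappa> / (8 * R0)"
  define l where "l = \<kappa> / (8 * T)"
  have pos: "\<eta> > 0" "l > 0" using \<kappa> R0_pos T by (auto simp: \<eta>_def l_def)
  obtain \<delta> where \<delta>: "\<delta> > 0" "\<And>eps s t. good eps \<Longrightarrow> 0 \<le> s \<Longrightarrow> s \<le> t \<Longrightarrow> t < s + \<delta> \<Longrightarrow> t < T \<Longrightarrow>
      L2norm (\<lambda>x. ue eps t x - ue eps s x) \<le> \<eta>"
    using equicontinuous[OF pos(1)] by blast
  define d where "d = min (\<delta> / 2) (t / 2)"
  have d: "0 < d" "d < \<delta>" "d < t" "d \<in> {0<..<T}" using \<delta>(1) t by (auto simp: d_def min_def)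
  have "((\<lambda>eps. (L2norm (ue eps 0))\<^sup>2) \<longlongrightarrow> (L2norm u0)\<^sup>2) (at_right 0)" by (intro tendsto_power initial_tendsto)
  then have "\<forall>\<^sub>F eps in at_right 0. (L2norm u0)\<^sup>2 - \<kappa> / 4 < (L2norm (ue eps 0))\<^sup>2"
    using \<kappa> by (intro order_tendstoD(1)) auto
  then show ?thesis using eventually_good dissipation_rate_vanishes[OF d(4) pos(2)]
  proof eventually_elim
    case (elim eps)
    have eps: "eps > 0" using elim by (simp add: good_def)
    interpret ns_flow T eps "comp1 (ue eps)" "comp2 (ue eps)" "dt (comp1 (ue eps))" "dt (comp2 (ue eps))" "vorticity (ue eps)"
      "vort1 (ue eps)" "vort2 (ue eps)" "bernoulli (ue eps) (pe eps)" "bernoulli1 (ue eps) (pe eps)" "bernoulli2 (ue eps) (pe eps)"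
      "d1 (comp1 (ue eps))" "d2 (comp1 (ue eps))" "d1 (comp2 (ue eps))" "d2 (comp2 (ue eps))"
      by (rule flow[OF eps eps])
    define X where "X = L2norm (ue eps 0)"
    define Y where "Y = L2norm (ue eps d)"
    have XY: "0 \<le> X" "0 \<le> Y" "X \<le> R0" using elim by (auto simp: X_def Y_def L2norm_nonneg good_def)
    have "\<bar>Y - X\<bar> \<le> L2norm (\<lambda>x. ue eps d x - ue eps 0 x)"
      unfolding X_def Y_def using d T by (intro L2norm_abs_diff ue_sq_int eps) auto
    also have "\<dots> \<le> \<eta>" using \<delta>(2)[OF elim(2), of 0 d] d by simp
    finally have close: "X - Y \<le> \<eta>" by simp
    have "X\<^sup>2 - Y\<^sup>2 \<le> \<kappa> / 4"
    proof (cases "X \<le> Y")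
      case True
      then have "X\<^sup>2 \<le> Y\<^sup>2" using XY by (intro power_mono) auto
      then show ?thesis using \<kappa> by simp
    next
      case False
      have "X\<^sup>2 - Y\<^sup>2 = (X - Y) * (X + Y)" by (simp add: power2_eq_square algebra_simps)
      also have "\<dots> \<le> \<eta> * (2 * R0)" using False XY close pos by (intro mult_mono) auto
      also have "\<dots> = \<kappa> / 4" using R0_pos by (simp add: \<eta>_def)
      finally show ?thesis .
    qed
    moreover have "energy d - energy t \<le> \<kappa> / 4"
    proof -
      have "energy d - energy t \<le> 2 * eps * (t - d) * enstrophy d" using d t by (intro energy_drop_le) auto
      also have "\<dots> = 2 * (t - d) * (eps * enstrophy d)" by simp
      also have "\<dots> \<le> 2 * T * l"
        using elim(3) d t enstrophy_nonneg[OF d(4)] eps by (intro mult_mono) auto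
      also have "\<dots> = \<kappa> / 4" using T by (simp add: l_def)
      finally show ?thesis .
    qed
    ultimately show ?case
      using elim(1) \<kappa> energy_eq[OF eps d(4)] energy_eq[OF eps t] unfolding X_def Y_def by linarith
  qed
qed

text \<open>Weak lower semicontinuity of the norm, by testing the weak limit against
  \<open>u t\<close> itself.\<close>

lemma limit_energy_le:
  assumes t: "t \<in> {0<..<T}" shows "L2norm (u t) \<le> L2norm u0"
proof -
  have sq: "sq_int (u t)" using CL2_sq_int[OF u] t by auto
  have "(L2norm (u t))\<^sup>2 \<le> L2norm u0 * L2norm (u t)"
  proof (rule tendsto_le)
    show "((\<lambda>eps. ip (ue eps t) (u t)) \<longlongrightarrow> (L2norm (u t))\<^sup>2) (at_right 0)"
      unfolding L2norm_sq using t by (intro weak_limit sq) auto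
    show "((\<lambda>eps. L2norm (ue eps 0) * L2norm (u t)) \<longlongrightarrow> L2norm u0 * L2norm (u t)) (at_right 0)"
      by (intro tendsto_mult_right initial_tendsto)
    show "\<forall>\<^sub>F eps in at_right 0. ip (ue eps t) (u t) \<le> L2norm (ue eps 0) * L2norm (u t)"
      using eventually_good
    proof eventually_elim
      case (elim eps)
      have eps: "eps > 0" using elim by (simp add: good_def)
      have "ip (ue eps t) (u t) \<le> L2norm (ue eps t) * L2norm (u t)"
        using ip_le[OF ue_sq_int[OF eps] sq, of t] t by auto
      also have "L2norm (ue eps t) \<le> L2norm (ue eps 0)"
        using energy_le_initial[OF eps t] by (intro power2_le_imp_le[of "L2norm (ue eps t)"]) (auto simp: L2norm_nonneg)
      finally show ?case by (simp add: mult_right_mono L2norm_nonneg)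
    qed
  qed simp
  then have "L2norm (u t) * L2norm (u t) \<le> L2norm (u t) * L2norm u0" by (simp add: power2_eq_square mult.commute)
  then show ?thesis using L2norm_nonneg[of "u t"] L2norm_nonneg[of u0]
    by (cases "L2norm (u t) = 0") (auto simp: mult_le_cancel_left)
qed

text \<open>The direction that weak convergence alone does not give. Averages on a fixed grid pass
  to the limit, and by \<open>cell_average_error\<close> a fine grid captures the energy of every
  approximation up to an error independent of \<open>eps\<close>.\<close>

lemma limit_energy_ge:
  assumes t: "t \<in> {0<..<T}" shows "(L2norm u0)\<^sup>2 \<le> (L2norm (u t))\<^sup>2"
proof (rule field_le_epsilon)
  fix \<kappa> :: real assume \<kappa>: "\<kappa> > 0"
  have sq: "sq_int (u t)" using CL2_sq_int[OF u] t by auto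
  \<comment> \<open>Order of choices: \<open>N\<close> fixes the mollification scale and with it the
    Lipschitz bound \<open>B\<close>, against which the averaging level \<open>n\<close> is taken
    last. A third of \<open>\<kappa>\<close> each goes to variation, oscillation and energy
    loss.\<close>
  obtain N where N: "N \<ge> 1" "b N \<le> \<kappa> / 3 * kmass / 36"
    using eventually_b_small[of "\<kappa> / 3 * kmass / 36"] \<kappa> kmass_pos by auto
  define B where "B = 24 / (kmass * (grid_scale N) ^ 3) * (2 * pi\<^sup>2 + R0\<^sup>2 / 2)"
  have "(\<lambda>n. 2 * (8 * pi\<^sup>2 * (2 * B * grid_scale n)\<^sup>2)) \<longlonglongrightarrow> 2 * (8 * pi\<^sup>2 * (2 * B * 0)\<^sup>2)"
    by (intro tendsto_intros grid_scale_tendsto)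
  then have "\<forall>\<^sub>F n in sequentially. 2 * (8 * pi\<^sup>2 * (2 * B * grid_scale n)\<^sup>2) < \<kappa> / 3"
    by (rule order_tendstoD(2)) (use \<kappa> in simp)
  then obtain n where n: "2 * (8 * pi\<^sup>2 * (2 * B * grid_scale n)\<^sup>2) < \<kappa> / 3"
    by (auto simp: eventually_sequentially)
  let ?A = "\<lambda>v. avg_energy (\<lambda>x. fst (v x)) n + avg_energy (\<lambda>x. snd (v x)) n"
  have lim: "((\<lambda>eps. ?A (ue eps t)) \<longlongrightarrow> ?A (u t)) (at_right 0)"
    using t by (intro avg_energy_tendsto ue_sq_int sq weak_limit) auto
  have "\<forall>\<^sub>F eps in at_right 0. (L2norm u0)\<^sup>2 - \<kappa> \<le> ?A (ue eps t)"
  proof -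
    have "\<forall>\<^sub>F eps in at_right 0. (L2norm u0)\<^sup>2 - \<kappa> / 3 \<le> (L2norm (ue eps t))\<^sup>2" using \<kappa> by (intro energy_lower t) auto
    then show ?thesis using eventually_good
    proof eventually_elim
      case (elim eps)
      have eps: "eps > 0" using elim by (simp add: good_def)
      interpret ns_flow T eps "comp1 (ue eps)" "comp2 (ue eps)" "dt (comp1 (ue eps))" "dt (comp2 (ue eps))" "vorticity (ue eps)"
        "vort1 (ue eps)" "vort2 (ue eps)" "bernoulli (ue eps) (pe eps)" "bernoulli1 (ue eps) (pe eps)" "bernoulli2 (ue eps) (pe eps)"
        "d1 (comp1 (ue eps))" "d2 (comp1 (ue eps))" "d1 (comp2 (ue eps))" "d2 (comp2 (ue eps))"
        by (rule flow[OF eps eps])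
      have A: "?A (ue eps t) = avg_energy (comp1 (ue eps) t) n + avg_energy (comp2 (ue eps) t) n"
        by (simp add: comp1_def[abs_def] comp2_def[abs_def])
      have en: "corr (comp1 (ue eps) t) (comp1 (ue eps) t) 0 + corr (comp2 (ue eps) t) (comp2 (ue eps) t) 0 = (L2norm (ue eps t))\<^sup>2"
        using energy_eq[OF eps t] by (simp add: energy_def)
      have nn: "corr (comp1 (ue eps) t) (comp1 (ue eps) t) 0 \<ge> 0" "corr (comp2 (ue eps) t) (comp2 (ue eps) t) 0 \<ge> 0"
        by (intro corr_self_nonneg has_partialsD(3)[OF u1[OF t]] has_partialsD(3)[OF u2[OF t]])+
      have le: "corr (comp1 (ue eps) t) (comp1 (ue eps) t) 0 \<le> R0\<^sup>2" "corr (comp2 (ue eps) t) (comp2 (ue eps) t) 0 \<le> R0\<^sup>2"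
        using nn en energy_le(1)[OF elim(2) t] by linarith+
      define S where "S = 8 * pi\<^sup>2 * (2 * B * grid_scale n)\<^sup>2"
      have S: "8 * pi\<^sup>2 * (2 * (24 / (kmass * (grid_scale N) ^ 3) * (2 * pi\<^sup>2 + R0\<^sup>2 / 2)) * (2 * pi / 2 ^ n))\<^sup>2 = S"
        by (simp add: S_def B_def grid_scale_def)
      note c1 = cell_average_error[OF u1[OF t] per(1)[OF t] grid_scale_pos[of N] grid_scale_le_pi[OF N(1)] le(1), of n, unfolded S]
      note c2 = cell_average_error[OF u2[OF t] per(2)[OF t] grid_scale_pos[of N] grid_scale_le_pi[OF N(1)] le(2), of n, unfolded S]
      have "2 * variation (comp1 (ue eps) t) (grid_scale N) / kmass + 2 * variation (comp2 (ue eps) t) (grid_scale N) / kmass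
         = 2 * (variation (comp1 (ue eps) t) (grid_scale N) + variation (comp2 (ue eps) t) (grid_scale N)) / kmass"
        by (simp add: add_divide_distrib)
      also have "\<dots> \<le> 2 * (18 * b N) / kmass"
        using variation_le[OF eps t, of N] kmass_pos by (intro divide_right_mono mult_left_mono) auto
      also have "\<dots> \<le> \<kappa> / 3" using N(2) kmass_pos by (simp add: field_simps)
      finally show ?case using c1 c2 en elim(1) n A unfolding S_def by linarith
    qed
  qed
  then have "(L2norm u0)\<^sup>2 - \<kappa> \<le> ?A (u t)" by (rule tendsto_lowerbound[OF lim]) simp
  then show "(L2norm u0)\<^sup>2 \<le> (L2norm (u t))\<^sup>2 + \<kappa>" using avg_energy_field_le[OF sq, of n] by linarith
qed

text \<open>Interior times are settled; at 0 and T the norm is the limit of its interior values,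
  because \<open>u\<close> is continuous in L^2.\<close>

lemma conservative:
  assumes "t \<in> {0..T}" shows "L2norm (u t) = L2norm u0"
proof -
  have int: "L2norm (u s) = L2norm u0" if "s \<in> {0<..<T}" for s
    using limit_energy_le[OF that] limit_energy_ge[OF that] L2norm_nonneg power2_le_imp_le by (intro antisym) blast+
  have lim: "((\<lambda>s. L2norm (u s)) \<longlongrightarrow> L2norm (u t)) (at t within {0..T})" by (rule CL2_L2norm_tendsto[OF u assms])
  have nb: "at t within {0..T} \<noteq> bot"
    using assms T by (simp add: at_within_Icc_at trivial_limit_within islimpt_Icc)
  show ?thesis
  proof (cases "t \<in> {0<..<T}")
    case False
    then have tt: "t = 0 \<or> t = T" using assms by auto
    have "\<forall>\<^sub>F s in at t within {0..T}. L2norm u0 = L2norm (u s)"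
      unfolding eventually_at
    proof (intro exI[of _ T] conjI ballI impI T)
      fix s assume "s \<in> {0..T}" "s \<noteq> t \<and> dist s t < T"
      then have "s \<in> {0<..<T}" using tt by (auto simp: dist_real_def)
      then show "L2norm u0 = L2norm (u s)" using int by simp
    qed
    then have "((\<lambda>s. L2norm (u s)) \<longlongrightarrow> L2norm u0) (at t within {0..T})"
      by (rule Lim_transform_eventually[OF tendsto_const])
    then show ?thesis using tendsto_unique[OF nb lim] by simp
  qed (rule int)
qed

end

lemma sN_le_of_SPsi_norm:
  assumes n: "SPsi_norm \<Psi> f \<le> ennreal M" and N: "N \<ge> 1" and p: "\<Psi> (real N) > 0" and M: "M \<ge> 0"
  shows "sN f N \<le> ennreal (M * \<Psi> (real N))"
proof -
  have "sN f N / ennreal (\<Psi> (real N)) \<le> SPsi_norm \<Psi> f"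
    unfolding SPsi_norm_def by (rule SUP_upper) (use N in auto)
  then have "sN f N / ennreal (\<Psi> (real N)) \<le> ennreal M" using n by simp
  then have "sN f N / ennreal (\<Psi> (real N)) * ennreal (\<Psi> (real N)) \<le> ennreal M * ennreal (\<Psi> (real N))"
    by (intro mult_right_mono) auto
  moreover have "sN f N / ennreal (\<Psi> (real N)) * ennreal (\<Psi> (real N)) = sN f N"
    using p by (simp add: ennreal_divide_times ennreal_times_divide mult_divide_eq_ennreal mult.commute)
  ultimately show ?thesis using M p by (simp add: ennreal_mult)
qed

theorem theorem1p14:
  fixes T :: real
    and u :: "real \<Rightarrow> pt \<Rightarrow> real \<times> real"
    and u0 :: "pt \<Rightarrow> real \<times> real"
    and ue :: "real \<Rightarrow> real \<Rightarrow> pt \<Rightarrow> real \<times> real"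
    and pe :: "real \<Rightarrow> real \<Rightarrow> pt \<Rightarrow> real"
  assumes "T > 0"
    and "euler_weak T u u0"
    and "physical_realization T u u0 ue pe"
    and "admissible_sparse_stability T ue"
  shows "\<forall>t\<in>{0..T}. L2norm (u t) = L2norm u0"
proof -
  obtain \<Psi> M where dec: "decay \<Psi>"
    and bd: "\<And>eps t. eps > 0 \<Longrightarrow> t \<in> {0<..<T} \<Longrightarrow> SPsi_norm \<Psi> (vorticity (ue eps) t) \<le> ennreal M"
    using assms(4) unfolding admissible_sparse_stability_def admissible_decay_def by blast
  \<comment> \<open>\<open>ennreal M\<close> is 0 for negative \<open>M\<close>; the truncation
    gives the same bound with a nonnegative constant.\<close>
  define K where "K = max M 0"
  \<comment> \<open>The index is \<open>Suc N\<close> because \<open>sN f (Suc N)\<close> is the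
    seminorm that sees exactly the levels from \<open>N\<close> on; 8/3 is the constant of
    \<open>dyadic_sum_le_sN\<close>.\<close>
  define b where "b = (\<lambda>N. 8 / 3 * (K * \<Psi> (real (Suc N)))\<^sup>2)"
  have ns: "NS_solution eps T (ue eps) (pe eps)" if "eps > 0" for eps
    using assms(3) that by (auto simp: physical_realization_def)
  interpret realization T u u0 ue pe b
  proof
    show "CL2 T u" "L2_field u0" using assms(2) by (auto simp: euler_weak_def)
    show "weak_star_conv T ue u" "((\<lambda>eps. L2norm (\<lambda>x. ue eps 0 x - u0 x)) \<longlongrightarrow> 0) (at_right 0)"
      using assms(3) by (auto simp: physical_realization_def)
    have "(\<Psi> \<longlongrightarrow> 0) at_top" using dec by (simp add: decay_def)
    then have "(\<lambda>N. \<Psi> (real (Suc N))) \<longlonglongrightarrow> 0"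
      by (rule filterlim_compose[OF _ filterlim_compose[OF filterlim_real_sequentially filterlim_Suc]])
    then have "b \<longlonglongrightarrow> 8 / 3 * (K * 0)\<^sup>2" unfolding b_def by (intro tendsto_intros)
    then show "b \<longlonglongrightarrow> 0" by simp
    fix eps t :: real and L N :: nat assume eps: "eps > 0" and t: "t \<in> {0<..<T}"
    have c: "continuous_on UNIV (vorticity (ue eps) t)"
      by (rule has_partialsD(3)[OF ns_flow.w[OF NS_ns_flow[OF ns[OF eps] eps] t]])
    have pos: "\<Psi> (real (Suc N)) > 0" using dec by (simp add: decay_def)
    have "SPsi_norm \<Psi> (vorticity (ue eps) t) \<le> ennreal K"
      using bd[OF eps t] by (rule order_trans) (simp add: K_def ennreal_leI)
    then have "sN (vorticity (ue eps) t) (Suc N) \<le> ennreal (K * \<Psi> (real (Suc N)))"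
      by (rule sN_le_of_SPsi_norm) (use pos in \<open>auto simp: K_def\<close>)
    from dyadic_sum_le_sN[OF c this, of L] pos
    show "(\<Sum>i\<le>L. dyadic_energy (vorticity (ue eps) t) (N + i)) \<le> b N"
      by (simp add: dyadic_energy_def b_def K_def)
  qed (use assms(1) ns in auto)
  show ?thesis using conservative by blast
qed

end
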